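(* Let $\Gamma\subset\mathbb{R}^3$ be a smooth closed surface discretized by a shape-regular family of curved meshes $\{\mathcal{T}_h\}_{h>0}$ with mesh size $h$, and let $Q_\Gamma$ be a composite quadrature rule on $\Gamma$ of degree of exactness $\mathfrak{q}$. Let $\varphi\in C^{\mathfrak{q}+1}(\Gamma)$, $x\in\Gamma$, $k>0$, and let $\mathsf{B}\in\{\mathsf{S},\mathsf{K},\mathsf{K}^\top,\mathsf{H},\mathsf{W}\}$ with associated parameters $(p,s)$ given by $(0,0)$ for $\mathsf{S}$, $(1,0)$ for $\mathsf{K}$ and $\mathsf{K}^\top$, $(2,1)$ for $\mathsf{H}$, and $(2,0)$ for $\mathsf{W}$. Let $f_\delta$ denote the regularized integrand for $\mathsf{B}[\varphi](x)$ with regularization parameter $\delta\in(0,1)$, and suppose the regularization error satisfies $E_r(\delta,k)=\mathcal{O}(\delta^{\mathfrak{m}})$ as $\delta\to0$. 1. (Discretization error bound.) There exist constants $C_\sigma$, $C_\Phi$, $C_\Psi$, depending on $k$, $\Gamma$ and $\mathfrak{q}$ but independent of $h$ and $\delta$, such that $$ \left|\int_\Gamma f_\delta\,\mathrm{d}s-Q_\Gamma[f_\delta]\right|\lesssim C_\sigma C_\Phi C_\Psi\,\|\varphi\|_{C^{\mathfrak{q}+1}(\Gamma)}\,h^{\mathfrak{q}+1}\times \begin{cases}\delta^{-(\mathfrak{q}+1)}, & p=s,\\ \delta^{-(\mathfrak{q}+2(p-s))}, & p>s.\end{cases} $$ 2. (Optimal regularization parameter.) Setting $\delta\propto h^{\mu^\star}$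 with $$ \mu^\star(p,s)=\begin{cases}\dfrac{\mathfrak{q}+1}{\mathfrak{q}+1+\mathfrak{m}}, & p=s,\\[2mm] \dfrac{\mathfrak{q}+1}{\mathfrak{q}+2(p-s)+\mathfrak{m}}, & p>s,\end{cases} $$ balances the discretization and regularization errors (i.e. makes the orders in $h$ of the two error bounds equal), yielding a total error $E=E_r+E_d=\mathcal{O}(h^{\mathfrak{o}^\star})$ with overall convergence rate $\mathfrak{o}^\star(p,s)=\mu^\star(p,s)\cdot\mathfrak{m}$.
   Context: **Operators and singular integrands.** $\nu$ is the outward unit normal to $\Gamma$, and "p.f." denotes the Hadamard finite part. For each operator $\mathsf{B}$ the singular integrand at the target point $x\in\Gamma$ is $$f(y)=\frac{\Phi(k|x-y|)}{|x-y|^{2p+1}}\Psi(x,y)\varphi(y),\qquad y\in\Gamma,$$ with the following data (this is the singular part of the Helmholtz kernel, up to the factor $1/(4\pi)$): - $\mathsf{S}$ (single layer): $p=0$, $\Phi(r)=\cos r$, $\Psi(x,y)=1$. - $\mathsf{K}$ (double layer): $p=1$, $\Phi(r)=\cos r+r\sin r$, $\Psi(x,y)=\nu(y)\cdot(x-y)$. - $\mathsf{K}^\top$ (adjoint double layer): $p=1$, $\Phi(r)=\cos r+r\sin r$, $\Psi(x,y)=\nu(x)\cdot(y-x)$. - $\mathsf{H}$ (hypersingular part of the hypersingular operator $\mathsf{T}=\mathsf{H}+\mathsf{W}$): $p=2$, $\Phi(r)=\cos r+r\sin r$, $\Psi(x,y)=|x-y|^2\,\nu(y)\cdot\nu(x)$.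 - $\mathsf{W}$ (weakly singular part of $\mathsf{T}$): $p=2$, $\Phi(r)=(r^2-3)\cos r-3r\sin r$, $\Psi(x,y)=[(x-y)\cdot\nu(y)]\,[(x-y)\cdot\nu(x)]$. The parameter $s$ is such that $\Psi(x,y)/|x-y|^{2s}$ is smooth on $\Gamma\times\Gamma$. **Regularized integrand.** $$f_\delta(y)=\frac{\Phi(k|x-y|)}{|x-y|^{2p+1}}\,\sigma_p\!\left(\frac{|x-y|}{\delta}\right)\Psi(x,y)\varphi(y),\qquad y\in\Gamma$$ (extended by its limit to $y=x$), where $$\sigma_p(t)=\operatorname{erf}(t)+\frac{2}{\sqrt\pi}e^{-t^2}P_p(t),\qquad P_p(t)=t^{2p}\sum_{\ell=1}^n a_\ell t^{2\ell-1}+\begin{cases}0,&p=0,\\-t,&p=1,\\-t-\tfrac23t^3,&p=2.\end{cases}$$ The coefficients $a_\ell=a_\ell(\varkappa)$, with $\varkappa=\delta k$, are chosen so that the moment conditions $$\mathrm{p.f.}\int_0^\infty\Phi(\varkappa t)\,(1-\sigma_p(t))\,t^{2(j-p)}\,\mathrm{d}t=0,\qquad j=j_0,\dots,m-1,$$ hold, where $j_0=0$ for $\mathsf{S}$, $j_0=1$ for $\mathsf{K},\mathsf{K}^\top,\mathsf{H}$ and $j_0=2$ for $\mathsf{W}$. The regularization order associated with $m$ is $\mathfrak{m}=2(m-p)+1$. (The $n$ unknowns are determined by this linear system, which may be underdetermined, in which case it is solved by the pseudoinverse.) **Errors.** $E_r(\delta,k)=\mathrm{p.f.}\int_\Gamma(f-f_\delta)\,\mathrm{d}s$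 is the regularization error, $E_d(h,k)=\int_\Gamma f_\delta\,\mathrm{d}s-Q_\Gamma[f_\delta]$ the discretization error, and $E=E_r+E_d$ the total error. **Meshes and quadrature.** Each mesh $\mathcal{T}_h$ is a tessellation $\Gamma=\bigcup_{T\in\mathcal{T}_h}T$, where each element $T$ is the image of a fixed reference element $\widehat T$ under a smooth parametrization $F_T:\widehat T\to T\subset\Gamma$; $h=\max_{T\in\mathcal{T}_h}\operatorname{diam}(T)$. Write $J_T=|\partial_{\hat x_1}F_T\times\partial_{\hat x_2}F_T|$ for the surface Jacobian. The family $\{\mathcal{T}_h\}$ is shape-regular and quasi-uniform, and the parametrizations are uniformly regular, in the following sense, with all constants independent of $h$ and $T$: (i) shape-regularity: the ratio of the largest to the smallest singular value of the $3\times2$ Jacobian matrix of $F_T$ is bounded on $\widehat T$ by a constant; (ii) quasi-uniformity: $h\le C\operatorname{diam}(T)$ for all $T\in\mathcal{T}_h$; (iii) regularity of the parametrizations: there are constants $c,C>0$ with $c h^2\le J_T(\hat x)\le Ch^2$ for all $\hat x\in\widehat T$, and for every multi-index $\alpha$ with $|\alpha|\ge1$ there is a constant $C_\alpha$ with $|\partial^\alpha F_T|\le C_\alpha h^{|\alpha|}$ on $\widehat T$. Given a fixed rule with nodes $\hat x_j\in\widehat T$ and positive weights $w_j$, $j=1,\dots,N_Q$, of degree of exactness $\mathfrak{q}$ (exact for all polynomials of total degree $\le\mathfrak{q}$ on $\widehat T$), set $Q_T[\psi]=\sum_{j}w_j\,\psi(F_T(\hat x_j))\,J_T(\hat x_j)$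 and $Q_\Gamma[\psi]=\sum_{T\in\mathcal{T}_h}Q_T[\psi]$. Under these assumptions one has the standard local estimate: $|\int_T\psi\,\mathrm{d}s-Q_T[\psi]|\le C\,h_T^{r+2}\|\psi\|_{C^r(T)}$ for $r\in\{0,\dots,\mathfrak{q}+1\}$, $h_T=\operatorname{diam}(T)$, and sufficiently smooth $\psi$, with $C$ independent of $h$ and $T$. **Conventions.** $\lesssim$ hides constants that may depend on $\mathfrak{q}$, $\Gamma$, the quadrature rule and the mesh regularity, but not on $h$, $\delta$, $k$. The constant implicit in $E_r=\mathcal{O}(\delta^{\mathfrak{m}})$ is independent of $\delta$. The surface $\Gamma$ and density are assumed to be as smooth as needed (for simplicity, analytic).
   Formalization: The coefficients a_l(δk) are assumed bounded and δ restricted to (0,δ0), δ0≤1, since they can blow up inside (0,1); for H with q=0 the bound in part 1 is claimed only for h≤δ, as it fails when h/δ is unbounded; the regularization order is taken positive (m≥p). *)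

theory Defs
  imports "HOL-Analysis.Analysis" "HOL-Library.Landau_Symbols"
begin

section \<open>Differentiability classes\<close>

primrec Ck :: "nat \<Rightarrow> 'a::real_normed_vector set \<Rightarrow> ('a \<Rightarrow> 'b::real_normed_vector) \<Rightarrow> bool" where
  "Ck 0 S f = continuous_on S f"
| "Ck (Suc r) S f = ((\<forall>x\<in>S. f differentiable (at x)) \<and>
     (\<forall>v. Ck r S (\<lambda>x. frechet_derivative f (at x) v)))"

text \<open>Only used for open \<open>S\<close>.\<close>

definition smooth :: "'a::real_normed_vector set \<Rightarrow> ('a \<Rightarrow> 'b::real_normed_vector) \<Rightarrow> bool" where
  "smooth S f \<longleftrightarrow> (\<forall>r. Ck r S f)"

text \<open>A multi-index of order \<open>r\<close> is given by the list of the \<open>r\<close> coordinate directions in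
  which one differentiates.\<close>

primrec partials :: "'n::finite list \<Rightarrow> (real^'n \<Rightarrow> 'b::real_normed_vector) \<Rightarrow> real^'n \<Rightarrow> 'b" where
  "partials [] f = f"
| "partials (i # \<alpha>) f = (\<lambda>x. frechet_derivative (partials \<alpha> f) (at x) (axis i 1))"

text \<open>A function on a compact smooth surface \<open>S\<close> is of class \<open>C\<^sup>r\<close> iff it extends to a \<open>C\<^sup>r\<close>
  function on a neighbourhood of \<open>S\<close>. The norm below is the induced quotient norm: the infimum,
  over all such extensions, of the largest partial derivative of order at most \<open>r\<close> on \<open>S\<close>. It is
  equivalent to the norms defined through a finite atlas (the extension that is constant along
  the normals attains the latter up to a constant), but does not depend on a choice of atlas.\<close>

definition Ck_extension ::
    "nat \<Rightarrow> (real^'n::finite) set \<Rightarrow> (real^'n \<Rightarrow> 'b::real_normed_vector) \<Rightarrow> (real^'n \<Rightarrow> 'b) \<Rightarrow> bool" where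
  "Ck_extension r S f g \<longleftrightarrow> (\<exists>V. open V \<and> S \<subseteq> V \<and> Ck r V g) \<and> (\<forall>y\<in>S. g y = f y)"

definition Ck_surface ::
    "nat \<Rightarrow> (real^'n::finite) set \<Rightarrow> (real^'n \<Rightarrow> 'b::real_normed_vector) \<Rightarrow> bool" where
  "Ck_surface r S f \<longleftrightarrow> (\<exists>g. Ck_extension r S f g)"

definition Ck_norm ::
    "nat \<Rightarrow> (real^'n::finite) set \<Rightarrow> (real^'n \<Rightarrow> 'b::real_normed_vector) \<Rightarrow> real" where
  "Ck_norm r S f = Inf {b. \<exists>g. Ck_extension r S f g \<and>
     (\<forall>\<alpha>. length \<alpha> \<le> r \<longrightarrow> (\<forall>y\<in>S. norm (partials \<alpha> g y) \<le> b))}"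

section \<open>Surfaces\<close>

definition surf_jac :: "(real^2 \<Rightarrow> real^3) \<Rightarrow> real^2 \<Rightarrow> real" where
  "surf_jac F u = norm (cross3 (partials [1] F u) (partials [2] F u))"

definition surface_param :: "(real^3) set \<Rightarrow> (real^2) set \<Rightarrow> (real^2 \<Rightarrow> real^3) \<Rightarrow> bool" where
  "surface_param \<Gamma> U F \<longleftrightarrow> open U \<and> smooth U F \<and> inj_on F U \<and> F ` U \<subseteq> \<Gamma> \<and>
     (\<forall>u\<in>U. surf_jac F u \<noteq> 0)"

definition smooth_closed_surface :: "(real^3) set \<Rightarrow> bool" where
  "smooth_closed_surface \<Gamma> \<longleftrightarrow> compact \<Gamma> \<and>
     (\<forall>y\<in>\<Gamma>. \<exists>U F G. surface_param \<Gamma> U F \<and> y \<in> F ` U \<and>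
        openin (top_of_set \<Gamma>) (F ` U) \<and> homeomorphism U (F ` U) F G)"

text \<open>\<open>inside \<Gamma>\<close> and \<open>outside \<Gamma>\<close> are the unions of the bounded and of the unbounded components of
  the complement of \<open>\<Gamma>\<close>.\<close>

definition outward_unit_normal :: "(real^3) set \<Rightarrow> (real^3 \<Rightarrow> real^3) \<Rightarrow> bool" where
  "outward_unit_normal \<Gamma> \<nu> \<longleftrightarrow>
     (\<exists>V N. open V \<and> \<Gamma> \<subseteq> V \<and> smooth V N \<and> (\<forall>y\<in>\<Gamma>. N y = \<nu> y)) \<and>
     (\<forall>y\<in>\<Gamma>. norm (\<nu> y) = 1) \<and>
     (\<forall>U F u v. surface_param \<Gamma> U F \<and> u \<in> U \<longrightarrow> \<nu> (F u) \<bullet> frechet_derivative F (at u) v = 0) \<and>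
     (\<forall>y\<in>\<Gamma>. \<forall>\<^sub>F t in at_right 0. y + t *\<^sub>R \<nu> y \<in> outside \<Gamma> \<and> y - t *\<^sub>R \<nu> y \<in> inside \<Gamma>)"

text \<open>The surface measure is the unique Borel measure on \<open>\<Gamma>\<close> given by \<open>\<integral> J\<^sub>F du\<close> in every regular
  parametrization.\<close>

definition surface_measure :: "(real^3) set \<Rightarrow> (real^3) measure \<Rightarrow> bool" where
  "surface_measure \<Gamma> ds \<longleftrightarrow> sets ds = sets (restrict_space borel \<Gamma>) \<and>
     (\<forall>U F A. surface_param \<Gamma> U F \<and> A \<in> sets ds \<and> A \<subseteq> F ` U \<longrightarrow>
        emeasure ds A = (\<integral>\<^sup>+u\<in>{u\<in>U. F u \<in> A}. ennreal (surf_jac F u) \<partial>lborel))"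

section \<open>Meshes and quadrature\<close>

definition reference_element :: "(real^2) set \<Rightarrow> bool" where
  "reference_element Th \<longleftrightarrow> compact Th \<and> convex Th \<and> interior Th \<noteq> {}"

definition max_singular_value :: "(real^2 \<Rightarrow> real^3) \<Rightarrow> real^2 \<Rightarrow> real" where
  "max_singular_value F u = (SUP v\<in>sphere 0 1. norm (frechet_derivative F (at u) v))"

definition min_singular_value :: "(real^2 \<Rightarrow> real^3) \<Rightarrow> real^2 \<Rightarrow> real" where
  "min_singular_value F u = (INF v\<in>sphere 0 1. norm (frechet_derivative F (at u) v))"

text \<open>A mesh is the finite set of its parametrizations; the elements are the images of \<open>Th\<close>.\<close>

definition tessellation :: "(real^3) set \<Rightarrow> (real^2) set \<Rightarrow> (real^2 \<Rightarrow> real^3) set \<Rightarrow> bool" where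
  "tessellation \<Gamma> Th M \<longleftrightarrow> finite M \<and>
     (\<forall>F\<in>M. (\<exists>V. open V \<and> Th \<subseteq> V \<and> smooth V F) \<and> inj_on F Th) \<and>
     \<Gamma> = (\<Union>F\<in>M. F ` Th) \<and>
     pairwise (\<lambda>F G. disjnt (F ` interior Th) (G ` interior Th)) M"

definition mesh_size :: "(real^2) set \<Rightarrow> (real^2 \<Rightarrow> real^3) set \<Rightarrow> real" where
  "mesh_size Th M = Max ((\<lambda>F. diameter (F ` Th)) ` M)"

text \<open>\<open>reg_s\<close>, \<open>reg_u\<close>, \<open>reg_lo\<close>, \<open>reg_hi\<close>, \<open>reg_D\<close> are the constants of shape-regularity,
  quasi-uniformity and of the regularity of the parametrizations.\<close>

definition regular_mesh ::
    "(real^3) set \<Rightarrow> (real^2) set \<Rightarrow> real \<Rightarrow> real \<Rightarrow> real \<Rightarrow> real \<Rightarrow> (2 list \<Rightarrow> real) \<Rightarrow>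
     real \<Rightarrow> (real^2 \<Rightarrow> real^3) set \<Rightarrow> bool" where
  "regular_mesh \<Gamma> Th reg_s reg_u reg_lo reg_hi reg_D h M \<longleftrightarrow>
     tessellation \<Gamma> Th M \<and> h = mesh_size Th M \<and>
     (\<forall>F\<in>M. \<forall>u\<in>Th. max_singular_value F u \<le> reg_s * min_singular_value F u) \<and>
     (\<forall>F\<in>M. h \<le> reg_u * diameter (F ` Th)) \<and>
     (\<forall>F\<in>M. \<forall>u\<in>Th. reg_lo * h^2 \<le> surf_jac F u \<and> surf_jac F u \<le> reg_hi * h^2) \<and>
     (\<forall>F\<in>M. \<forall>\<alpha>. \<alpha> \<noteq> [] \<longrightarrow> (\<forall>u\<in>Th. norm (partials \<alpha> F u) \<le> reg_D \<alpha> * h ^ length \<alpha>))"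

definition poly2 :: "nat \<Rightarrow> (nat \<Rightarrow> nat \<Rightarrow> real) \<Rightarrow> real^2 \<Rightarrow> real" where
  "poly2 q c u = (\<Sum>i\<le>q. \<Sum>j\<le>q - i. c i j * (u $ 1)^i * (u $ 2)^j)"

definition quadrature_rule ::
    "(real^2) set \<Rightarrow> nat \<Rightarrow> nat \<Rightarrow> (nat \<Rightarrow> real^2) \<Rightarrow> (nat \<Rightarrow> real) \<Rightarrow> bool" where
  "quadrature_rule Th q NQ xq w \<longleftrightarrow>
     (\<forall>j\<in>{1..NQ}. xq j \<in> Th \<and> 0 < w j) \<and>
     (\<forall>c. (\<Sum>j=1..NQ. w j * poly2 q c (xq j)) = (LINT u:Th|lborel. poly2 q c u))"

definition surface_quadrature ::
    "nat \<Rightarrow> (nat \<Rightarrow> real^2) \<Rightarrow> (nat \<Rightarrow> real) \<Rightarrow> (real^2 \<Rightarrow> real^3) set \<Rightarrow>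
     (real^3 \<Rightarrow> complex) \<Rightarrow> complex" where
  "surface_quadrature NQ xq w M \<psi> =
     (\<Sum>F\<in>M. \<Sum>j=1..NQ. (w j * surf_jac F (xq j)) *\<^sub>R \<psi> (F (xq j)))"

section \<open>Hadamard finite part\<close>

text \<open>\<open>A \<epsilon>\<close> is the integral truncated at distance \<open>\<epsilon>\<close> from the singularity; the finite part is
  what remains after removing the divergent terms in \<open>\<epsilon>\<^sup>-\<^sup>i\<close> and \<open>ln \<epsilon>\<close>.\<close>

definition has_finite_part :: "(real \<Rightarrow> 'b::real_normed_vector) \<Rightarrow> 'b \<Rightarrow> bool" where
  "has_finite_part A I \<longleftrightarrow> (\<exists>N c b.
     ((\<lambda>\<epsilon>. A \<epsilon> - (\<Sum>i=1..N. (1 / \<epsilon>^i) *\<^sub>R c i) - ln \<epsilon> *\<^sub>R b) \<longlongrightarrow> I) (at_right 0))"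

definition finite_part :: "(real \<Rightarrow> 'b::real_normed_vector) \<Rightarrow> 'b" where
  "finite_part A = (THE I. has_finite_part A I)"

section \<open>Operators and integrands\<close>

datatype layer_op = SL | DL | ADL | HS | WS

primrec op_p :: "layer_op \<Rightarrow> nat" where
  "op_p SL = 0" | "op_p DL = 1" | "op_p ADL = 1" | "op_p HS = 2" | "op_p WS = 2"

primrec op_s :: "layer_op \<Rightarrow> nat" where
  "op_s SL = 0" | "op_s DL = 0" | "op_s ADL = 0" | "op_s HS = 1" | "op_s WS = 0"

primrec op_j0 :: "layer_op \<Rightarrow> nat" where
  "op_j0 SL = 0" | "op_j0 DL = 1" | "op_j0 ADL = 1" | "op_j0 HS = 1" | "op_j0 WS = 2"

primrec op_\<Phi> :: "layer_op \<Rightarrow> real \<Rightarrow> real" where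
  "op_\<Phi> SL r = cos r"
| "op_\<Phi> DL r = cos r + r * sin r"
| "op_\<Phi> ADL r = cos r + r * sin r"
| "op_\<Phi> HS r = cos r + r * sin r"
| "op_\<Phi> WS r = (r^2 - 3) * cos r - 3 * r * sin r"

primrec op_\<Psi> :: "layer_op \<Rightarrow> (real^3 \<Rightarrow> real^3) \<Rightarrow> real^3 \<Rightarrow> real^3 \<Rightarrow> real" where
  "op_\<Psi> SL \<nu> x y = 1"
| "op_\<Psi> DL \<nu> x y = \<nu> y \<bullet> (x - y)"
| "op_\<Psi> ADL \<nu> x y = \<nu> x \<bullet> (y - x)"
| "op_\<Psi> HS \<nu> x y = (norm (x - y))^2 * (\<nu> y \<bullet> \<nu> x)"
| "op_\<Psi> WS \<nu> x y = ((x - y) \<bullet> \<nu> y) * ((x - y) \<bullet> \<nu> x)"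

definition erf :: "real \<Rightarrow> real" where
  "erf t = 2 / sqrt pi * (LBINT u=0..t. exp (- (u^2)))"

definition reg_P :: "nat \<Rightarrow> nat \<Rightarrow> (nat \<Rightarrow> real) \<Rightarrow> real \<Rightarrow> real" where
  "reg_P p n c t = t^(2*p) * (\<Sum>l=1..n. c l * t^(2*l - 1)) +
     (if p = 0 then 0 else if p = 1 then - t else - t - 2/3 * t^3)"

definition reg_\<sigma> :: "nat \<Rightarrow> nat \<Rightarrow> (nat \<Rightarrow> real) \<Rightarrow> real \<Rightarrow> real" where
  "reg_\<sigma> p n c t = erf t + 2 / sqrt pi * exp (- (t^2)) * reg_P p n c t"

definition moment_conditions :: "layer_op \<Rightarrow> nat \<Rightarrow> nat \<Rightarrow> real \<Rightarrow> (nat \<Rightarrow> real) \<Rightarrow> bool" where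
  "moment_conditions B n m \<kappa> c \<longleftrightarrow> (\<forall>j\<in>{op_j0 B..<m}.
     has_finite_part (\<lambda>\<epsilon>. LINT t:{\<epsilon>..}|lborel.
       op_\<Phi> B (\<kappa> * t) * (1 - reg_\<sigma> (op_p B) n c t) * t powi (2 * (int j - int (op_p B)))) 0)"

text \<open>The pseudoinverse solution of a consistent linear system is its solution of least
  Euclidean norm.\<close>

definition reg_coeffs :: "layer_op \<Rightarrow> nat \<Rightarrow> nat \<Rightarrow> real \<Rightarrow> (nat \<Rightarrow> real) \<Rightarrow> bool" where
  "reg_coeffs B n m \<kappa> c \<longleftrightarrow> moment_conditions B n m \<kappa> c \<and>
     (\<forall>d. moment_conditions B n m \<kappa> d \<longrightarrow> (\<Sum>l=1..n. (c l)^2) \<le> (\<Sum>l=1..n. (d l)^2))"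

definition sing_integrand ::
    "layer_op \<Rightarrow> (real^3 \<Rightarrow> real^3) \<Rightarrow> real \<Rightarrow> (real^3 \<Rightarrow> complex) \<Rightarrow> real^3 \<Rightarrow> real^3 \<Rightarrow> complex" where
  "sing_integrand B \<nu> k \<phi> x y =
     (op_\<Phi> B (k * norm (x - y)) / norm (x - y) ^ (2 * op_p B + 1) * op_\<Psi> B \<nu> x y) *\<^sub>R \<phi> y"

text \<open>\<open>a \<kappa> l\<close> is the \<open>l\<close>-th coefficient at \<open>\<kappa> = \<delta> * k\<close>.\<close>

definition reg_integrand ::
    "(real^3) set \<Rightarrow> layer_op \<Rightarrow> (real^3 \<Rightarrow> real^3) \<Rightarrow> nat \<Rightarrow> (real \<Rightarrow> nat \<Rightarrow> real) \<Rightarrow> real \<Rightarrow>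
     (real^3 \<Rightarrow> complex) \<Rightarrow> real^3 \<Rightarrow> real \<Rightarrow> real^3 \<Rightarrow> complex" where
  "reg_integrand \<Gamma> B \<nu> n a k \<phi> x \<delta> =
     (let g = (\<lambda>y. reg_\<sigma> (op_p B) n (a (\<delta> * k)) (norm (x - y) / \<delta>) *\<^sub>R sing_integrand B \<nu> k \<phi> x y)
      in (\<lambda>y. if y = x then Lim (at x within \<Gamma>) g else g y))"

definition reg_error ::
    "(real^3) set \<Rightarrow> (real^3) measure \<Rightarrow> layer_op \<Rightarrow> (real^3 \<Rightarrow> real^3) \<Rightarrow> nat \<Rightarrow>
     (real \<Rightarrow> nat \<Rightarrow> real) \<Rightarrow> real \<Rightarrow> (real^3 \<Rightarrow> complex) \<Rightarrow> real^3 \<Rightarrow> real \<Rightarrow> complex" where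
  "reg_error \<Gamma> ds B \<nu> n a k \<phi> x \<delta> = finite_part (\<lambda>\<epsilon>. LINT y:(\<Gamma> - ball x \<epsilon>)|ds.
     sing_integrand B \<nu> k \<phi> x y - reg_integrand \<Gamma> B \<nu> n a k \<phi> x \<delta> y)"

definition disc_error ::
    "(real^3) set \<Rightarrow> (real^3) measure \<Rightarrow> layer_op \<Rightarrow> (real^3 \<Rightarrow> real^3) \<Rightarrow> nat \<Rightarrow>
     (real \<Rightarrow> nat \<Rightarrow> real) \<Rightarrow> real \<Rightarrow> (real^3 \<Rightarrow> complex) \<Rightarrow> real^3 \<Rightarrow>
     nat \<Rightarrow> (nat \<Rightarrow> real^2) \<Rightarrow> (nat \<Rightarrow> real) \<Rightarrow> (real^2 \<Rightarrow> real^3) set \<Rightarrow> real \<Rightarrow> complex" where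
  "disc_error \<Gamma> ds B \<nu> n a k \<phi> x NQ xq w M \<delta> =
     (LINT y|ds. reg_integrand \<Gamma> B \<nu> n a k \<phi> x \<delta> y) -
     surface_quadrature NQ xq w M (reg_integrand \<Gamma> B \<nu> n a k \<phi> x \<delta>)"

definition reg_order :: "nat \<Rightarrow> nat \<Rightarrow> real" where
  "reg_order m p = 2 * (real m - real p) + 1"

definition disc_rate :: "nat \<Rightarrow> nat \<Rightarrow> nat \<Rightarrow> real \<Rightarrow> real \<Rightarrow> real" where
  "disc_rate q p s h \<delta> = h^(q + 1) *
     (if p = s then \<delta> powr (- (real q + 1)) else \<delta> powr (- (real q + 2 * (real p - real s))))"

definition mu_star :: "nat \<Rightarrow> nat \<Rightarrow> nat \<Rightarrow> nat \<Rightarrow> real" where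
  "mu_star q m p s =
     (if p = s then (real q + 1) / (real q + 1 + reg_order m p)
      else (real q + 1) / (real q + 2 * (real p - real s) + reg_order m p))"

end

theory Submission
  imports Defs
begin

text \<open>
Up to a constant, the regularized integrand is \<open>\<delta>\<^bsup>-(2d+1)\<^esup> g(|x-y|\<^sup>2/\<delta>\<^sup>2)\<close> times a smooth function of
\<open>y\<close>, with \<open>d = p - s\<close> and an entire function \<open>g\<close>. The reason is the identity
\<open>erf t - 2/sqrt \<pi> e\<^bsup>-t^2\<^esup> (t + 2/3 t\<^sup>3 + \<dots>) = const t\<^bsup>2p+1\<^esup> G\<^sub>p(t\<^sup>2)\<close> with
\<open>G\<^sub>p(s) = \<integral>\<^sub>0\<^sup>1 v\<^bsup>2p\<^esup> e\<^bsup>-s v^2\<^esup> dv\<close> and \<open>p\<close> terms in the parentheses: the correction terms in \<open>\<sigma>\<^sub>p\<close> cancel the singularity exactly.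
As \<open>G\<^sub>p' = - G\<^bsub>p+1\<^esub>\<close> and \<open>G\<^sub>p(s) \<le> C\<^sub>p (1+s)\<^bsup>-p\<^esup>\<close>, each derivative in \<open>y\<close> costs a factor
\<open>1/(\<delta>+|x-y|)\<close>, so that a derivative of order \<open>i\<close> of the integrand is of size
\<open>\<delta>\<^bsup>-1\<^esup> (\<delta>+|x-y|)\<^bsup>-2d-i\<^esup>\<close> (lemma \<open>reg_density_bounds\<close>).

On an element \<open>T\<close> the rule is exact for the Taylor polynomial of degree \<open>q\<close> of the pulled-back
integrand, and each derivative in the reference coordinates carries a factor \<open>h\<close>. The error on \<open>T\<close> is therefore at most
\<open>h\<^sup>2 h\<^bsup>q+1\<^esup>\<close> times the derivative of order \<open>q+1\<close> (lemma \<open>element_quadrature_error\<close>). If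
\<open>\<delta>+|x-y|\<close> varies only by a bounded factor on each element, the sum over the mesh is comparable with
\<open>h\<^bsup>q+1\<^esup> \<integral> \<delta>\<^bsup>-1\<^esup> (\<delta>+|x-y|)\<^bsup>-2d-q-1\<^esup> ds\<close>. The area of \<open>\<Gamma>\<close> in a ball of radius \<open>R\<close> is \<open>O(R\<^sup>2)\<close>.
Hence the integral is smaller than the supremum \<open>\<delta>\<^bsup>-2d-q-2\<^esup>\<close> of its integrand by a factor \<open>\<delta>\<^sup>2\<close> when
\<open>d > 0\<close>; when \<open>d = 0\<close>, only the factor \<open>\<delta>\<close> is used, because for \<open>q = 0\<close> the decay is too slow for more. These are
the two cases of the stated rate. The variation of \<open>\<delta>+|x-y|\<close> on an element is large only if \<open>h > \<delta>\<close>, for elements within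
distance \<open>h\<close> of \<open>x\<close>. There are boundedly many of them, and on them the crude bound \<open>h\<^sup>2 sup |f\<^sub>\<delta>|\<close>
is smaller than the rate (lemma \<open>singular_order_rate_le\<close>); for the hypersingular operator this needs
\<open>q \<ge> 1\<close>.

The exponent \<open>\<mu>\<^sup>*\<close> solves a linear equation that equates the orders in \<open>h\<close> of the rate and of
\<open>\<delta>\<^bsup>\<mm>\<^esup>\<close>, and the total error is then estimated by composing both bounds with
\<open>\<delta> = c h\<^bsup>\<mu>\<^esup>\<close>.
\<close>

section \<open>Functions with geometrically bounded jets\<close>

text \<open>The derivatives of order \<open>i \<le> r\<close> on \<open>S\<close> are at most \<open>K L\<^sup>i\<close>, and they exist on \<open>V\<close>. The
recursion on one derivative at a time makes the product and chain rules simple inductions, because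
the pair \<open>(K, L)\<close> of a derivative is \<open>(K L, L)\<close>. The set \<open>S\<close> is separate from \<open>V\<close> so that bounds at a
single point, with \<open>K\<close> and \<open>L\<close> depending on it, are covered.\<close>

primrec jet_bounded ::
    "nat \<Rightarrow> 'a::euclidean_space set \<Rightarrow> 'a set \<Rightarrow> ('a \<Rightarrow> 'b::real_normed_vector) \<Rightarrow> real \<Rightarrow> real \<Rightarrow> bool" where
  "jet_bounded 0 V S f K L \<longleftrightarrow> (\<forall>x\<in>S. norm (f x) \<le> K)"
| "jet_bounded (Suc r) V S f K L \<longleftrightarrow> (\<forall>x\<in>V. f differentiable (at x)) \<and> (\<forall>x\<in>S. norm (f x) \<le> K) \<and>
     (\<forall>b\<in>Basis. jet_bounded r V S (\<lambda>x. frechet_derivative f (at x) b) (K * L) L)"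

lemma jet_boundedD:
  assumes "jet_bounded r V S f K L" "x \<in> S" shows "norm (f x) \<le> K"
  using assms by (cases r) auto

lemma jet_bounded_differentiable:
  assumes "jet_bounded r V S f K L" "0 < r" "x \<in> V" shows "f differentiable (at x)"
  using assms by (cases r) auto

lemma jet_bounded_cong:
  assumes "open V" "S \<subseteq> V" "\<And>x. x \<in> V \<Longrightarrow> f x = g x" "jet_bounded r V S f K L"
  shows "jet_bounded r V S g K L"
  using assms(3,4)
proof (induction r arbitrary: f g K)
  case 0
  then show ?case using assms(2) by (metis jet_bounded.simps(1) subset_iff)
next
  case (Suc r)
  have d: "f differentiable (at x)" if "x \<in> V" for x using Suc.prems that by simp
  have dg: "g differentiable (at x)" if "x \<in> V" for x
    using d[OF that] assms(1) that Suc.prems(1)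
    by (metis differentiable_def has_derivative_transform_within_open)
  have e: "frechet_derivative f (at x) = frechet_derivative g (at x)" if "x \<in> V" for x
    using frechet_derivative_transform_within_open[OF d[OF that] assms(1) that Suc.prems(1)] .
  have b: "norm (g x) \<le> K" if "x \<in> S" for x using Suc.prems assms(2) that by (metis jet_boundedD subset_iff)
  have "jet_bounded r V S (\<lambda>x. frechet_derivative g (at x) b) (K * L) L" if "b \<in> Basis" for b
    by (rule Suc.IH[of "\<lambda>x. frechet_derivative f (at x) b"]) (use e Suc.prems that in auto)
  then show ?case using dg b by simp
qed

text \<open>An explicit derivative replaces the choice made by \<open>frechet_derivative\<close>; on an open set the two agree.\<close>

lemma jet_bounded_SucI:
  assumes "open V" "S \<subseteq> V" "\<And>x. x \<in> V \<Longrightarrow> (f has_derivative f' x) (at x)"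
    "\<And>x. x \<in> S \<Longrightarrow> norm (f x) \<le> K"
    "\<And>b. b \<in> Basis \<Longrightarrow> jet_bounded r V S (\<lambda>x. f' x b) (K * L) L"
  shows "jet_bounded (Suc r) V S f K L"
proof -
  have e: "f' x = frechet_derivative f (at x)" if "x \<in> V" for x
    by (rule frechet_derivative_at[OF assms(3)[OF that]])
  have "jet_bounded r V S (\<lambda>x. frechet_derivative f (at x) b) (K * L) L" if "b \<in> Basis" for b
    by (rule jet_bounded_cong[OF assms(1,2) _ assms(5)[OF that]]) (simp add: e)
  then show ?thesis using assms(3,4) by (auto simp: differentiable_def)
qed

lemma jet_bounded_SucE:
  assumes "jet_bounded (Suc r) V S f K L" "b \<in> Basis"
  shows "jet_bounded r V S (\<lambda>x. frechet_derivative f (at x) b) (K * L) L"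
  using assms by simp

lemma jet_bounded_has_derivative:
  assumes "jet_bounded (Suc r) V S f K L" "x \<in> V"
  shows "(f has_derivative frechet_derivative f (at x)) (at x)"
  using assms by (simp add: frechet_derivative_works[symmetric])

lemma jet_bounded_mono:
  assumes "jet_bounded r V S f K L" "r' \<le> r" "open W" "W \<subseteq> V" "S' \<subseteq> S" "S' \<subseteq> W"
    "K \<le> K'" "0 \<le> L" "L \<le> L'"
  shows "jet_bounded r' W S' f K' L'"
proof (cases "S' = {}")
  case True
  have "jet_bounded r' W {} f K' L'" using assms(1-4)
  proof (induction r' arbitrary: r f K K')
    case (Suc r')
    then obtain r1 where r1: "r = Suc r1" "r' \<le> r1" by (metis Suc_le_D Suc_le_mono)
    show ?case using Suc.prems Suc.IH[OF _ r1(2) assms(3,4)] r1 by auto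
  qed simp
  then show ?thesis using True by simp
next
  case False
  then show ?thesis using assms(1,2,7)
  proof (induction r' arbitrary: r f K K')
    case 0
    then show ?case using jet_boundedD[OF 0(2)] assms(5) by force
  next
    case (Suc r')
    then obtain r1 where r1: "r = Suc r1" "r' \<le> r1" by (metis Suc_le_D Suc_le_mono)
    obtain x where x: "x \<in> S'" using False by auto
    then have "norm (f x) \<le> K" using jet_boundedD[OF Suc.prems(2)] assms(5) by auto
    then have "0 \<le> K" using norm_ge_zero order_trans by blast
    then have KL: "K * L \<le> K' * L'" using Suc.prems(4) assms(8,9) by (intro mult_mono) auto
    have a: "norm (f x) \<le> K'" if "x \<in> S'" for x
      using jet_boundedD[OF Suc.prems(2)] assms(5) that Suc.prems(4) by force
    have "jet_bounded r' W S' (\<lambda>x. frechet_derivative f (at x) b) (K' * L') L'" if "b \<in> Basis" for b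
      by (rule Suc.IH[OF False _ r1(2) KL]) (use Suc.prems(2) r1 that in auto)
    then show ?case using Suc.prems(2) r1 a assms(4) by auto
  qed
qed

lemma jet_bounded_const:
  assumes "open V" "S \<subseteq> V" "norm c \<le> K" "0 \<le> L"
  shows "jet_bounded r V S (\<lambda>x. c) K L"
  using assms(3)
proof (induction r arbitrary: c K)
  case (Suc r)
  have "0 \<le> K" using Suc.prems norm_ge_zero order_trans by blast
  show ?case
    by (rule jet_bounded_SucI[OF assms(1,2), where f' = "\<lambda>x v. 0"])
      (use Suc assms \<open>0 \<le> K\<close> in auto)
qed simp

lemma jet_bounded_affine:
  assumes "open V" "S \<subseteq> V" "bounded_linear f" "\<And>x. x \<in> S \<Longrightarrow> norm (c + f x) \<le> K"
    "\<And>b. b \<in> Basis \<Longrightarrow> norm (f b) \<le> K * L" "0 \<le> L"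
  shows "jet_bounded r V S (\<lambda>x. c + f x) K L"
proof (cases r)
  case (Suc n)
  show ?thesis unfolding Suc
    by (rule jet_bounded_SucI[OF assms(1,2), where f' = "\<lambda>x. f"])
      (use assms in \<open>auto intro!: jet_bounded_const derivative_eq_intros bounded_linear_imp_has_derivative\<close>)
qed (use assms in auto)

lemma jet_bounded_add:
  assumes "open V" "S \<subseteq> V" "jet_bounded r V S f K1 L" "jet_bounded r V S g K2 L"
  shows "jet_bounded r V S (\<lambda>x. f x + g x) (K1 + K2) L"
  using assms(3,4)
proof (induction r arbitrary: f g K1 K2)
  case 0
  then show ?case by (simp add: norm_triangle_mono)
next
  case (Suc r)
  note d = jet_bounded_has_derivative[OF Suc.prems(1)] jet_bounded_has_derivative[OF Suc.prems(2)]
  show ?case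
  proof (rule jet_bounded_SucI[OF assms(1,2)])
    show "((\<lambda>x. f x + g x) has_derivative
      (\<lambda>v. frechet_derivative f (at x) v + frechet_derivative g (at x) v)) (at x)" if "x \<in> V" for x
      using has_derivative_add[OF d(1)[OF that] d(2)[OF that]] .
    show "norm (f x + g x) \<le> K1 + K2" if "x \<in> S" for x
      using jet_boundedD[OF Suc.prems(1) that] jet_boundedD[OF Suc.prems(2) that]
      by (simp add: norm_triangle_mono)
    show "jet_bounded r V S (\<lambda>x. frechet_derivative f (at x) b + frechet_derivative g (at x) b)
        ((K1 + K2) * L) L" if "b \<in> Basis" for b
      using Suc.IH[OF jet_bounded_SucE[OF Suc.prems(1) that] jet_bounded_SucE[OF Suc.prems(2) that]]
      by (simp add: algebra_simps)
  qed
qed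

lemma jet_bounded_sum:
  assumes "open V" "S \<subseteq> V" "0 \<le> L" "\<And>i. i \<in> I \<Longrightarrow> jet_bounded r V S (f i) (K i) L"
  shows "jet_bounded r V S (\<lambda>x. \<Sum>i\<in>I. f i x) (\<Sum>i\<in>I. K i) L"
proof (cases "finite I")
  case True
  then show ?thesis using assms(4)
    by (induction I) (auto intro!: jet_bounded_add jet_bounded_const assms(1-3))
qed (auto intro!: jet_bounded_const assms)

text \<open>In the Leibniz rule the binomial sum of \<open>L1\<^bsup>i\<^esup> L2\<^bsup>j\<^esup>\<close> is \<open>(L1 + L2)\<^bsup>i+j\<^esup>\<close>, so the exponential form of the
bounds is preserved without a combinatorial constant.\<close>

lemma jet_bounded_bilinear:
  fixes prod :: "'b::real_normed_vector \<Rightarrow> 'c::real_normed_vector \<Rightarrow> 'd::real_normed_vector"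
  assumes "open V" "S \<subseteq> V" "bounded_bilinear prod" "\<And>a b. norm (prod a b) \<le> norm a * norm b"
    "jet_bounded r V S f K1 L1" "jet_bounded r V S g K2 L2" "0 \<le> L1" "0 \<le> L2"
  shows "jet_bounded r V S (\<lambda>x. prod (f x) (g x)) (K1 * K2) (L1 + L2)"
  using assms(5,6)
proof (induction r arbitrary: f g K1 K2)
  case 0
  then show ?case by (auto intro!: order_trans[OF assms(4)] mult_mono') 
next
  case (Suc r)
  interpret bounded_bilinear prod by fact
  note d = jet_bounded_has_derivative[OF Suc.prems(1)] jet_bounded_has_derivative[OF Suc.prems(2)]
  have m: "jet_bounded r V S f K1 L1" "jet_bounded r V S g K2 L2"
    by (rule jet_bounded_mono[OF Suc.prems(1)] jet_bounded_mono[OF Suc.prems(2)]; use assms in simp)+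
  show ?case
  proof (rule jet_bounded_SucI[OF assms(1,2)])
    show "((\<lambda>x. prod (f x) (g x)) has_derivative
      (\<lambda>v. prod (f x) (frechet_derivative g (at x) v) + prod (frechet_derivative f (at x) v) (g x))) (at x)"
      if "x \<in> V" for x
      using FDERIV[OF d(1)[OF that] d(2)[OF that]] .
    show "norm (prod (f x) (g x)) \<le> K1 * K2" if "x \<in> S" for x
      using jet_boundedD[OF Suc.prems(1) that] jet_boundedD[OF Suc.prems(2) that]
      by (auto intro!: order_trans[OF assms(4)] mult_mono')
    show "jet_bounded r V S (\<lambda>x. prod (f x) (frechet_derivative g (at x) b) +
        prod (frechet_derivative f (at x) b) (g x)) (K1 * K2 * (L1 + L2)) (L1 + L2)" if "b \<in> Basis" for b
      using jet_bounded_add[OF assms(1,2) Suc.IH[OF m(1) jet_bounded_SucE[OF Suc.prems(2) that]]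
          Suc.IH[OF jet_bounded_SucE[OF Suc.prems(1) that] m(2)]]
      by (simp add: algebra_simps)
  qed
qed

text \<open>One derivative of the composition is a sum of products of \<open>\<partial>\<^sub>c g \<circ> f\<close>, of size \<open>K M\<close>, and of \<open>\<partial>f\<close>, of size
\<open>K'\<close>. The product rule adds the rate \<open>L'\<close> of \<open>\<partial>f\<close> once in each of the \<open>r\<close> steps.\<close>

lemma jet_bounded_compose:
  fixes f :: "'a::euclidean_space \<Rightarrow> 'c::euclidean_space" and g :: "'c \<Rightarrow> 'b::real_normed_vector"
    and K K' L' M :: real
  assumes "open V" "S \<subseteq> V" "open W" "S' \<subseteq> W" "f ` V \<subseteq> W" "f ` S \<subseteq> S'"
    "jet_bounded r W S' g K M"
    "\<And>x. x \<in> V \<Longrightarrow> f differentiable (at x)"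
    "\<And>b. b \<in> Basis \<Longrightarrow> jet_bounded r V S (\<lambda>x. frechet_derivative f (at x) b) K' L'"
    "0 \<le> M" "0 \<le> L'" "0 \<le> K'" "0 \<le> K"
  shows "jet_bounded r V S (\<lambda>x. g (f x)) K (DIM('c) * M * K' + r * L')"
  using assms(7,9,13)
proof (induction r arbitrary: g K)
  case 0
  then show ?case using assms by auto
next
  case (Suc r)
  note K = Suc.prems(3)
  define L where "L = DIM('c) * M * K' + Suc r * L'"
  define L0 where "L0 = DIM('c) * M * K' + r * L'"
  have L0: "0 \<le> L0" "L0 + L' = L" using assms by (auto simp: L0_def L_def algebra_simps)
  have L: "DIM('c) * M * K' \<le> L" using assms by (auto simp: L_def)
  have "jet_bounded (Suc r) V S (\<lambda>x. g (f x)) K L"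
    proof (rule jet_bounded_SucI[OF assms(1,2)])
      fix x assume x: "x \<in> V"
      have df: "(f has_derivative frechet_derivative f (at x)) (at x)"
        using assms(8)[OF x] by (simp add: frechet_derivative_works[symmetric])
      have dg: "(g has_derivative frechet_derivative g (at (f x))) (at (f x))"
        by (rule jet_bounded_has_derivative[OF Suc.prems(1)]) (use assms x in auto)
      have lin: "linear (frechet_derivative g (at (f x)))"
        using dg has_derivative_linear by blast
      have "frechet_derivative g (at (f x)) w =
          (\<Sum>c\<in>Basis. (w \<bullet> c) *\<^sub>R frechet_derivative g (at (f x)) c)" for w
        by (subst (1) euclidean_representation[symmetric])
          (simp add: linear_sum[OF lin] linear_scale[OF lin])
      then have e: "frechet_derivative g (at (f x)) = (\<lambda>w. \<Sum>c\<in>Basis. (w \<bullet> c) *\<^sub>R frechet_derivative g (at (f x)) c)"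
        by (rule ext)
      show "((\<lambda>x. g (f x)) has_derivative (\<lambda>v. \<Sum>c\<in>Basis. (frechet_derivative f (at x) v \<bullet> c) *\<^sub>R
          frechet_derivative g (at (f x)) c)) (at x)"
        using has_derivative_compose[OF df dg] by (subst (asm) e)
    next
      show "norm (g (f x)) \<le> K" if "x \<in> S" for x
        using jet_boundedD[OF Suc.prems(1)] assms that by blast
    next
      fix b :: 'a assume b: "b \<in> Basis"
      have p2: "jet_bounded r V S (\<lambda>x. frechet_derivative f (at x) b) K' L'" if "b \<in> Basis" for b
        by (rule jet_bounded_mono[OF Suc.prems(2)[OF that]]) (use assms in auto)
      have 1: "jet_bounded r V S (\<lambda>x. frechet_derivative f (at x) b \<bullet> c) (K' * 1) (L' + 0)"
        if "c \<in> Basis" for c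
        by (rule jet_bounded_bilinear[OF assms(1,2) bounded_bilinear_inner])
          (use Suc.prems(2)[OF b] that assms in \<open>auto intro!: jet_bounded_const Cauchy_Schwarz_ineq2
            elim!: jet_bounded_mono simp del: jet_bounded.simps\<close>)
      have 2: "jet_bounded r V S (\<lambda>x. frechet_derivative g (at (f x)) c) (K * M) L0"
        if "c \<in> Basis" for c
        unfolding L0_def
        by (rule Suc.IH[OF jet_bounded_SucE[OF Suc.prems(1) that]])
          (use p2 assms K in auto)
      have "jet_bounded r V S (\<lambda>x. \<Sum>c\<in>Basis. (frechet_derivative f (at x) b \<bullet> c) *\<^sub>R
          frechet_derivative g (at (f x)) c) (\<Sum>c\<in>(Basis::'c set). K' * 1 * (K * M)) (L' + 0 + L0)"
        by (intro jet_bounded_sum assms jet_bounded_bilinear[OF assms(1,2) bounded_bilinear_scaleR] 1 2)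
          (use L0 assms in auto)
      then show "jet_bounded r V S (\<lambda>x. \<Sum>c\<in>Basis. (frechet_derivative f (at x) b \<bullet> c) *\<^sub>R
          frechet_derivative g (at (f x)) c) (K * L) L"
        by (rule jet_bounded_mono) (use assms L0 K L mult_left_mono[OF L K] in \<open>auto simp: algebra_simps\<close>)
    qed
  then show ?case by (simp only: L_def)
qed

text \<open>For functions of one real variable it is enough to know the sequence of derivatives.\<close>

lemma jet_bounded_real_sequence:
  fixes f :: "nat \<Rightarrow> real \<Rightarrow> real"
  assumes "open V" "S \<subseteq> V"
    "\<And>i s. i < r \<Longrightarrow> s \<in> V \<Longrightarrow> (f i has_field_derivative f (Suc i) s) (at s)"
    "\<And>i s. i \<le> r \<Longrightarrow> s \<in> S \<Longrightarrow> \<bar>f i s\<bar> \<le> K * L ^ i"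
  shows "jet_bounded r V S (f 0) K L"
  using assms(3,4)
proof (induction r arbitrary: f K)
  case 0
  then show ?case by fastforce
next
  case (Suc r)
  have "jet_bounded r V S (\<lambda>x. f (Suc 0) x) (K * L) L"
  proof (rule Suc.IH[of "\<lambda>i. f (Suc i)"])
    show "\<bar>f (Suc i) s\<bar> \<le> K * L * L ^ i" if "i \<le> r" "s \<in> S" for i s
      using Suc.prems(2)[of "Suc i" s] that by (simp add: mult.assoc)
  qed (use Suc.prems in auto)
  moreover have "norm (f 0 x) \<le> K" if "x \<in> S" for x
    using Suc.prems(2)[of 0] that by fastforce
  ultimately show ?case
    by (intro jet_bounded_SucI[OF assms(1,2), where f' = "\<lambda>x v. f (Suc 0) x * v"])
      (use Suc.prems(1)[of 0] in \<open>auto simp: has_field_derivative_def\<close>)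
qed

lemma Ck_imp_continuous_on:
  assumes "Ck r V f" shows "continuous_on V f"
  using assms
  by (cases r) (auto intro: differentiable_imp_continuous_on differentiable_at_imp_differentiable_on)

text \<open>All derivatives are continuous on the compact set, so the rate can be taken to be one.\<close>

lemma Ck_jet_bounded_compact:
  fixes f :: "'a::euclidean_space \<Rightarrow> 'b::real_normed_vector"
  assumes "Ck r V f" "open V" "compact S" "S \<subseteq> V"
  shows "\<exists>K\<ge>0. jet_bounded r V S f K 1"
  using assms(1)
proof (induction r arbitrary: f)
  have bd: "\<exists>K\<ge>0. \<forall>x\<in>S. norm (f x) \<le> K" if "continuous_on V f" for f :: "'a \<Rightarrow> 'b"
  proof -
    have "bounded (f ` S)"
      using compact_continuous_image[OF continuous_on_subset[OF that assms(4)] assms(3)] compact_imp_bounded by blast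
    then show ?thesis by (auto simp: bounded_pos intro: less_imp_le)
  qed
  {
    case 0
    then show ?case using bd by simp
  next
    case (Suc r)
    obtain K0 where K0: "K0 \<ge> 0" "\<forall>x\<in>S. norm (f x) \<le> K0"
      using bd[OF Ck_imp_continuous_on[OF Suc.prems]] by auto
    have "\<forall>b. \<exists>K\<ge>0. jet_bounded r V S (\<lambda>x. frechet_derivative f (at x) b) K 1"
      using Suc by simp
    then obtain K where K: "\<And>b. K b \<ge> 0" "\<And>b. jet_bounded r V S (\<lambda>x. frechet_derivative f (at x) b) (K b) 1"
      by metis
    have Ks: "K b \<le> K0 + (\<Sum>b\<in>Basis. K b)" if "b \<in> Basis" for b
      using member_le_sum[OF that, of K] K K0 by force
    have "jet_bounded (Suc r) V S f (K0 + (\<Sum>b\<in>Basis. K b)) 1"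
      using Suc.prems K0 K(1) sum_nonneg[of "Basis::'a set" K]
      by (auto intro!: jet_bounded_mono[OF K(2)] Ks assms add_increasing2)
    then show ?case using K0 sum_nonneg[of Basis K] K(1) by (metis add_nonneg_nonneg)
  }
qed

lemma Ck_mono:
  assumes "Ck r V f" "r' \<le> r" "W \<subseteq> V" shows "Ck r' W f"
  using assms(1,2)
proof (induction r' arbitrary: r f)
  case 0
  then show ?case using Ck_imp_continuous_on[OF 0(1)] assms(3) continuous_on_subset by auto
next
  case (Suc r')
  then obtain r1 where "r = Suc r1" "r' \<le> r1" by (metis Suc_le_D Suc_le_mono)
  then have "Ck r' W (\<lambda>x. frechet_derivative f (at x) v)" for v
    using Suc.prems(1) Suc.IH[of r1 "\<lambda>x. frechet_derivative f (at x) v"] by simp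
  then show ?case using Suc.prems(1) \<open>r = Suc r1\<close> assms(3) by auto
qed

lemma smooth_subset: "smooth V f \<Longrightarrow> W \<subseteq> V \<Longrightarrow> smooth W f"
  unfolding smooth_def using Ck_mono by blast

lemma smooth_frechet_derivative:
  "smooth V f \<Longrightarrow> smooth V (\<lambda>x. frechet_derivative f (at x) v)"
  unfolding smooth_def by (metis Ck.simps(2))

lemma smooth_differentiable: "smooth V f \<Longrightarrow> x \<in> V \<Longrightarrow> f differentiable (at x)"
  unfolding smooth_def by (metis Ck.simps(2))

lemma partials_append: "partials (\<alpha> @ \<beta>) f = partials \<alpha> (partials \<beta> f)"
  by (induction \<alpha>) auto

lemma Basis_vec_axis: "(b::real^'n) \<in> Basis \<longleftrightarrow> (\<exists>i. b = axis i 1)"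
  by (auto simp: Basis_vec_def)

text \<open>In \<open>partials\<close> the head of the list is the outermost derivative, whereas \<open>jet_bounded\<close> splits off the innermost
one; hence the passage through multi-indices extended at their end.\<close>

lemma Ck_partials_imp_jet_bounded:
  fixes f :: "real^'n \<Rightarrow> 'b::real_normed_vector"
  assumes "Ck r V f" "S \<subseteq> V"
    "\<And>\<alpha> x. length \<alpha> \<le> r \<Longrightarrow> x \<in> S \<Longrightarrow> norm (partials \<alpha> f x) \<le> K * L ^ length \<alpha>"
  shows "jet_bounded r V S f K L"
  using assms(1,3)
proof (induction r arbitrary: f K)
  case 0
  then show ?case using 0(2)[of "[]"] by simp
next
  case (Suc r)
  have "jet_bounded r V S (\<lambda>x. frechet_derivative f (at x) (axis i 1)) (K * L) L" for i
  proof (rule Suc.IH)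
    fix \<alpha> :: "'n list" and x assume *: "length \<alpha> \<le> r" "x \<in> S"
    show "norm (partials \<alpha> (\<lambda>x. frechet_derivative f (at x) (axis i 1)) x) \<le> K * L * L ^ length \<alpha>"
      using Suc.prems(2)[of "\<alpha> @ [i]" x] * by (simp add: partials_append mult.assoc)
  qed (use Suc.prems in auto)
  then show ?case using Suc.prems(1) Suc.prems(2)[of "[]"] by (auto simp: Basis_vec_axis)
qed

lemma Ck_partials:
  "Ck r V f \<Longrightarrow> length \<alpha> \<le> r \<Longrightarrow> Ck (r - length \<alpha>) V (partials \<alpha> f)"
proof (induction \<alpha> arbitrary: r)
  case (Cons i \<alpha>)
  then have "Ck (r - length \<alpha>) V (partials \<alpha> f)" "r - length \<alpha> = Suc (r - length (i # \<alpha>))" by auto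
  then show ?case by simp
qed simp

lemma Ck_partials_bounded_compact:
  fixes f :: "real^'n \<Rightarrow> 'b::real_normed_vector"
  assumes "Ck r V f" "compact S" "S \<subseteq> V"
  shows "\<exists>b. \<forall>\<alpha>. length \<alpha> \<le> r \<longrightarrow> (\<forall>x\<in>S. norm (partials \<alpha> f x) \<le> b)"
proof -
  have "\<exists>b. \<forall>x\<in>S. norm (partials \<alpha> f x) \<le> b" if "length \<alpha> \<le> r" for \<alpha>
  proof -
    have "continuous_on S (partials \<alpha> f)"
      using Ck_imp_continuous_on[OF Ck_partials[OF assms(1) that]] assms(3) continuous_on_subset by blast
    then have "bounded (partials \<alpha> f ` S)" using assms(2) compact_continuous_image compact_imp_bounded by blast
    then show ?thesis by (auto simp: bounded_iff)
  qed
  then obtain b where b: "\<And>\<alpha> x. length \<alpha> \<le> r \<Longrightarrow> x \<in> S \<Longrightarrow> norm (partials \<alpha> f x) \<le> b \<alpha>" by metis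
  have fin: "finite {\<alpha>::'n list. length \<alpha> \<le> r}" using finite_lists_length_le[of "UNIV::'n set"] by simp
  show ?thesis
  proof (intro exI[of _ "\<Sum>\<alpha>\<in>{\<alpha>. length \<alpha> \<le> r}. \<bar>b \<alpha>\<bar>"] allI impI ballI)
    fix \<alpha> :: "'n list" and x assume *: "length \<alpha> \<le> r" "x \<in> S"
    have "norm (partials \<alpha> f x) \<le> \<bar>b \<alpha>\<bar>" using b[OF *] by linarith
    also have "\<dots> \<le> (\<Sum>\<alpha>\<in>{\<alpha>. length \<alpha> \<le> r}. \<bar>b \<alpha>\<bar>)" by (rule member_le_sum) (use * fin in auto)
    finally show "norm (partials \<alpha> f x) \<le> (\<Sum>\<alpha>\<in>{\<alpha>. length \<alpha> \<le> r}. \<bar>b \<alpha>\<bar>)" .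
  qed
qed

section \<open>Quadrature on the reference element\<close>

lemma jet_bounded_pointwise:
  assumes "\<And>x. x \<in> S \<Longrightarrow> jet_bounded r V {x} f K L" "S \<noteq> {}"
  shows "jet_bounded r V S f K L"
  using assms(1)
proof (induction r arbitrary: f K)
  case (Suc r)
  have "jet_bounded r V S (\<lambda>x. frechet_derivative f (at x) b) (K * L) L" if "b \<in> Basis" for b
    by (rule Suc.IH) (use Suc.prems that in auto)
  then show ?case using Suc.prems assms(2) by fastforce
qed auto

lemma jet_bounded_lower_order:
  assumes "jet_bounded r V S f K L" "r' \<le> r"
  shows "jet_bounded r' V S f K L"
  using assms
proof (induction r' arbitrary: r f K)
  case 0
  then show ?case using jet_boundedD by fastforce
next
  case (Suc r')
  then obtain r1 where r1: "r = Suc r1" "r' \<le> r1" by (metis Suc_le_D Suc_le_mono)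
  have "jet_bounded r' V S (\<lambda>x. frechet_derivative f (at x) b) (K * L) L" if "b \<in> Basis" for b
    by (rule Suc.IH[OF _ r1(2)]) (use Suc.prems r1 that in auto)
  then show ?case using Suc.prems r1 by auto
qed

text \<open>The \<open>k\<close>-th derivative in the direction \<open>v\<close>, written as an iterated sum over coordinate directions. In this
form it is visibly a polynomial in \<open>v\<close>.\<close>

primrec directional_derivative ::
    "nat \<Rightarrow> 'a::euclidean_space \<Rightarrow> ('a \<Rightarrow> real) \<Rightarrow> 'a \<Rightarrow> real" where
  "directional_derivative 0 v f = f"
| "directional_derivative (Suc k) v f =
     (\<lambda>x. \<Sum>b\<in>Basis. (v \<bullet> b) * directional_derivative k v (\<lambda>x. frechet_derivative f (at x) b) x)"

lemma directional_derivative_along_line: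
  assumes "jet_bounded (Suc k) V S f K L" "u + t *\<^sub>R v \<in> V"
  shows "((\<lambda>t. directional_derivative k v f (u + t *\<^sub>R v)) has_field_derivative
           directional_derivative (Suc k) v f (u + t *\<^sub>R v)) (at t)"
  using assms(1)
proof (induction k arbitrary: f K)
  case 0
  let ?D = "frechet_derivative f (at (u + t *\<^sub>R v))"
  have df: "(f has_derivative ?D) (at (u + t *\<^sub>R v))"
    using jet_bounded_has_derivative[OF 0 assms(2)] .
  have lin: "linear ?D" using df has_derivative_linear by blast
  have "((\<lambda>t. u + t *\<^sub>R v) has_derivative (\<lambda>h. h *\<^sub>R v)) (at t)"
    by (auto intro!: derivative_eq_intros)
  from has_derivative_compose[OF this df]
  have "((\<lambda>t. f (u + t *\<^sub>R v)) has_derivative (\<lambda>h. ?D v * h)) (at t)"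
    by (simp add: linear_scale[OF lin] mult.commute)
  moreover have "?D v = (\<Sum>b\<in>Basis. (v \<bullet> b) * ?D b)"
    by (subst (1) euclidean_representation[symmetric])
      (simp add: linear_sum[OF lin] linear_scale[OF lin])
  ultimately show ?case by (simp add: has_field_derivative_def)
next
  case (Suc k)
  have "((\<lambda>t. directional_derivative k v (\<lambda>x. frechet_derivative f (at x) b) (u + t *\<^sub>R v)) has_field_derivative
      directional_derivative (Suc k) v (\<lambda>x. frechet_derivative f (at x) b) (u + t *\<^sub>R v)) (at t)"
    if "b \<in> Basis" for b
    by (rule Suc.IH[OF jet_bounded_SucE[OF Suc.prems that]])
  then have "((\<lambda>t. \<Sum>b\<in>Basis. (v \<bullet> b) * directional_derivative k v (\<lambda>x. frechet_derivative f (at x) b) (u + t *\<^sub>R v))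
      has_field_derivative (\<Sum>b\<in>Basis. (v \<bullet> b) *
        directional_derivative (Suc k) v (\<lambda>x. frechet_derivative f (at x) b) (u + t *\<^sub>R v))) (at t)"
    by (intro DERIV_sum DERIV_cmult) auto
  then show ?case
    by (subst (2) directional_derivative.simps, subst (1) directional_derivative.simps)
qed

lemma directional_derivative_le:
  assumes "jet_bounded k V S f K L" "x \<in> S" "0 \<le> K" "0 \<le> L"
  shows "\<bar>directional_derivative k v f x\<bar> \<le> (\<Sum>b\<in>Basis. \<bar>v \<bullet> b\<bar>) ^ k * (K * L ^ k)"
  using assms(1,3)
proof (induction k arbitrary: f K)
  case 0
  then show ?case using jet_boundedD[OF 0(1) assms(2)] by simp
next
  case (Suc k)
  let ?s = "\<Sum>b\<in>Basis. \<bar>v \<bullet> b\<bar>"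
  have "\<bar>directional_derivative (Suc k) v f x\<bar>
      \<le> (\<Sum>b\<in>Basis. \<bar>v \<bullet> b\<bar> * \<bar>directional_derivative k v (\<lambda>x. frechet_derivative f (at x) b) x\<bar>)"
    by (simp add: abs_mult[symmetric])
  also have "\<dots> \<le> (\<Sum>b\<in>Basis. \<bar>v \<bullet> b\<bar> * (?s ^ k * (K * L * L ^ k)))"
    by (intro sum_mono mult_left_mono Suc.IH jet_bounded_SucE[OF Suc.prems(1)]) (use Suc.prems assms in auto)
  also have "\<dots> = ?s * (?s ^ k * (K * L * L ^ k))"
    by (rule sum_distrib_right[symmetric])
  also have "\<dots> = ?s ^ Suc k * (K * L ^ Suc k)"
    by (simp add: mult_ac)
  finally show ?case .
qed

text \<open>One-dimensional Taylor expansion along the segment from \<open>u0\<close> to \<open>u\<close>; the factor \<open>DIM * norm\<close> bounds the sum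
of the absolute values of the coordinates of \<open>u - u0\<close>.\<close>

lemma taylor_remainder_directional:
  fixes f :: "'a::euclidean_space \<Rightarrow> real"
  assumes "jet_bounded (Suc q) V S f K L" "convex S" "S \<subseteq> V" "0 \<le> K" "0 \<le> L" "u0 \<in> S" "u \<in> S"
  shows "\<bar>f u - (\<Sum>m\<le>q. directional_derivative m (u - u0) f u0 / fact m)\<bar>
     \<le> (DIM('a) * norm (u - u0)) ^ Suc q * (K * L ^ Suc q)"
proof -
  let ?v = "u - u0 :: 'a"
  have seg: "u0 + t *\<^sub>R ?v \<in> S" if "0 \<le> t" "t \<le> 1" for t
    using convexD_alt[OF assms(2,6,7) that] by (simp add: algebra_simps)
  have "\<exists>t>0. t < 1 \<and> f (u0 + 1 *\<^sub>R ?v) =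
      (\<Sum>m<Suc q. directional_derivative m ?v f (u0 + 0 *\<^sub>R ?v) / fact m * 1 ^ m) +
      directional_derivative (Suc q) ?v f (u0 + t *\<^sub>R ?v) / fact (Suc q) * 1 ^ Suc q"
  proof (rule Maclaurin[where f = "\<lambda>t. f (u0 + t *\<^sub>R ?v)"], goal_cases)
    case 4
    show ?case
    proof (intro allI impI, elim conjE)
      fix m t assume *: "m < Suc q" "0 \<le> t" "t \<le> (1::real)"
      have "jet_bounded (Suc m) V S f K L"
        by (rule jet_bounded_lower_order[OF assms(1)]) (use * in simp)
      then show "((\<lambda>t. directional_derivative m ?v f (u0 + t *\<^sub>R ?v)) has_real_derivative
        directional_derivative (Suc m) ?v f (u0 + t *\<^sub>R ?v)) (at t)"
        by (rule directional_derivative_along_line) (use seg * assms in auto)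
    qed
  qed auto
  then obtain t where t: "0 < t" "t < 1" and e: "f u =
      (\<Sum>m\<le>q. directional_derivative m ?v f u0 / fact m) +
      directional_derivative (Suc q) ?v f (u0 + t *\<^sub>R ?v) / fact (Suc q)"
    by (auto simp del: directional_derivative.simps sum.lessThan_Suc simp add: lessThan_Suc_atMost)
  have "\<bar>f u - (\<Sum>m\<le>q. directional_derivative m ?v f u0 / fact m)\<bar> =
      \<bar>directional_derivative (Suc q) ?v f (u0 + t *\<^sub>R ?v)\<bar> / fact (Suc q)"
    unfolding e by (simp del: directional_derivative.simps fact_Suc)
  also have "\<dots> \<le> \<bar>directional_derivative (Suc q) ?v f (u0 + t *\<^sub>R ?v)\<bar>"
    by (simp add: divide_le_eq mult_le_cancel_left1 del: directional_derivative.simps fact_Suc)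
  also have "\<dots> \<le> (\<Sum>b\<in>Basis. \<bar>?v \<bullet> b\<bar>) ^ Suc q * (K * L ^ Suc q)"
    by (rule directional_derivative_le[OF assms(1)]) (use seg t assms in auto)
  also have "\<dots> \<le> (DIM('a) * norm ?v) ^ Suc q * (K * L ^ Suc q)"
  proof (intro mult_right_mono power_mono)
    have "(\<Sum>b\<in>Basis. \<bar>?v \<bullet> b\<bar>) \<le> (\<Sum>b\<in>(Basis::'a set). norm ?v)"
      by (intro sum_mono Basis_le_norm) auto
    then show "(\<Sum>b\<in>Basis. \<bar>?v \<bullet> b\<bar>) \<le> DIM('a) * norm ?v" by simp
  qed (use assms in \<open>auto intro: sum_nonneg\<close>)
  finally show ?thesis .
qed

text \<open>Polynomials generated by constants, sums and multiplication by a coordinate. Exactness of the rule is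
proved along this generation instead of through coefficient arrays.\<close>

inductive polynomial_of_degree_le :: "nat \<Rightarrow> (real^2 \<Rightarrow> real) \<Rightarrow> bool" where
  const: "polynomial_of_degree_le d (\<lambda>u. c)"
| coord: "polynomial_of_degree_le d f \<Longrightarrow> polynomial_of_degree_le (Suc d) (\<lambda>u. u $ i * f u)"
| add: "polynomial_of_degree_le d f \<Longrightarrow> polynomial_of_degree_le d g \<Longrightarrow>
    polynomial_of_degree_le d (\<lambda>u. f u + g u)"

lemma polynomial_of_degree_le_scale:
  "polynomial_of_degree_le d f \<Longrightarrow> polynomial_of_degree_le d (\<lambda>u. c * f u)"
proof (induction rule: polynomial_of_degree_le.induct)
  case (coord d f i)
  then show ?case using polynomial_of_degree_le.coord[OF coord(2), of i] by (simp add: mult_ac)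
qed (auto simp: algebra_simps intro: polynomial_of_degree_le.intros)

lemma polynomial_of_degree_le_mono:
  "polynomial_of_degree_le d f \<Longrightarrow> d \<le> d' \<Longrightarrow> polynomial_of_degree_le d' f"
proof (induction arbitrary: d' rule: polynomial_of_degree_le.induct)
  case (coord d f i)
  then obtain e where "d' = Suc e" "d \<le> e" by (metis Suc_le_D Suc_le_mono)
  then show ?case using coord by (auto intro: polynomial_of_degree_le.intros)
qed (auto intro: polynomial_of_degree_le.intros)

lemma polynomial_of_degree_le_sum:
  "(\<And>i. i \<in> I \<Longrightarrow> polynomial_of_degree_le d (f i)) \<Longrightarrow> polynomial_of_degree_le d (\<lambda>u. \<Sum>i\<in>I. f i u)"
  by (induction I rule: infinite_finite_induct) (auto intro: polynomial_of_degree_le.intros)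

lemma polynomial_of_degree_le_continuous:
  "polynomial_of_degree_le d f \<Longrightarrow> continuous_on A f"
  by (induction rule: polynomial_of_degree_le.induct) (auto intro!: continuous_intros)

lemma directional_derivative_polynomial:
  "polynomial_of_degree_le k (\<lambda>u. directional_derivative k (u - u0) f u0)"
proof (induction k arbitrary: f)
  case 0
  then show ?case by (simp add: polynomial_of_degree_le.const)
next
  case (Suc k)
  have "polynomial_of_degree_le (Suc k) (\<lambda>u. ((u - u0) \<bullet> b) * directional_derivative k (u - u0) g u0)"
    if b: "b \<in> Basis" for b g
  proof -
    obtain i where i: "b = axis i 1" using b by (auto simp: Basis_vec_axis)
    have "polynomial_of_degree_le (Suc k) (\<lambda>u. u $ i * directional_derivative k (u - u0) g u0 +
        (- u0 $ i) * directional_derivative k (u - u0) g u0)"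
      by (intro polynomial_of_degree_le.intros polynomial_of_degree_le_scale Suc.IH
          polynomial_of_degree_le_mono[OF Suc.IH]) auto
    then show ?thesis by (simp add: i inner_axis algebra_simps)
  qed
  then show ?case by (auto intro!: polynomial_of_degree_le_sum)
qed

text \<open>The induction runs over \<open>f\<close> with an additional monomial factor: multiplication of \<open>f\<close> by a coordinate
raises an exponent of that monomial, so that in the end only pure monomials have to be expressed by
\<open>poly2\<close>.\<close>

lemma quadrature_rule_polynomial_exact:
  assumes "quadrature_rule Th q NQ xq w" "compact Th" "polynomial_of_degree_le q f"
  shows "(\<Sum>l=1..NQ. w l * f (xq l)) = (LINT u:Th|lborel. f u)"
proof -
  have int: "set_integrable lborel Th f" if "continuous_on Th f" for f :: "real^2 \<Rightarrow> real"
    using borel_integrable_compact[OF assms(2) that] by (simp add: set_integrable_def)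
  have "(\<Sum>l=1..NQ. w l * ((xq l $ 1) ^ i * (xq l $ 2) ^ j * f (xq l))) =
      (LINT u:Th|lborel. (u $ 1) ^ i * (u $ 2) ^ j * f u)" if "i + j + d \<le> q" "polynomial_of_degree_le d f" for i j d f
    using that(2,1)
  proof (induction arbitrary: i j rule: polynomial_of_degree_le.induct)
    case (const d c)
    \<comment> \<open>The coefficients of a single monomial.\<close>
    define e where "e = (\<lambda>i' j'. if i' = i \<and> j' = j then c else 0)"
    have "poly2 q e u = (u $ 1) ^ i * (u $ 2) ^ j * c" for u
    proof -
      let ?X = "\<lambda>i'. \<Sum>j'\<le>q - i'. e i' j' * (u $ 1) ^ i' * (u $ 2) ^ j'"
      have "poly2 q e u = (\<Sum>i'\<le>q. if i' = i then ?X i else 0)"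
        unfolding poly2_def by (rule sum.cong) (simp_all add: e_def)
      also have "\<dots> = ?X i" using const by simp
      also have "\<dots> = (\<Sum>j'\<le>q - i. if j' = j then (u $ 1) ^ i * (u $ 2) ^ j * c else 0)"
        by (rule sum.cong) (simp_all add: e_def)
      finally show ?thesis using const by simp
    qed
    moreover have "(\<Sum>l=1..NQ. w l * poly2 q e (xq l)) = (LINT u:Th|lborel. poly2 q e u)"
      using assms(1) unfolding quadrature_rule_def by blast
    ultimately show ?case by simp
  next
    case (coord d f k)
    show ?case
    proof (cases "k = 1")
      case True
      then show ?thesis using coord.IH[of "Suc i" j] coord.prems by (simp add: mult_ac)
    next
      case False
      then have "k = 2" using exhaust_2 by blast
      then show ?thesis using coord.IH[of i "Suc j"] coord.prems by (simp add: mult_ac)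
    qed
  next
    case (add d f g)
    have "(LINT u:Th|lborel. (u $ 1) ^ i * (u $ 2) ^ j * (f u + g u)) =
      (LINT u:Th|lborel. (u $ 1) ^ i * (u $ 2) ^ j * f u) + (LINT u:Th|lborel. (u $ 1) ^ i * (u $ 2) ^ j * g u)"
      unfolding distrib_left
      by (intro set_integral_add int continuous_intros polynomial_of_degree_le_continuous[OF add(1)]
          polynomial_of_degree_le_continuous[OF add(2)])
    then show ?case using add.IH[of i j] add.prems by (simp add: algebra_simps sum.distrib)
  qed
  from this[of 0 0 q f] show ?thesis using assms(3) by simp
qed

lemma quadrature_weights_sum:
  assumes "quadrature_rule Th q NQ xq w" "compact Th"
  shows "(\<Sum>l=1..NQ. w l) = measure lborel Th"
  using quadrature_rule_polynomial_exact[OF assms polynomial_of_degree_le.const[of q 1]]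
  by (simp add: set_lebesgue_integral_def)

text \<open>The rule and the integral agree on the Taylor polynomial of degree \<open>q\<close>, so the error is that of the
remainder. As the weights are positive, they sum up to the measure of the reference element, and both the
integral and the rule contribute at most this measure times the supremum of the remainder.\<close>

lemma quadrature_error_reference_element:
  assumes "quadrature_rule Th q NQ xq w" "reference_element Th" "open V" "Th \<subseteq> V"
    "jet_bounded (Suc q) V Th g K L" "0 \<le> K" "0 \<le> L"
  shows "\<bar>(LINT u:Th|lborel. g u) - (\<Sum>l=1..NQ. w l * g (xq l))\<bar>
    \<le> 2 * measure lborel Th * (2 * diameter Th) ^ Suc q * (K * L ^ Suc q)"
proof -
  have Th: "compact Th" "convex Th" "Th \<noteq> {}" using assms(2) by (auto simp: reference_element_def)
  then obtain u0 where u0: "u0 \<in> Th" by auto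
  define p where "p = (\<lambda>u. \<Sum>m\<le>q. directional_derivative m (u - u0) g u0 / fact m)"
  have pp: "polynomial_of_degree_le q p"
    unfolding p_def divide_inverse mult.commute[of _ "inverse (fact _)"]
    by (intro polynomial_of_degree_le_sum polynomial_of_degree_le_scale
        polynomial_of_degree_le_mono[OF directional_derivative_polynomial]) auto
  define R where "R = (2 * diameter Th) ^ Suc q * (K * L ^ Suc q)"
  have d: "norm (u - u0) \<le> diameter Th" if "u \<in> Th" for u
    using diameter_bounded_bound[OF compact_imp_bounded[OF Th(1)] that u0] by (simp add: dist_norm)
  have R: "\<bar>g u - p u\<bar> \<le> R" if "u \<in> Th" for u
  proof -
    have "\<bar>g u - p u\<bar> \<le> (DIM(real^2) * norm (u - u0)) ^ Suc q * (K * L ^ Suc q)"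
      unfolding p_def
      by (rule taylor_remainder_directional[OF assms(5) Th(2) assms(4) assms(6,7) u0 that])
    also have "\<dots> \<le> R" unfolding R_def
      by (intro mult_right_mono power_mono) (use d[OF that] assms in auto)
    finally show ?thesis .
  qed
  have ceq: "continuous_on Th g"
    by (rule differentiable_imp_continuous_on, rule differentiable_at_imp_differentiable_on)
      (use jet_bounded_differentiable[OF assms(5)] assms(4) in auto)
  have int: "set_integrable lborel Th f" if "continuous_on Th f" for f :: "real^2 \<Rightarrow> real"
    using borel_integrable_compact[OF Th(1) that] by (simp add: set_integrable_def)
  note ig = int[OF ceq] and ip = int[OF polynomial_of_degree_le_continuous[OF pp]]
  have q: "0 < w l" "xq l \<in> Th" if "l \<in> {1..NQ}" for l
    using assms(1) that by (auto simp: quadrature_rule_def)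
  have ex: "(\<Sum>l=1..NQ. w l * p (xq l)) = (LINT u:Th|lborel. p u)"
    by (rule quadrature_rule_polynomial_exact[OF assms(1) Th(1) pp])
  have "(LINT u:Th|lborel. g u) - (LINT u:Th|lborel. p u) = (LINT u:Th|lborel. g u - p u)"
    by (rule set_integral_diff(2)[OF ig ip, symmetric])
  moreover have "\<bar>LINT u:Th|lborel. g u - p u\<bar> \<le> (LINT u:Th|lborel. R)"
  proof -
    have "norm (LINT u:Th|lborel. g u - p u) \<le> (LINT u:Th|lborel. norm (g u - p u))"
      by (rule set_integral_norm_bound) (rule set_integral_diff(1)[OF ig ip])
    also have "\<dots> \<le> (LINT u:Th|lborel. R)"
      by (rule set_integral_mono)
        (use R ceq polynomial_of_degree_le_continuous[OF pp] in \<open>auto intro!: int continuous_intros\<close>)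
    finally show ?thesis by simp
  qed
  moreover have "(LINT u:Th|lborel. R) = R * measure lborel Th"
    by (simp add: set_lebesgue_integral_def)
  moreover have "\<bar>(\<Sum>l=1..NQ. w l * p (xq l)) - (\<Sum>l=1..NQ. w l * g (xq l))\<bar> \<le> R * measure lborel Th"
  proof -
    have "\<bar>(\<Sum>l=1..NQ. w l * p (xq l)) - (\<Sum>l=1..NQ. w l * g (xq l))\<bar> = \<bar>\<Sum>l=1..NQ. w l * (p (xq l) - g (xq l))\<bar>"
      by (simp add: sum_subtractf algebra_simps)
    also have "\<dots> \<le> (\<Sum>l=1..NQ. w l * R)"
    proof (rule sum_abs[THEN order_trans], rule sum_mono)
      fix l assume l: "l \<in> {1..NQ}"
      show "\<bar>w l * (p (xq l) - g (xq l))\<bar> \<le> w l * R"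
        using R[OF q(2)[OF l]] q(1)[OF l] by (simp add: abs_mult abs_minus_commute)
    qed
    also have "\<dots> = (\<Sum>l=1..NQ. w l) * R" by (rule sum_distrib_right[symmetric])
    also have "\<dots> = R * measure lborel Th"
      unfolding quadrature_weights_sum[OF assms(1) Th(1)] by (rule mult.commute)
    finally show ?thesis .
  qed
  ultimately have "\<bar>(LINT u:Th|lborel. g u) - (\<Sum>l=1..NQ. w l * g (xq l))\<bar> \<le> 2 * (R * measure lborel Th)"
    unfolding ex by linarith
  then show ?thesis by (simp add: R_def mult_ac)
qed

section \<open>Charts and the surface measure\<close>

lemma linear_Basis_expand:
  fixes f :: "'a::euclidean_space \<Rightarrow> 'b::real_vector"
  assumes "linear f" shows "f v = (\<Sum>b\<in>Basis. (v \<bullet> b) *\<^sub>R f b)"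
  by (subst (1) euclidean_representation[of v, symmetric])
    (simp add: linear_sum[OF assms] linear_scale[OF assms])

lemma linear_norm_le_Basis:
  fixes f :: "'a::euclidean_space \<Rightarrow> 'b::real_normed_vector" and B :: real
  assumes "linear f" "\<And>b. b \<in> Basis \<Longrightarrow> norm (f b) \<le> B"
  shows "norm (f v) \<le> DIM('a) * B * norm v"
proof -
  have "norm (f v) \<le> (\<Sum>b\<in>(Basis::'a set). norm v * B)"
    unfolding linear_Basis_expand[OF assms(1), of v]
    by (intro sum_norm_le) (auto intro!: mult_mono assms Basis_le_norm)
  then show ?thesis by (simp add: mult_ac)
qed

lemma has_derivative_frechet:
  "f differentiable (at x) \<Longrightarrow> (f has_derivative frechet_derivative f (at x)) (at x)"
  by (simp add: frechet_derivative_works[symmetric])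

lemma smooth_continuous_on: "smooth V f \<Longrightarrow> continuous_on V f"
  unfolding smooth_def using Ck_imp_continuous_on by blast

lemma surf_jac_eq:
  "surf_jac F u = norm (cross3 (frechet_derivative F (at u) (axis 1 1)) (frechet_derivative F (at u) (axis 2 1)))"
  by (simp add: surf_jac_def)

lemma surf_jac_continuous_on: "smooth V F \<Longrightarrow> continuous_on V (surf_jac F)"
  unfolding surf_jac_eq
  by (intro continuous_on_norm continuous_on_cross smooth_continuous_on smooth_frechet_derivative)

text \<open>A vector \<open>v\<close> in the kernel gives a linear relation between the two tangent vectors; its cross product with
either of them isolates one coordinate of \<open>v\<close>.\<close>

lemma immersion_derivative_inj:
  assumes "surf_jac F u \<noteq> 0" "F differentiable (at u)"
  shows "inj (frechet_derivative F (at u))"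
proof -
  let ?L = "frechet_derivative F (at u)"
  have lin: "linear ?L" using has_derivative_frechet[OF assms(2)] has_derivative_linear by blast
  have "v = 0" if "?L v = 0" for v
  proof -
    let ?a = "?L (axis 1 1)" and ?b = "?L (axis 2 1)"
    have B: "(Basis::(real^2) set) = {axis 1 1, axis 2 1}"
      by (auto simp: Basis_vec_axis forall_2 exhaust_2) (metis exhaust_2)
    have ne: "axis 1 1 \<noteq> (axis 2 1 :: real^2)" by (simp add: axis_eq_axis)
    have "?L v = (v $ 1) *\<^sub>R ?a + (v $ 2) *\<^sub>R ?b"
      by (subst linear_Basis_expand[OF lin]) (simp add: B ne inner_axis)
    then have e: "(v $ 1) *\<^sub>R ?a + (v $ 2) *\<^sub>R ?b = 0" using that by simp
    have "(v $ 1) *\<^sub>R cross3 ?a ?b = cross3 ((v $ 1) *\<^sub>R ?a + (v $ 2) *\<^sub>R ?b) ?b"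
      by (simp add: cross_add_left cross_mult_left)
    moreover have "(v $ 2) *\<^sub>R cross3 ?a ?b = cross3 ?a ((v $ 1) *\<^sub>R ?a + (v $ 2) *\<^sub>R ?b)"
      by (simp add: cross_add_right cross_mult_right)
    ultimately have "v $ 1 = 0" "v $ 2 = 0" using e assms(1) by (auto simp: surf_jac_eq)
    then show ?thesis by (simp add: vec_eq_iff forall_2)
  qed
  then show ?thesis using linear_injective_0[OF lin] by blast
qed

text \<open>The derivative at \<open>u0\<close> expands lengths by a factor \<open>B > 0\<close>. On a small ball the derivative of \<open>F\<close> minus its
linearization has norm at most \<open>B/2\<close>, so \<open>F\<close> expands by at least \<open>B/2\<close>.\<close>

lemma immersion_locally_expanding:
  fixes F :: "real^2 \<Rightarrow> real^3"
  assumes "open U" "smooth U F" "u0 \<in> U" "surf_jac F u0 \<noteq> 0"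
  shows "\<exists>r>0. \<exists>c>0. cball u0 r \<subseteq> U \<and>
    (\<forall>u\<in>cball u0 r. \<forall>v\<in>cball u0 r. c * norm (u - v) \<le> norm (F u - F v))"
proof -
  let ?D = "\<lambda>u. frechet_derivative F (at u)" and ?L = "frechet_derivative F (at u0)"
  have diff: "(F has_derivative ?D u) (at u)" if "u \<in> U" for u
    using has_derivative_frechet smooth_differentiable[OF assms(2) that] .
  have lin: "linear (?D u)" if "u \<in> U" for u using diff[OF that] has_derivative_linear by blast
  obtain B where B: "B > 0" "\<And>v. B * norm v \<le> norm (?L v)"
    using linear_inj_bounded_below_pos[OF lin[OF assms(3)] immersion_derivative_inj[OF assms(4)]]
      smooth_differentiable[OF assms(2,3)] by metis
  \<comment> \<open>A tolerance of \<open>B/4\<close> in each of the two coordinate directions gives \<open>B/2\<close> for the whole derivative.\<close>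
  have "\<forall>\<^sub>F u in at u0. \<forall>b\<in>Basis. dist (?D u b) (?L b) < B / 4"
  proof (rule eventually_ball_finite)
    show "\<forall>b\<in>Basis. \<forall>\<^sub>F u in at u0. dist (?D u b) (?L b) < B / 4"
    proof
      fix b :: "real^2"
      have "isCont (\<lambda>u. ?D u b) u0"
        using smooth_continuous_on[OF smooth_frechet_derivative[OF assms(2)]] assms(1,3)
          continuous_on_eq_continuous_at by blast
      then show "\<forall>\<^sub>F u in at u0. dist (?D u b) (?L b) < B / 4"
        unfolding isCont_def by (rule tendstoD) (use B(1) in simp)
    qed
  qed simp
  then obtain e where e0: "e > 0"
    "\<forall>u\<in>UNIV. u \<noteq> u0 \<and> dist u u0 < e \<longrightarrow> (\<forall>b\<in>Basis. dist (?D u b) (?L b) < B / 4)"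
    using iffD1[OF eventually_at] by blast
  then have e: "e > 0" "\<And>u b. u \<noteq> u0 \<Longrightarrow> dist u u0 < e \<Longrightarrow> b \<in> Basis \<Longrightarrow> dist (?D u b) (?L b) < B / 4"
    by blast+
  obtain e' where e': "e' > 0" "cball u0 e' \<subseteq> U" using assms(1,3) open_contains_cball by blast
  define r where "r = min e' (e / 2)"
  have r: "r > 0" "cball u0 r \<subseteq> U" using e' e by (auto simp: r_def)
  have near: "norm (?D u b - ?L b) \<le> B / 4" if "u \<in> cball u0 r" "b \<in> Basis" for u b
    using e(2)[of u b] that e(1) B(1) by (cases "u = u0") (auto simp: r_def dist_norm norm_minus_commute)
  have on: "onorm (\<lambda>v. ?D u v - ?L v) \<le> B / 2" if "u \<in> cball u0 r" for u
  proof (rule onorm_le)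
    fix v
    have "linear (\<lambda>v. ?D u v - ?L v)" using lin r that assms(3) by (intro linear_compose_sub) auto
    from linear_norm_le_Basis[OF this near[OF that], of v] show "norm (?D u v - ?L v) \<le> B / 2 * norm v"
      by simp
  qed
  have lip: "norm ((F u - ?L u) - (F v - ?L v)) \<le> B / 2 * norm (u - v)" if "u \<in> cball u0 r" "v \<in> cball u0 r" for u v
  proof (rule differentiable_bound[OF convex_cball _ on that])
    fix w assume w: "w \<in> cball u0 r"
    have "((\<lambda>u. F u - ?L u) has_derivative (\<lambda>v. ?D w v - ?L v)) (at w)"
      by (intro has_derivative_diff diff bounded_linear_imp_has_derivative has_derivative_bounded_linear[OF diff[OF assms(3)]])
        (use r w in auto)
    then show "((\<lambda>u. F u - ?L u) has_derivative (\<lambda>v. ?D w v - ?L v)) (at w within cball u0 r)"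
      using has_derivative_at_withinI by blast
  qed
  have "B / 2 * norm (u - v) \<le> norm (F u - F v)" if "u \<in> cball u0 r" "v \<in> cball u0 r" for u v
  proof -
    have "norm (?L (u - v)) \<le> norm (F u - F v) + norm ((F u - ?L u) - (F v - ?L v))"
      using norm_triangle_ineq4[of "F u - F v" "(F u - ?L u) - (F v - ?L v)"]
      by (simp add: linear_diff[OF lin[OF assms(3)]] algebra_simps)
    then show ?thesis using lip[OF that] B(2)[of "u - v"] by simp
  qed
  then show ?thesis using r B(1) by (intro exI[of _ r] conjI exI[of _ "B / 2"]) auto
qed

text \<open>A compact piece of a chart on which the inverse of the parametrization is Lipschitz continuous and the
Jacobian is bounded. Both null sets and areas of small sets can be estimated through such a piece.\<close>

definition bilipschitz_chart :: "(real^3) set \<Rightarrow> (real^2 \<Rightarrow> real^3) \<Rightarrow> (real^2) set \<Rightarrow> bool" where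
  "bilipschitz_chart \<Gamma> F K \<longleftrightarrow> compact K \<and>
     (\<exists>U c J. surface_param \<Gamma> U F \<and> K \<subseteq> U \<and> 0 < c \<and> 0 \<le> J \<and>
       (\<forall>u\<in>K. \<forall>v\<in>K. c * norm (u - v) \<le> norm (F u - F v)) \<and> (\<forall>u\<in>K. surf_jac F u \<le> J))"

lemma bilipschitz_chartE:
  assumes "bilipschitz_chart \<Gamma> F K"
  obtains U c J where "compact K" "surface_param \<Gamma> U F" "K \<subseteq> U" "0 < c" "0 \<le> J"
    "\<forall>u\<in>K. \<forall>v\<in>K. c * norm (u - v) \<le> norm (F u - F v)" "\<forall>u\<in>K. surf_jac F u \<le> J"
  using assms unfolding bilipschitz_chart_def by blast

lemma compact_real_upper_bound:
  fixes f :: "'a \<Rightarrow> real"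
  assumes "compact (f ` S)"
  obtains J where "\<forall>u\<in>S. f u \<le> J" "0 \<le> J"
proof -
  obtain M where "\<forall>y\<in>f ` S. norm y \<le> M" using compact_imp_bounded[OF assms] bounded_iff by blast
  then have "\<forall>u\<in>S. f u \<le> \<bar>M\<bar>" by force
  then show ?thesis using that by auto
qed

text \<open>Images of open balls under charts are open in \<open>\<Gamma>\<close>, which is compact.\<close>

lemma smooth_closed_surface_finite_atlas:
  assumes "smooth_closed_surface \<Gamma>"
  shows "\<exists>\<C>. finite \<C> \<and> \<Gamma> \<subseteq> (\<Union>(F, K)\<in>\<C>. F ` K) \<and> (\<forall>(F, K)\<in>\<C>. bilipschitz_chart \<Gamma> F K)"
proof -
  have "\<exists>F K Nb. bilipschitz_chart \<Gamma> F K \<and> open Nb \<and> y \<in> Nb \<and> \<Gamma> \<inter> Nb \<subseteq> F ` K" if y: "y \<in> \<Gamma>" for y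
  proof -
    obtain U F G where UF: "surface_param \<Gamma> U F" "y \<in> F ` U" "openin (top_of_set \<Gamma>) (F ` U)"
      "homeomorphism U (F ` U) F G"
      using assms y unfolding smooth_closed_surface_def by meson
    obtain u0 where u0: "u0 \<in> U" "y = F u0" using UF by auto
    have sm: "open U" "smooth U F" "surf_jac F u0 \<noteq> 0" using UF(1) u0 by (auto simp: surface_param_def)
    obtain r c where rc: "r > 0" "c > 0" "cball u0 r \<subseteq> U"
      "\<And>u v. u \<in> cball u0 r \<Longrightarrow> v \<in> cball u0 r \<Longrightarrow> c * norm (u - v) \<le> norm (F u - F v)"
      using immersion_locally_expanding[OF sm(1,2) u0(1) sm(3)] by metis
    have "compact (surf_jac F ` cball u0 r)"
      by (intro compact_continuous_image continuous_on_subset[OF surf_jac_continuous_on[OF sm(2)]]) (use rc in auto)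
    then obtain J where J: "\<forall>u\<in>cball u0 r. surf_jac F u \<le> J" "0 \<le> J"
      by (rule compact_real_upper_bound)
    have "openin (top_of_set (F ` U)) (F ` ball u0 r)"
      by (rule homeomorphism_imp_open_map[OF UF(4)])
        (use rc in \<open>auto intro!: open_subset\<close>)
    then have "openin (top_of_set \<Gamma>) (F ` ball u0 r)" using UF(3) openin_trans by blast
    then obtain Nb where Nb: "open Nb" "F ` ball u0 r = \<Gamma> \<inter> Nb" by (metis openin_open)
    have "y \<in> F ` ball u0 r" using u0 rc by auto
    moreover have "F ` ball u0 r \<subseteq> F ` cball u0 r" by (intro image_mono ball_subset_cball)
    ultimately have "y \<in> Nb" "\<Gamma> \<inter> Nb \<subseteq> F ` cball u0 r" using Nb(2) by auto
    moreover have "bilipschitz_chart \<Gamma> F (cball u0 r)"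
      unfolding bilipschitz_chart_def
      by (intro conjI compact_cball exI[of _ U] exI[of _ c] exI[of _ J] ballI UF(1) rc J(2) rc(4))
        (use J(1) in auto)
    ultimately show ?thesis using Nb(1)
      by (intro exI[of _ F] exI[of _ "cball u0 r"] exI[of _ Nb] conjI)
  qed
  then have "\<forall>y\<in>\<Gamma>. \<exists>t. bilipschitz_chart \<Gamma> (fst t) (fst (snd t)) \<and> open (snd (snd t)) \<and> y \<in> snd (snd t) \<and>
      \<Gamma> \<inter> snd (snd t) \<subseteq> fst t ` fst (snd t)" by simp
  from bchoice[OF this] obtain t where t: "\<forall>y\<in>\<Gamma>. bilipschitz_chart \<Gamma> (fst (t y)) (fst (snd (t y))) \<and>
      open (snd (snd (t y))) \<and> y \<in> snd (snd (t y)) \<and> \<Gamma> \<inter> snd (snd (t y)) \<subseteq> fst (t y) ` fst (snd (t y))" ..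
  have "compact \<Gamma>" using assms by (simp add: smooth_closed_surface_def)
  moreover have "open (snd (snd (t y)))" if "y \<in> \<Gamma>" for y using t that by blast
  moreover have "\<Gamma> \<subseteq> (\<Union>y\<in>\<Gamma>. snd (snd (t y)))" using t by blast
  ultimately obtain Y where Y: "Y \<subseteq> \<Gamma>" "finite Y" "\<Gamma> \<subseteq> (\<Union>y\<in>Y. snd (snd (t y)))"
    by (rule compactE_image)
  show ?thesis
  proof (intro exI[of _ "(\<lambda>y. (fst (t y), fst (snd (t y)))) ` Y"] conjI)
    show "\<Gamma> \<subseteq> (\<Union>(F, K)\<in>(\<lambda>y. (fst (t y), fst (snd (t y)))) ` Y. F ` K)"
    proof
      fix z assume z: "z \<in> \<Gamma>"
      then obtain y where y: "y \<in> Y" "z \<in> snd (snd (t y))" using Y(3) by blast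
      then have "z \<in> fst (t y) ` fst (snd (t y))" using t z Y(1) by blast
      then show "z \<in> (\<Union>(F, K)\<in>(\<lambda>y. (fst (t y), fst (snd (t y)))) ` Y. F ` K)" using y(1) by auto
    qed
    show "\<forall>(F, K)\<in>(\<lambda>y. (fst (t y), fst (snd (t y)))) ` Y. bilipschitz_chart \<Gamma> F K" using t Y(1) by auto
  qed (use Y in simp)
qed

lemma surface_measure_space:
  assumes "surface_measure \<Gamma> ds" shows "space ds = \<Gamma>"
proof -
  have "sets ds = sets (restrict_space borel \<Gamma>)" using assms by (simp add: surface_measure_def)
  from sets_eq_imp_space_eq[OF this] show ?thesis by (simp add: space_restrict_space)
qed

lemma borel_measurable_preimage:
  fixes F :: "'a::topological_space \<Rightarrow> 'b::topological_space"
  assumes "continuous_on K F" "K \<in> sets borel" "A \<in> sets borel"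
  shows "{u\<in>K. F u \<in> A} \<in> sets borel"
proof -
  have "F -` A \<inter> space (restrict_space borel K) \<in> sets (restrict_space borel K)"
    by (rule measurable_sets[OF borel_measurable_continuous_on_restrict[OF assms(1)] assms(3)])
  then have "F -` A \<inter> K \<in> sets borel"
    using assms(2) by (auto simp: space_restrict_space sets_restrict_space)
  then show ?thesis by (simp add: vimage_def Int_def conj_commute)
qed

lemma compact_surface_borel: "smooth_closed_surface \<Gamma> \<Longrightarrow> \<Gamma> \<in> sets borel"
  by (auto simp: smooth_closed_surface_def intro: borel_compact)

lemma surface_measure_sets:
  assumes "surface_measure \<Gamma> ds" "smooth_closed_surface \<Gamma>"
  shows "A \<in> sets ds \<longleftrightarrow> A \<subseteq> \<Gamma> \<and> A \<in> sets borel"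
proof -
  have "sets ds = sets (restrict_space borel \<Gamma>)" using assms(1) by (simp add: surface_measure_def)
  then show ?thesis using sets_restrict_space_iff[of \<Gamma> borel A] compact_surface_borel[OF assms(2)] by simp
qed

text \<open>The preimage is contained in \<open>K\<close> because the parametrization is injective on all of \<open>U\<close>.\<close>

lemma surface_measure_chart_le:
  assumes "surface_measure \<Gamma> ds" "smooth_closed_surface \<Gamma>"
    "surface_param \<Gamma> U F" "K \<subseteq> U" "compact K" "\<And>u. u \<in> K \<Longrightarrow> surf_jac F u \<le> J" "0 \<le> J"
    "A \<in> sets ds" "A \<subseteq> F ` K"
  shows "{u\<in>K. F u \<in> A} \<in> sets borel" "emeasure ds A \<le> ennreal J * emeasure lborel {u\<in>K. F u \<in> A}"
proof -
  have c: "continuous_on K F"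
  proof -
    have "smooth U F" using assms(3) by (simp add: surface_param_def)
    from continuous_on_subset[OF smooth_continuous_on[OF this] assms(4)] show ?thesis .
  qed
  show b: "{u\<in>K. F u \<in> A} \<in> sets borel"
    by (rule borel_measurable_preimage[OF c]) (use assms surface_measure_sets[OF assms(1,2)] in \<open>auto intro: borel_compact\<close>)
  have inj: "inj_on F U" using assms(3) by (simp add: surface_param_def)
  have e: "{u\<in>U. F u \<in> A} = {u\<in>K. F u \<in> A}" using assms(4,9) inj by (auto dest: inj_onD)
  have "emeasure ds A = (\<integral>\<^sup>+u\<in>{u\<in>U. F u \<in> A}. ennreal (surf_jac F u) \<partial>lborel)"
  proof -
    have "A \<subseteq> F ` U" using assms(4,9) by blast
    then show ?thesis using assms(1,3,8) unfolding surface_measure_def by blast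
  qed
  also have "\<dots> \<le> (\<integral>\<^sup>+u\<in>{u\<in>K. F u \<in> A}. ennreal J \<partial>lborel)"
    unfolding e by (intro nn_integral_mono) (auto simp: indicator_def intro!: ennreal_leI assms)
  also have "\<dots> = ennreal J * emeasure lborel {u\<in>K. F u \<in> A}"
    using b by (simp add: nn_integral_cmult_indicator)
  finally show "emeasure ds A \<le> ennreal J * emeasure lborel {u\<in>K. F u \<in> A}" .
qed

lemma surface_measure_atlas_le:
  assumes "surface_measure \<Gamma> ds" "smooth_closed_surface \<Gamma>" "finite \<C>" "\<Gamma> \<subseteq> (\<Union>(F, K)\<in>\<C>. F ` K)"
    "\<forall>(F, K)\<in>\<C>. bilipschitz_chart \<Gamma> F K" "A \<in> sets ds"
  shows "emeasure ds A \<le> (\<Sum>(F, K)\<in>\<C>. emeasure ds (A \<inter> F ` K))"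
    "\<And>F K. (F, K) \<in> \<C> \<Longrightarrow> A \<inter> F ` K \<in> sets ds"
proof -
  show m: "A \<inter> F ` K \<in> sets ds" if FK: "(F, K) \<in> \<C>" for F K
  proof -
    have "bilipschitz_chart \<Gamma> F K" using assms(5) FK by blast
    then obtain U where "surface_param \<Gamma> U F" "K \<subseteq> U" "compact K" by (rule bilipschitz_chartE)
    then have "smooth U F" "F ` K \<subseteq> \<Gamma>" "K \<subseteq> U" "compact K" by (auto simp: surface_param_def)
    then have "compact (F ` K)" "F ` K \<subseteq> \<Gamma>"
      by (auto intro!: compact_continuous_image continuous_on_subset[OF smooth_continuous_on])
    then show ?thesis using assms(6) surface_measure_sets[OF assms(1,2)] by (auto intro: borel_compact)
  qed
  have "A \<subseteq> \<Gamma>" using assms(6) surface_measure_sets[OF assms(1,2)] by auto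
  then have "A = (\<Union>p\<in>\<C>. A \<inter> (case p of (F, K) \<Rightarrow> F ` K))"
    unfolding Int_UN_distrib[symmetric] using assms(4) by (intro Int_absorb2[symmetric]) (rule order_trans)
  then have "emeasure ds A = emeasure ds (\<Union>p\<in>\<C>. A \<inter> (case p of (F, K) \<Rightarrow> F ` K))"
    by (rule arg_cong)
  also have "\<dots> \<le> (\<Sum>p\<in>\<C>. emeasure ds (A \<inter> (case p of (F, K) \<Rightarrow> F ` K)))"
    by (rule emeasure_subadditive_finite) (use assms(3) m in \<open>auto split: prod.splits\<close>)
  finally show "emeasure ds A \<le> (\<Sum>(F, K)\<in>\<C>. emeasure ds (A \<inter> F ` K))"
    by (simp add: case_prod_beta)
qed

lemma surface_measure_cball_sets:
  assumes "surface_measure \<Gamma> ds" "smooth_closed_surface \<Gamma>"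
  shows "\<Gamma> \<inter> cball x R \<in> sets ds"
  unfolding surface_measure_sets[OF assms]
  by (intro conjI Int_lower1 sets.Int compact_surface_borel[OF assms(2)] borel_closed closed_cball)

text \<open>In each chart of a finite atlas the part of the surface in a ball of radius \<open>R\<close> has a preimage of diameter at
most \<open>2 R / c\<close>, where \<open>c\<close> is the expansion constant. The plane area of the preimage is therefore
\<open>O(R\<^sup>2)\<close>, uniformly in the centre of the ball.\<close>

lemma surface_measure_ball:
  assumes "surface_measure \<Gamma> ds" "smooth_closed_surface \<Gamma>"
  shows "\<exists>C\<ge>0. \<forall>x R. 0 \<le> R \<longrightarrow> emeasure ds (\<Gamma> \<inter> cball x R) \<le> ennreal (C * R^2)"
proof -
  obtain \<C> where \<C>: "finite \<C>" "\<Gamma> \<subseteq> (\<Union>(F, K)\<in>\<C>. F ` K)" "\<forall>(F, K)\<in>\<C>. bilipschitz_chart \<Gamma> F K"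
    using smooth_closed_surface_finite_atlas[OF assms(2)] by blast
  have "\<exists>C\<ge>0. \<forall>x R. 0 \<le> R \<longrightarrow> emeasure ds (\<Gamma> \<inter> cball x R \<inter> F ` K) \<le> ennreal (C * R^2)"
    if FK: "(F, K) \<in> \<C>" for F K
  proof -
    have "bilipschitz_chart \<Gamma> F K" using \<C>(3) FK by blast
    then obtain U c J where *: "compact K" "surface_param \<Gamma> U F" "K \<subseteq> U" "0 < c" "0 \<le> J"
      "\<forall>u\<in>K. \<forall>v\<in>K. c * norm (u - v) \<le> norm (F u - F v)" "\<forall>u\<in>K. surf_jac F u \<le> J"
      by (rule bilipschitz_chartE)
    define C where "C = J * (unit_ball_vol 2 * (2 / c)^2)"
    have "0 \<le> C" using * by (simp add: C_def)
    moreover have "emeasure ds (\<Gamma> \<inter> cball x R \<inter> F ` K) \<le> ennreal (C * R^2)" if R: "0 \<le> R" for x R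
    proof -
      let ?A = "\<Gamma> \<inter> cball x R \<inter> F ` K"
      have A0: "\<Gamma> \<inter> cball x R \<in> sets ds"
        by (rule surface_measure_cball_sets[OF assms])
      have A: "?A \<in> sets ds" by (rule surface_measure_atlas_le(2)[OF assms \<C> A0 FK])
      note le = surface_measure_chart_le[OF assms *(2,3,1) *(7)[rule_format] *(5) A]
      let ?S = "{u \<in> K. F u \<in> ?A}"
      have "emeasure lborel ?S \<le> ennreal (unit_ball_vol 2 * (2 * R / c)^2)"
      proof (cases "?S = {}")
        case False
        then obtain u0 where u0: "u0 \<in> ?S" by blast
        have "?S \<subseteq> cball u0 (2 * R / c)"
        proof
          fix u assume u: "u \<in> ?S"
          have "c * norm (u0 - u) \<le> norm (F u0 - F u)" using *(6) u u0 by blast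
          also have "\<dots> \<le> norm (F u0 - x) + norm (F u - x)"
            using norm_triangle_ineq4[of "F u0 - x" "F u - x"] by simp
          also have "\<dots> \<le> 2 * R" using u u0 by (auto simp: dist_norm norm_minus_commute)
          finally show "u \<in> cball u0 (2 * R / c)" using *(4) by (simp add: dist_norm field_simps)
        qed
        then have "emeasure lborel ?S \<le> emeasure lborel (cball u0 (2 * R / c))"
          by (rule emeasure_mono) simp
        also have "\<dots> = ennreal (unit_ball_vol 2 * (2 * R / c)^2)"
          using R *(4) by (simp add: emeasure_cball)
        finally show ?thesis .
      next
        case True
        show ?thesis unfolding True by simp
      qed
      then have "ennreal J * emeasure lborel ?S \<le> ennreal J * ennreal (unit_ball_vol 2 * (2 * R / c)^2)"
        by (rule mult_left_mono) simp
      also have "\<dots> = ennreal (C * R^2)"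
      proof -
        have "C * R^2 = J * (unit_ball_vol 2 * (2 * R / c)^2)" by (simp add: C_def power_divide power_mult_distrib)
        then show ?thesis using *(5) by (simp add: ennreal_mult')
      qed
      finally show ?thesis using le(2) by auto
    qed
    ultimately show ?thesis by blast
  qed
  note chart = this
  have "\<forall>p\<in>\<C>. \<exists>C. 0 \<le> C \<and> (\<forall>x R. 0 \<le> R \<longrightarrow> emeasure ds (\<Gamma> \<inter> cball x R \<inter> fst p ` snd p) \<le> ennreal (C * R^2))"
  proof
    fix p assume "p \<in> \<C>"
    then have "(fst p, snd p) \<in> \<C>" by simp
    from chart[OF this] show "\<exists>C. 0 \<le> C \<and> (\<forall>x R. 0 \<le> R \<longrightarrow>
      emeasure ds (\<Gamma> \<inter> cball x R \<inter> fst p ` snd p) \<le> ennreal (C * R^2))" .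
  qed
  from bchoice[OF this] obtain C where "\<forall>p\<in>\<C>. 0 \<le> C p \<and>
      (\<forall>x R. 0 \<le> R \<longrightarrow> emeasure ds (\<Gamma> \<inter> cball x R \<inter> fst p ` snd p) \<le> ennreal (C p * R^2))" ..
  then have C: "\<And>p. p \<in> \<C> \<Longrightarrow> C p \<ge> 0"
    "\<And>p x R. p \<in> \<C> \<Longrightarrow> 0 \<le> R \<Longrightarrow> emeasure ds (\<Gamma> \<inter> cball x R \<inter> fst p ` snd p) \<le> ennreal (C p * R^2)"
    by blast+
  show ?thesis
  proof (intro exI[of _ "\<Sum>p\<in>\<C>. C p"] conjI allI impI)
    show "0 \<le> (\<Sum>p\<in>\<C>. C p)" using C by (simp add: sum_nonneg)
    fix x :: "real^3" and R :: real assume R: "0 \<le> R"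
    have A0: "\<Gamma> \<inter> cball x R \<in> sets ds"
      by (rule surface_measure_cball_sets[OF assms])
    have "emeasure ds (\<Gamma> \<inter> cball x R) \<le> (\<Sum>p\<in>\<C>. emeasure ds (\<Gamma> \<inter> cball x R \<inter> fst p ` snd p))"
      using surface_measure_atlas_le(1)[OF assms \<C> A0] by (simp add: case_prod_beta)
    also have "\<dots> \<le> (\<Sum>p\<in>\<C>. ennreal (C p * R^2))" by (intro sum_mono C R)
    also have "\<dots> = ennreal ((\<Sum>p\<in>\<C>. C p) * R^2)"
      by (subst sum_ennreal) (auto simp: sum_distrib_right C(1))
    finally show "emeasure ds (\<Gamma> \<inter> cball x R) \<le> ennreal ((\<Sum>p\<in>\<C>. C p) * R^2)" .
  qed
qed

lemma smooth_Lipschitz_on_compact_convex: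
  fixes F :: "'a::euclidean_space \<Rightarrow> 'b::real_normed_vector"
  assumes "open V" "smooth V F" "compact S" "convex S" "S \<subseteq> V"
  shows "\<exists>B\<ge>0. \<forall>u\<in>S. \<forall>v\<in>S. norm (F u - F v) \<le> B * norm (u - v)"
proof -
  have "Ck 1 V F" using assms(2) by (simp add: smooth_def)
  then obtain K where K: "K \<ge> 0" "jet_bounded 1 V S F K 1"
    using Ck_jet_bounded_compact[OF _ assms(1,3,5)] by blast
  have diff: "(F has_derivative frechet_derivative F (at u)) (at u)" if "u \<in> S" for u
    using has_derivative_frechet smooth_differentiable assms that by blast
  have "norm (F u - F v) \<le> DIM('a) * K * norm (u - v)" if "u \<in> S" "v \<in> S" for u v
  proof (rule differentiable_bound[OF assms(4) _ _ that])
    fix w assume w: "w \<in> S"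
    show "(F has_derivative frechet_derivative F (at w)) (at w within S)"
      using diff[OF w] has_derivative_at_withinI by blast
    show "onorm (frechet_derivative F (at w)) \<le> DIM('a) * K"
    proof (rule onorm_le)
      show "norm (frechet_derivative F (at w) v) \<le> DIM('a) * K * norm v" for v
        by (rule linear_norm_le_Basis) (use diff[OF w] has_derivative_linear K(2) w in auto)
    qed
  qed
  then show ?thesis using K(1) by (intro exI[of _ "DIM('a) * K"]) auto
qed

text \<open>The boundary of a convex set in the plane is negligible. In a chart, the boundary curve of the element is the image of
this set under a map \<open>H\<close>, the inverse of the chart after \<open>F\<close>, which is Lipschitz continuous, so it is negligible
too. This makes overlaps of neighbouring elements harmless.\<close>

lemma surface_measure_element_frontier:
  fixes F :: "real^2 \<Rightarrow> real^3"
  assumes "surface_measure \<Gamma> ds" "smooth_closed_surface \<Gamma>"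
    "open V" "smooth V F" "Th \<subseteq> V" "compact Th" "convex Th" "F ` Th \<subseteq> \<Gamma>"
  shows "F ` frontier Th \<in> null_sets ds"
proof -
  let ?A = "F ` frontier Th"
  have fr: "frontier Th \<subseteq> Th" using assms(6) compact_imp_closed frontier_subset_closed by blast
  have "continuous_on (frontier Th) F"
    by (rule continuous_on_subset[OF smooth_continuous_on[OF assms(4)]]) (use assms(5) fr in blast)
  then have "compact ?A" by (rule compact_continuous_image[OF _ compact_frontier[OF assms(6)]])
  moreover have "?A \<subseteq> \<Gamma>" using fr assms(8) by blast
  ultimately have A: "?A \<in> sets ds"
    unfolding surface_measure_sets[OF assms(1,2)] by (intro conjI borel_compact)
  obtain \<C> where \<C>: "finite \<C>" "\<Gamma> \<subseteq> (\<Union>(F, K)\<in>\<C>. F ` K)" "\<forall>(F, K)\<in>\<C>. bilipschitz_chart \<Gamma> F K"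
    using smooth_closed_surface_finite_atlas[OF assms(2)] by blast
  obtain B where B: "B \<ge> 0" "\<And>u v. u \<in> Th \<Longrightarrow> v \<in> Th \<Longrightarrow> norm (F u - F v) \<le> B * norm (u - v)"
    using smooth_Lipschitz_on_compact_convex[OF assms(3,4,6,7,5)] by blast
  have "emeasure ds (?A \<inter> G ` K) = 0" if GK: "(G, K) \<in> \<C>" for G K
  proof -
    have "bilipschitz_chart \<Gamma> G K" using \<C>(3) GK by blast
    then obtain U c J where *: "compact K" "surface_param \<Gamma> U G" "K \<subseteq> U" "0 < c" "0 \<le> J"
      "\<forall>u\<in>K. \<forall>v\<in>K. c * norm (u - v) \<le> norm (G u - G v)" "\<forall>u\<in>K. surf_jac G u \<le> J"
      by (rule bilipschitz_chartE)
    have AK: "?A \<inter> G ` K \<in> sets ds" by (rule surface_measure_atlas_le(2)[OF assms(1,2) \<C> A GK])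
    note le = surface_measure_chart_le[OF assms(1,2) *(2,3,1) *(7)[rule_format] *(5) AK]
    let ?S = "{u \<in> K. G u \<in> ?A \<inter> G ` K}" and ?W = "{w \<in> frontier Th. F w \<in> G ` K}"
    define H where "H = (\<lambda>w. inv_into K G (F w))"
    have injK: "inj_on G K" using *(2,3) inj_on_subset by (auto simp: surface_param_def)
    have H: "H w \<in> K" "G (H w) = F w" if "w \<in> ?W" for w
      using that by (auto simp: H_def inv_into_into f_inv_into_f)
    have Hl: "norm (H v - H w) \<le> B / c * norm (v - w)" if "v \<in> ?W" "w \<in> ?W" for v w
    proof -
      have "c * norm (H v - H w) \<le> norm (F v - F w)" using *(6)[rule_format, OF H(1)[OF that(1)] H(1)[OF that(2)]] H that by simp
      also have "\<dots> \<le> B * norm (v - w)" using B(2) that fr by blast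
      finally show ?thesis using *(4) by (simp add: field_simps)
    qed
    have "negligible (H ` ?W)"
    proof (rule negligible_locally_Lipschitz_image)
      show "negligible ?W" by (rule negligible_subset[OF negligible_convex_frontier[OF assms(7)]]) blast
      show "\<exists>T B. open T \<and> w \<in> T \<and> (\<forall>v\<in>?W \<inter> T. norm (H v - H w) \<le> B * norm (v - w))" if "w \<in> ?W" for w
        using Hl[OF _ that] by (intro exI[of _ UNIV] exI[of _ "B / c"] conjI ballI open_UNIV UNIV_I) blast
    qed simp
    moreover have "?S \<subseteq> H ` ?W"
    proof
      fix u assume u: "u \<in> ?S"
      then obtain w where w: "w \<in> frontier Th" "G u = F w" by auto
      have uK: "u \<in> K" using u by simp
      have "H w = u" unfolding H_def w(2)[symmetric] by (rule inv_into_f_f[OF injK uK])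
      moreover have "F w \<in> G ` K" using uK w(2) by (metis imageI)
      ultimately show "u \<in> H ` ?W" using w(1) by blast
    qed
    ultimately have "negligible ?S" by (rule negligible_subset)
    then have "emeasure lborel ?S = 0"
      using le(1) by (simp add: negligible_iff_null_sets null_sets_completion_iff null_setsD1)
    then show ?thesis using le(2) by simp
  qed
  then have "(\<Sum>(G, K)\<in>\<C>. emeasure ds (?A \<inter> G ` K)) = 0"
    using \<C>(1) by (auto simp: sum_eq_0_iff)
  then show ?thesis using surface_measure_atlas_le(1)[OF assms(1,2) \<C> A] A by (auto simp: null_sets_def)
qed

section \<open>Integrals over a surface element\<close>

text \<open>One element of a mesh. The parametrization is assumed to be injective and to map into \<open>\<Gamma>\<close> only on
the reference element itself, so it is a chart of \<open>\<Gamma>\<close> only on the interior.\<close>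

locale surface_element =
  fixes \<Gamma> :: "(real^3) set" and ds :: "(real^3) measure" and Th :: "(real^2) set"
    and F :: "real^2 \<Rightarrow> real^3" and V :: "(real^2) set"
  assumes surface: "smooth_closed_surface \<Gamma>"
    and measure: "surface_measure \<Gamma> ds"
    and reference: "reference_element Th"
    and V: "open V" "Th \<subseteq> V" "smooth V F"
    and inj: "inj_on F Th"
    and sub: "F ` Th \<subseteq> \<Gamma>"
    and regular: "\<And>u. u \<in> Th \<Longrightarrow> surf_jac F u \<noteq> 0"
begin

lemma Th: "compact Th" "convex Th" "interior Th \<noteq> {}"
  using reference by (auto simp: reference_element_def)

lemma interior_V: "interior Th \<subseteq> V"
  using V(2) interior_subset by blast

lemma surface_param_interior: "surface_param \<Gamma> (interior Th) F"
  unfolding surface_param_def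
proof (intro conjI ballI)
  show "smooth (interior Th) F" by (rule smooth_subset[OF V(3) interior_V])
  show "inj_on F (interior Th)" by (rule inj_on_subset[OF inj interior_subset])
  show "F ` interior Th \<subseteq> \<Gamma>" using sub interior_subset by blast
  show "surf_jac F u \<noteq> 0" if "u \<in> interior Th" for u using regular that interior_subset by blast
qed simp

lemma continuous_F: "continuous_on V F"
  by (rule smooth_continuous_on[OF V(3)])

lemma continuous_J: "continuous_on V (surf_jac F)"
  by (rule surf_jac_continuous_on[OF V(3)])

lemma frontier_sub: "frontier Th \<subseteq> Th"
  by (rule frontier_subset_closed[OF compact_imp_closed[OF Th(1)]])

lemma frontier_null: "F ` frontier Th \<in> null_sets ds"
  by (rule surface_measure_element_frontier[OF measure surface V(1,3,2) Th(1,2) sub])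

lemma element_sets: "F ` Th \<in> sets ds"
proof -
  have "compact (F ` Th)"
    by (rule compact_continuous_image[OF continuous_on_subset[OF continuous_F V(2)] Th(1)])
  then show ?thesis unfolding surface_measure_sets[OF measure surface] using sub borel_compact by blast
qed

lemma image_interior: "F ` interior Th = F ` Th - F ` frontier Th"
proof -
  have "closure Th = Th" by (rule closure_closed[OF compact_imp_closed[OF Th(1)]])
  then have f: "frontier Th = Th - interior Th" by (simp add: frontier_def)
  have "F ` (Th - frontier Th) = F ` Th - F ` frontier Th"
    by (rule inj_on_image_set_diff[OF inj]) (use frontier_sub in auto)
  moreover have "Th - frontier Th = interior Th" using f interior_subset by blast
  ultimately show ?thesis by simp
qed

lemma interior_sets: "F ` interior Th \<in> sets ds"
  unfolding image_interior by (rule sets.Diff[OF element_sets null_setsD2[OF frontier_null]])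

lemma frontier_negligible: "frontier Th \<in> null_sets lborel"
proof -
  have "frontier Th \<in> sets borel" by (simp add: borel_closed)
  moreover have "negligible (frontier Th)" by (rule negligible_convex_frontier[OF Th(2)])
  ultimately show ?thesis by (simp add: negligible_iff_null_sets null_sets_completion_iff)
qed

lemma emeasure_element:
  assumes "A \<in> sets ds" "A \<subseteq> F ` interior Th"
  shows "emeasure ds A = (\<integral>\<^sup>+u\<in>{u\<in>interior Th. F u \<in> A}. ennreal (surf_jac F u) \<partial>lborel)"
  using assms measure surface_param_interior unfolding surface_measure_def by blast

lemma measurable_F: "F \<in> measurable (restrict_space lborel (interior Th)) (restrict_space ds (F ` interior Th))"
proof (rule measurable_restrict_space2)
  show "F \<in> space (restrict_space lborel (interior Th)) \<rightarrow> F ` interior Th"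
    by (auto simp: space_restrict_space)
  have c: "continuous_on (interior Th) F" by (rule continuous_on_subset[OF continuous_F interior_V])
  have "F \<in> measurable (restrict_space borel (interior Th)) (restrict_space borel \<Gamma>)"
    by (rule measurable_restrict_space2[OF _ borel_measurable_continuous_on_restrict[OF c]])
      (use sub interior_subset in \<open>fastforce simp: space_restrict_space\<close>)
  moreover have "sets ds = sets (restrict_space borel \<Gamma>)" using measure by (simp add: surface_measure_def)
  moreover have "sets (restrict_space lborel (interior Th)) = sets (restrict_space borel (interior Th))"
    by (rule sets_restrict_space_cong) simp
  ultimately show "F \<in> measurable (restrict_space lborel (interior Th)) ds"
    using measurable_cong_sets by blast
qed

lemma measurable_J: "surf_jac F \<in> borel_measurable (restrict_space lborel (interior Th))"
proof -
  have "continuous_on (interior Th) (surf_jac F)" by (rule continuous_on_subset[OF continuous_J interior_V])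
  then have "surf_jac F \<in> borel_measurable (restrict_space borel (interior Th))"
    by (rule borel_measurable_continuous_on_restrict)
  moreover have "sets (restrict_space lborel (interior Th)) = sets (restrict_space borel (interior Th))"
    by (rule sets_restrict_space_cong) simp
  ultimately show ?thesis using measurable_cong_sets by blast
qed

text \<open>On the image of the interior, the surface measure is the push-forward of Lebesgue measure with density
the Jacobian; this is what the definition of the surface measure says in the chart given by the element.\<close>

lemma restrict_surface_measure:
  "restrict_space ds (F ` interior Th) =
    distr (density (restrict_space lborel (interior Th)) (\<lambda>u. ennreal (surf_jac F u)))
      (restrict_space ds (F ` interior Th)) F" (is "?R = distr ?N _ F")
proof (rule measure_eqI)
  show "sets ?R = sets (distr ?N ?R F)" by simp
  fix A assume A: "A \<in> sets ?R"
  have S: "space ds \<inter> F ` interior Th \<inter> F ` interior Th = F ` interior Th"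
    using sets.sets_into_space[OF interior_sets] by blast
  have A': "A \<in> sets ds" "A \<subseteq> F ` interior Th"
    using A sets_restrict_space_iff[of "F ` interior Th" ds A] interior_sets S by auto
  have mF: "F \<in> measurable ?N ?R" using measurable_F by simp
  have pre: "F -` A \<inter> interior Th \<in> sets (restrict_space lborel (interior Th))"
    using measurable_sets[OF measurable_F A] by (simp add: space_restrict_space)
  have "emeasure (distr ?N ?R F) A = emeasure ?N (F -` A \<inter> interior Th)"
    by (subst emeasure_distr[OF mF A]) (simp add: space_restrict_space)
  also have "\<dots> = (\<integral>\<^sup>+u. ennreal (surf_jac F u) * indicator (F -` A \<inter> interior Th) u
      \<partial>restrict_space lborel (interior Th))"
    by (rule emeasure_density[OF _ pre]) (use measurable_J in measurable)
  also have "\<dots> = (\<integral>\<^sup>+u. ennreal (surf_jac F u) * indicator (F -` A \<inter> interior Th) u * indicator (interior Th) u \<partial>lborel)"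
    by (rule nn_integral_restrict_space) simp
  also have "\<dots> = (\<integral>\<^sup>+u\<in>{u\<in>interior Th. F u \<in> A}. ennreal (surf_jac F u) \<partial>lborel)"
    by (intro nn_integral_cong) (auto simp: indicator_def)
  also have "\<dots> = emeasure ds A" using emeasure_element[OF A'] by simp
  also have "\<dots> = emeasure ?R A"
    by (rule emeasure_restrict_space[symmetric]) (use interior_sets S A' in auto)
  finally show "emeasure ?R A = emeasure (distr ?N ?R F) A" by simp
qed

lemma set_integral_element_interior:
  fixes f :: "real^3 \<Rightarrow> real"
  assumes f: "f \<in> borel_measurable ds"
  shows "(LINT y:F ` interior Th|ds. f y) = (LINT u:interior Th|lborel. surf_jac F u * f (F u))"
proof -
  let ?R = "restrict_space ds (F ` interior Th)" and ?L = "restrict_space lborel (interior Th)"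
  have fR: "f \<in> borel_measurable ?R" by (rule measurable_restrict_space1[OF f])
  have "(LINT y:F ` interior Th|ds. f y) = integral\<^sup>L ?R f"
    unfolding set_lebesgue_integral_def
    by (rule integral_restrict_space[symmetric]) (use interior_sets in auto)
  also have "\<dots> = integral\<^sup>L (distr (density ?L (\<lambda>u. ennreal (surf_jac F u))) ?R F) f"
    by (subst restrict_surface_measure) (rule refl)
  also have "\<dots> = integral\<^sup>L (density ?L (\<lambda>u. ennreal (surf_jac F u))) (\<lambda>u. f (F u))"
    by (rule integral_distr[OF _ fR]) (use measurable_F in simp)
  also have "\<dots> = integral\<^sup>L ?L (\<lambda>u. surf_jac F u *\<^sub>R f (F u))"
    by (rule integral_density[OF measurable_compose[OF measurable_F fR] measurable_J]) (simp add: surf_jac_eq)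
  also have "\<dots> = (LINT u:interior Th|lborel. surf_jac F u * f (F u))"
    unfolding set_lebesgue_integral_def by (subst integral_restrict_space) auto
  finally show ?thesis .
qed

lemma set_integral_interior_eq:
  fixes g :: "real^2 \<Rightarrow> real"
  assumes "continuous_on Th g"
  shows "(LINT u:interior Th|lborel. g u) = (LINT u:Th|lborel. g u)"
  unfolding set_lebesgue_integral_def
proof (rule integral_cong_AE)
  have "continuous_on (interior Th) g" by (rule continuous_on_subset[OF assms interior_subset])
  from borel_measurable_continuous_on_indicator[OF _ this]
  show "(\<lambda>u. indicat_real (interior Th) u *\<^sub>R g u) \<in> borel_measurable lborel" by simp
  from borel_measurable_continuous_on_indicator[OF borel_compact[OF Th(1)] assms]
  show "(\<lambda>u. indicat_real Th u *\<^sub>R g u) \<in> borel_measurable lborel" by simp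
  have "closure Th = Th" by (rule closure_closed[OF compact_imp_closed[OF Th(1)]])
  then have "u \<in> Th \<longleftrightarrow> u \<in> interior Th" if "u \<notin> frontier Th" for u
    using that interior_subset[of Th] by (auto simp: frontier_def)
  then show "AE u in lborel. indicat_real (interior Th) u *\<^sub>R g u = indicat_real Th u *\<^sub>R g u"
    by (intro AE_I'[OF frontier_negligible]) (auto simp: indicator_def)
qed

lemma measure_interior: "measure lborel (interior Th) = measure lborel Th"
  using set_integral_interior_eq[of "\<lambda>u. 1"] by (simp add: set_lebesgue_integral_def)

lemma measure_reference_pos: "0 < measure lborel Th"
proof -
  obtain a e where "e > 0" "ball a e \<subseteq> interior Th"
    using Th(3) open_interior[of Th] open_contains_ball by blast
  then have "measure lborel (ball a e) \<le> measure lborel Th"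
    using interior_subset[of Th] compact_imp_bounded[OF Th(1)] borel_compact[OF Th(1)]
    by (intro measure_mono_fmeasurable fmeasurable_compact Th(1)) auto
  moreover have "0 < measure lborel (ball a e)" using \<open>e > 0\<close> by (rule content_ball_pos)
  ultimately show ?thesis by linarith
qed

lemma emeasure_element_ge:
  assumes "\<And>u. u \<in> Th \<Longrightarrow> c \<le> surf_jac F u" "0 \<le> c"
  shows "ennreal (c * measure lborel Th) \<le> emeasure ds (F ` interior Th)"
proof -
  have "emeasure lborel (interior Th) = ennreal (measure lborel (interior Th))"
    by (rule emeasure_eq_ennreal_measure)
      (use emeasure_bounded_finite[OF bounded_subset[OF compact_imp_bounded[OF Th(1)] interior_subset]] in auto)
  then have "ennreal (c * measure lborel Th) = ennreal c * emeasure lborel (interior Th)"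
    using assms(2) by (simp add: measure_interior ennreal_mult')
  also have "\<dots> = (\<integral>\<^sup>+u. ennreal c * indicator (interior Th) u \<partial>lborel)"
    by (simp add: nn_integral_cmult_indicator)
  also have "\<dots> \<le> (\<integral>\<^sup>+u\<in>{u\<in>interior Th. F u \<in> F ` interior Th}. ennreal (surf_jac F u) \<partial>lborel)"
    by (intro nn_integral_mono) (use assms interior_subset in \<open>auto simp: indicator_def intro!: ennreal_leI\<close>)
  also have "\<dots> = emeasure ds (F ` interior Th)"
    using emeasure_element[OF interior_sets] by simp
  finally show ?thesis .
qed

end

section \<open>Sums over a mesh and integrals of decaying functions\<close>

lemma regular_mesh_element:
  assumes "smooth_closed_surface \<Gamma>" "surface_measure \<Gamma> ds" "reference_element Th"
    "regular_mesh \<Gamma> Th reg_s reg_u reg_lo reg_hi reg_D h M" "0 < reg_lo" "0 < h" "F \<in> M"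
  obtains V where "surface_element \<Gamma> ds Th F V"
proof -
  have t: "tessellation \<Gamma> Th M" and J: "\<forall>u\<in>Th. reg_lo * h^2 \<le> surf_jac F u"
    using assms(4,7) by (auto simp: regular_mesh_def)
  obtain V where V: "open V" "Th \<subseteq> V" "smooth V F" using t assms(7) unfolding tessellation_def by blast
  have inj: "inj_on F Th" and sub: "F ` Th \<subseteq> \<Gamma>" using t assms(7) unfolding tessellation_def by blast+
  have "0 < reg_lo * h^2" using assms(5,6) by simp
  then have "surf_jac F u \<noteq> 0" if "u \<in> Th" for u using J that by fastforce
  then have "surface_element \<Gamma> ds Th F V"
    using assms V inj sub by (intro surface_element.intro) auto
  then show ?thesis by (rule that)
qed

lemma surface_measure_finite:
  assumes "smooth_closed_surface \<Gamma>" "surface_measure \<Gamma> ds"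
  shows "finite_measure ds"
proof (rule finite_measureI)
  obtain C where C: "\<And>x R. 0 \<le> R \<Longrightarrow> emeasure ds (\<Gamma> \<inter> cball x R) \<le> ennreal (C * R^2)"
    using surface_measure_ball[OF assms(2,1)] by blast
  have "bounded \<Gamma>" using assms(1) by (simp add: smooth_closed_surface_def compact_imp_bounded)
  then obtain R where R: "\<forall>y\<in>\<Gamma>. norm y \<le> R" "0 < R" by (auto simp: bounded_pos)
  then have "\<Gamma> \<inter> cball 0 R = space ds" by (auto simp: surface_measure_space[OF assms(2)])
  then have "emeasure ds (space ds) \<le> ennreal (C * R^2)" using C[of R 0] R(2) by simp
  then show "emeasure ds (space ds) \<noteq> \<infinity>" by (auto simp: top_unique)
qed

lemma continuous_on_surface_measurable:
  fixes f :: "real^3 \<Rightarrow> 'b::{banach, second_countable_topology}"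
  assumes "smooth_closed_surface \<Gamma>" "surface_measure \<Gamma> ds" "continuous_on \<Gamma> f"
  shows "f \<in> borel_measurable ds"
proof -
  have "f \<in> borel_measurable (restrict_space borel \<Gamma>)" by (rule borel_measurable_continuous_on_restrict[OF assms(3)])
  moreover have "sets ds = sets (restrict_space borel \<Gamma>)" using assms(2) by (simp add: surface_measure_def)
  ultimately show ?thesis using measurable_cong_sets by blast
qed

lemma continuous_on_surface_integrable:
  fixes f :: "real^3 \<Rightarrow> 'b::{banach, second_countable_topology}"
  assumes "smooth_closed_surface \<Gamma>" "surface_measure \<Gamma> ds" "continuous_on \<Gamma> f"
  shows "integrable ds f"
proof -
  interpret finite_measure ds by (rule surface_measure_finite[OF assms(1,2)])
  have "compact (f ` \<Gamma>)"
    using compact_continuous_image[OF assms(3)] assms(1) by (simp add: smooth_closed_surface_def)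
  then obtain B where B: "\<forall>y\<in>\<Gamma>. norm (f y) \<le> B" using compact_imp_bounded bounded_iff by (metis image_eqI)
  show ?thesis
    by (rule integrable_const_bound[OF _ continuous_on_surface_measurable[OF assms]])
      (use B in \<open>auto simp: surface_measure_space[OF assms(2)] intro!: AE_I2\<close>)
qed

text \<open>The open elements are disjoint, and together they cover the surface up to the images of the boundary
of the reference element, which are null sets.\<close>

lemma integral_regular_mesh:
  fixes f :: "real^3 \<Rightarrow> real"
  assumes "smooth_closed_surface \<Gamma>" "surface_measure \<Gamma> ds" "reference_element Th"
    "regular_mesh \<Gamma> Th reg_s reg_u reg_lo reg_hi reg_D h M" "0 < reg_lo" "0 < h" "continuous_on \<Gamma> f"
  shows "(LINT y|ds. f y) = (\<Sum>F\<in>M. LINT u:Th|lborel. surf_jac F u * f (F u))"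
proof -
  have t: "tessellation \<Gamma> Th M" using assms(4) by (simp add: regular_mesh_def)
  have el: "\<exists>V. surface_element \<Gamma> ds Th F V" if "F \<in> M" for F
    using regular_mesh_element[OF assms(1-6) that] by blast
  have fin: "finite M" using t by (simp add: tessellation_def)
  have \<Gamma>: "\<Gamma> = (\<Union>F\<in>M. F ` Th)" using t by (simp add: tessellation_def)
  have dis: "disjoint_family_on (\<lambda>F. F ` interior Th) M"
    using t by (auto simp: tessellation_def pairwise_def disjnt_def disjoint_family_on_def)
  have m: "f \<in> borel_measurable ds" by (rule continuous_on_surface_measurable[OF assms(1,2,7)])
  have i: "integrable ds f" by (rule continuous_on_surface_integrable[OF assms(1,2,7)])
  have T: "F ` interior Th \<in> sets ds" if "F \<in> M" for F
    using el[OF that] surface_element.interior_sets by blast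
  have TU: "(\<Union>F\<in>M. F ` interior Th) \<in> sets ds" using T fin by blast
  have null: "(\<Union>F\<in>M. F ` frontier Th) \<in> null_sets ds"
    by (rule null_sets.finite_UN[OF fin]) (use el surface_element.frontier_null in blast)
  have "(LINT y|ds. f y) = (LINT y:(\<Union>F\<in>M. F ` interior Th)|ds. f y)"
    unfolding set_lebesgue_integral_def
  proof (rule integral_cong_AE[OF m])
    show "(\<lambda>y. indicat_real (\<Union>F\<in>M. F ` interior Th) y *\<^sub>R f y) \<in> borel_measurable ds"
      using TU m by measurable
    have in_interior: "y \<in> (\<Union>F\<in>M. F ` interior Th)" if "y \<in> \<Gamma>" "y \<notin> (\<Union>F\<in>M. F ` frontier Th)" for y
    proof -
      obtain F where F: "F \<in> M" "y \<in> F ` Th" using \<Gamma> \<open>y \<in> \<Gamma>\<close> by blast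
      have "y \<notin> F ` frontier Th" using that(2) F(1) by blast
      moreover obtain V where V: "surface_element \<Gamma> ds Th F V" using el[OF F(1)] by blast
      ultimately have "y \<in> F ` interior Th" using F(2) surface_element.image_interior[OF V] by blast
      then show ?thesis using F(1) by blast
    qed
    show "AE y in ds. f y = indicat_real (\<Union>F\<in>M. F ` interior Th) y *\<^sub>R f y"
    proof (rule AE_I'[OF null], rule subsetI, rule ccontr)
      fix y assume y: "y \<in> {y \<in> space ds. f y \<noteq> indicat_real (\<Union>F\<in>M. F ` interior Th) y *\<^sub>R f y}"
        and n: "y \<notin> (\<Union>F\<in>M. F ` frontier Th)"
      have "y \<in> (\<Union>F\<in>M. F ` interior Th)"
        by (rule in_interior[OF _ n]) (use y surface_measure_space[OF assms(2)] in simp)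
      then have "indicat_real (\<Union>F\<in>M. F ` interior Th) y = 1" by (rule indicator_simps(1))
      then show False using y by simp
    qed
  qed
  also have "\<dots> = (\<Sum>F\<in>M. LINT y:F ` interior Th|ds. f y)"
  proof (rule set_integral_finite_Union[OF fin dis])
    show "set_integrable ds (F ` interior Th) f" if "F \<in> M" for F
      unfolding set_integrable_def using integrable_mult_indicator[OF T[OF that] i] .
  qed (use T in auto)
  also have "\<dots> = (\<Sum>F\<in>M. LINT u:Th|lborel. surf_jac F u * f (F u))"
  proof (rule sum.cong[OF refl])
    fix F assume F: "F \<in> M"
    then obtain V where V: "surface_element \<Gamma> ds Th F V" using el by blast
    interpret surface_element \<Gamma> ds Th F V by fact
    have "continuous_on Th (\<lambda>u. surf_jac F u * f (F u))"
      by (intro continuous_on_mult continuous_on_subset[OF continuous_J local.V(2)]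
          continuous_on_compose2[OF assms(7)] continuous_on_subset[OF continuous_F local.V(2)] sub)
    then show "(LINT y:F ` interior Th|ds. f y) = (LINT u:Th|lborel. surf_jac F u * f (F u))"
      using set_integral_element_interior[OF m] set_integral_interior_eq by simp
  qed
  finally show ?thesis .
qed

text \<open>A sum over elements is compared with an integral: each element has area at least
\<open>reg_lo h\<^sup>2\<close> times the area of the reference element.\<close>

lemma regular_mesh_sum_le_integral:
  assumes "smooth_closed_surface \<Gamma>" "surface_measure \<Gamma> ds" "reference_element Th"
    "regular_mesh \<Gamma> Th reg_s reg_u reg_lo reg_hi reg_D h M" "0 < reg_lo" "0 < h" "M' \<subseteq> M"
    "w \<in> borel_measurable ds" "\<And>F. F \<in> M' \<Longrightarrow> 0 \<le> c F"
    "\<And>F u. F \<in> M' \<Longrightarrow> u \<in> Th \<Longrightarrow> c F \<le> w (F u)"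
  shows "ennreal (reg_lo * measure lborel Th * h^2 * (\<Sum>F\<in>M'. c F)) \<le> (\<integral>\<^sup>+y. ennreal (w y) \<partial>ds)"
proof -
  have t: "tessellation \<Gamma> Th M" using assms(4) by (simp add: regular_mesh_def)
  have el: "\<exists>V. surface_element \<Gamma> ds Th F V" if "F \<in> M" for F
    using regular_mesh_element[OF assms(1-6) that] by blast
  have fin: "finite M'" using t assms(7) finite_subset by (auto simp: tessellation_def)
  have T: "F ` interior Th \<in> sets ds" if "F \<in> M'" for F
    using el assms(7) that surface_element.interior_sets by blast
  have dis: "disjoint_family_on (\<lambda>F. F ` interior Th) M'"
    using t assms(7) by (auto simp: tessellation_def pairwise_def disjnt_def disjoint_family_on_def) blast
  have "reg_lo * measure lborel Th * h^2 * (\<Sum>F\<in>M'. c F) = (\<Sum>F\<in>M'. c F * (reg_lo * h^2 * measure lborel Th))"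
    unfolding sum_distrib_right[symmetric] by (simp only: mult_ac)
  then have "ennreal (reg_lo * measure lborel Th * h^2 * (\<Sum>F\<in>M'. c F)) =
      (\<Sum>F\<in>M'. ennreal (c F * (reg_lo * h^2 * measure lborel Th)))"
    using assms(5,9) by (subst sum_ennreal) auto
  also have "\<dots> \<le> (\<Sum>F\<in>M'. ennreal (c F) * emeasure ds (F ` interior Th))"
  proof (rule sum_mono)
    fix F assume F: "F \<in> M'"
    then obtain V where V: "surface_element \<Gamma> ds Th F V" using el assms(7) by blast
    have "reg_lo * h^2 \<le> surf_jac F u" if "u \<in> Th" for u
      using assms(4,7) F that unfolding regular_mesh_def by blast
    from surface_element.emeasure_element_ge[OF V this]
    have "ennreal (reg_lo * h^2 * measure lborel Th) \<le> emeasure ds (F ` interior Th)"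
      using assms(5) by simp
    then show "ennreal (c F * (reg_lo * h^2 * measure lborel Th)) \<le> ennreal (c F) * emeasure ds (F ` interior Th)"
      using assms(9)[OF F] by (subst ennreal_mult') (auto intro: mult_left_mono)
  qed
  also have "\<dots> = (\<Sum>F\<in>M'. \<integral>\<^sup>+y. ennreal (c F) * indicator (F ` interior Th) y \<partial>ds)"
    using T by (simp add: nn_integral_cmult_indicator)
  also have "\<dots> = (\<integral>\<^sup>+y. (\<Sum>F\<in>M'. ennreal (c F) * indicator (F ` interior Th) y) \<partial>ds)"
    by (rule nn_integral_sum[symmetric]) (use T in measurable)
  also have "\<dots> \<le> (\<integral>\<^sup>+y. ennreal (w y) \<partial>ds)"
  proof (rule nn_integral_mono)
    fix y
    show "(\<Sum>F\<in>M'. ennreal (c F) * indicator (F ` interior Th) y) \<le> ennreal (w y)"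
    proof (cases "\<exists>F\<in>M'. y \<in> F ` interior Th")
      case True
      then obtain F where F: "F \<in> M'" "y \<in> F ` interior Th" by blast
      have "indicator (G ` interior Th) y = (0::ennreal)" if "G \<in> M' - {F}" for G
      proof -
        have "F ` interior Th \<inter> G ` interior Th = {}"
          using dis F(1) that unfolding disjoint_family_on_def by auto
        then show ?thesis using F(2) by (auto simp: indicator_def)
      qed
      then have "(\<Sum>G\<in>M'. ennreal (c G) * indicator (G ` interior Th) y) = ennreal (c F) * indicator (F ` interior Th) y"
        by (subst sum.remove[OF fin F(1)]) simp
      also have "\<dots> \<le> ennreal (w y)"
        using F assms(10)[OF F(1)] interior_subset by (auto intro!: ennreal_leI)
      finally show ?thesis .
    next
      case False
      then have "(\<Sum>F\<in>M'. ennreal (c F) * indicator (F ` interior Th) y) = 0"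
        by (intro sum.neutral) (auto simp: indicator_def)
      then show ?thesis by simp
    qed
  qed
  finally show ?thesis .
qed

text \<open>The function \<open>w\<close> is dominated by the step function \<open>\<Sum>\<^sub>j c\<^sub>j 1\<^bsub>B(x, R\<^sub>j)\<^esub>\<close>, whose integral is at most
\<open>C \<Sum>\<^sub>j c\<^sub>j R\<^sub>j\<^sup>2\<close>.\<close>

lemma surface_integral_le_shells:
  assumes "smooth_closed_surface \<Gamma>" "surface_measure \<Gamma> ds" "0 \<le> C"
    "\<And>R. 0 \<le> R \<Longrightarrow> emeasure ds (\<Gamma> \<inter> cball x R) \<le> ennreal (C * R^2)"
    "\<And>j. 0 \<le> c j" "\<And>j. 0 \<le> R j" "(\<lambda>j. c j * R j^2) sums S"
    "\<And>y. y \<in> \<Gamma> \<Longrightarrow> \<exists>j::nat. dist x y \<le> R j \<and> w y \<le> c j"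
  shows "(\<integral>\<^sup>+y. ennreal (w y) \<partial>ds) \<le> ennreal (C * S)"
proof -
  let ?B = "\<lambda>j. \<Gamma> \<inter> cball x (R j)"
  have B: "?B j \<in> sets ds" for j by (rule surface_measure_cball_sets[OF assms(2,1)])
  have "(\<integral>\<^sup>+y. ennreal (w y) \<partial>ds) \<le> (\<integral>\<^sup>+y. (\<Sum>j. ennreal (c j) * indicator (?B j) y) \<partial>ds)"
  proof (rule nn_integral_mono)
    fix y assume "y \<in> space ds"
    then have y: "y \<in> \<Gamma>" using surface_measure_space[OF assms(2)] by simp
    then obtain j where j: "dist x y \<le> R j" "w y \<le> c j" using assms(8) by blast
    have "ennreal (w y) \<le> ennreal (c j) * indicator (?B j) y" using y j by (auto intro: ennreal_leI)
    also have "\<dots> \<le> (\<Sum>j. ennreal (c j) * indicator (?B j) y)"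
    proof -
      define f where "f = (\<lambda>j. ennreal (c j) * indicator (?B j) y)"
      have "f j \<le> (\<Sum>j. f j)" using sum_le_suminf[OF summableI, of "{j}" f] by simp
      then show ?thesis by (simp only: f_def)
    qed
    finally show "ennreal (w y) \<le> (\<Sum>j. ennreal (c j) * indicator (?B j) y)" .
  qed
  also have "\<dots> = (\<Sum>j. \<integral>\<^sup>+y. ennreal (c j) * indicator (?B j) y \<partial>ds)"
    by (rule nn_integral_suminf) (use B in measurable)
  also have "\<dots> = (\<Sum>j. ennreal (c j) * emeasure ds (?B j))"
    using B by (simp add: nn_integral_cmult_indicator)
  also have "\<dots> \<le> (\<Sum>j. ennreal (C * (c j * R j^2)))"
  proof (rule suminf_le)
    fix j
    have "ennreal (c j) * emeasure ds (?B j) \<le> ennreal (c j) * ennreal (C * R j^2)"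
      by (rule mult_left_mono[OF assms(4)[OF assms(6)]]) simp
    also have "\<dots> = ennreal (c j * (C * R j^2))" using assms(5) by (simp add: ennreal_mult')
    finally show "ennreal (c j) * emeasure ds (?B j) \<le> ennreal (C * (c j * R j^2))" by (simp add: mult_ac)
  qed auto
  also have "\<dots> = ennreal (C * S)"
    using assms(3,5) sums_mult[OF assms(7), of C]
    by (intro suminf_ennreal_eq) auto
  finally show ?thesis .
qed

text \<open>Dyadic balls of radii \<open>2\<^sup>j \<delta>\<close>: the weights \<open>8\<^bsup>-j\<^esup>\<close> beat the areas \<open>4\<^sup>j \<delta>\<^sup>2\<close>.\<close>

lemma surface_integral_decay_cubic:
  assumes "smooth_closed_surface \<Gamma>" "surface_measure \<Gamma> ds"
  shows "\<exists>C\<ge>0. \<forall>x \<delta>. 0 < \<delta> \<longrightarrow> (\<integral>\<^sup>+y. ennreal (inverse ((1 + dist x y / \<delta>) ^ 3)) \<partial>ds) \<le> ennreal (C * \<delta>^2)"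
proof -
  obtain C where C: "0 \<le> C" "\<And>x R. 0 \<le> R \<Longrightarrow> emeasure ds (\<Gamma> \<inter> cball x R) \<le> ennreal (C * R^2)"
    using surface_measure_ball[OF assms(2,1)] by blast
  have "(\<integral>\<^sup>+y. ennreal (inverse ((1 + dist x y / \<delta>) ^ 3)) \<partial>ds) \<le> ennreal (C * (16 * \<delta>^2))" if \<delta>: "0 < \<delta>" for x \<delta>
  proof (rule surface_integral_le_shells[OF assms C(1) C(2), where c = "\<lambda>j. 8 * (1/8) ^ j" and R = "\<lambda>j. 2 ^ j * \<delta>"])
    have "(\<lambda>j. 8 * \<delta>^2 * (1/2::real) ^ j) sums (8 * \<delta>^2 * (1 / (1 - 1/2)))"
      by (intro sums_mult geometric_sums) simp
    moreover have "8 * (1/8) ^ j * (2 ^ j * \<delta>)^2 = 8 * \<delta>^2 * (1/2::real) ^ j" for j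
    proof -
      have "(1/8) ^ j * ((2 ^ j)^2) = ((1/8) * 2^2 :: real) ^ j"
        by (simp only: power_mult_distrib power_mult[symmetric] mult.commute[of _ 2])
      then show ?thesis by (simp add: power_mult_distrib)
    qed
    ultimately show "(\<lambda>j. 8 * (1/8) ^ j * (2 ^ j * \<delta>)^2) sums (16 * \<delta>^2)"
      by (simp only:) simp
  next
    fix y assume "y \<in> \<Gamma>"
    define t where "t = dist x y / \<delta>"
    have t: "0 \<le> t" "dist x y = t * \<delta>" using \<delta> by (auto simp: t_def)
    obtain n where n: "t \<le> 2 ^ n" using real_arch_pow[of 2 t] by (auto intro: less_imp_le)
    define j where "j = (LEAST j. t \<le> 2 ^ j)"
    have j: "t \<le> 2 ^ j" unfolding j_def by (rule LeastI[of "\<lambda>j. t \<le> 2 ^ j", OF n])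
    have "inverse ((1 + t) ^ 3) \<le> 8 * (1/8) ^ j"
    proof (cases j)
      case 0
      have "inverse ((1 + t) ^ 3) \<le> inverse 1" using t by (intro le_imp_inverse_le one_le_power) auto
      then show ?thesis using 0 by simp
    next
      case (Suc i)
      have "\<not> t \<le> 2 ^ i" using not_less_Least[of i "\<lambda>j. t \<le> 2 ^ j"] Suc by (simp add: j_def)
      then have "(2 ^ i) ^ 3 \<le> (1 + t) ^ 3" using t by (intro power_mono) auto
      then have "inverse ((1 + t) ^ 3) \<le> inverse ((2 ^ i) ^ 3)" by (intro le_imp_inverse_le) auto
      also have "(2 ^ i) ^ 3 = (8::real) ^ i" 
      proof -
        have "(2 ^ i) ^ 3 = ((2::real) ^ 3) ^ i" by (simp only: power_mult[symmetric] mult.commute)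
        then show ?thesis by simp
      qed
      also have "inverse ((8::real) ^ i) = 8 * (1/8) ^ j" by (simp add: Suc power_inverse field_simps)
      finally show ?thesis .
    qed
    then show "\<exists>j. dist x y \<le> 2 ^ j * \<delta> \<and> inverse ((1 + dist x y / \<delta>) ^ 3) \<le> 8 * (1/8) ^ j"
      using j \<delta> by (intro exI[of _ j]) (simp add: t t_def[symmetric])
  qed (use \<delta> in auto)
  then show ?thesis using C(1) by (intro exI[of _ "C * 16"]) (auto simp: mult_ac)
qed

text \<open>The same sum over growing balls would diverge for this slow decay. Since the surface is bounded, shrinking
dyadic balls of radii \<open>D 2\<^bsup>-j\<^esup>\<close> are used for the bound \<open>\<delta>/|x-y|\<close>, which does not see the scale \<open>\<delta>\<close>.\<close>

lemma surface_integral_decay_linear: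
  assumes "smooth_closed_surface \<Gamma>" "surface_measure \<Gamma> ds"
  shows "\<exists>C\<ge>0. \<forall>x\<in>\<Gamma>. \<forall>\<delta>. 0 < \<delta> \<longrightarrow> (\<integral>\<^sup>+y. ennreal (inverse (1 + dist x y / \<delta>)) \<partial>ds) \<le> ennreal (C * \<delta>)"
proof -
  obtain C where C: "0 \<le> C" "\<And>x R. 0 \<le> R \<Longrightarrow> emeasure ds (\<Gamma> \<inter> cball x R) \<le> ennreal (C * R^2)"
    using surface_measure_ball[OF assms(2,1)] by blast
  have b: "bounded \<Gamma>" using assms(1) by (simp add: smooth_closed_surface_def compact_imp_bounded)
  \<comment> \<open>The summand \<open>1\<close> only ensures \<open>D > 0\<close>.\<close>
  define D where "D = diameter \<Gamma> + 1"
  have D: "0 < D" using diameter_ge_0[OF b] by (simp add: D_def)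
  have "(\<integral>\<^sup>+y. ennreal (inverse (1 + dist x y / \<delta>)) \<partial>ds) \<le> ennreal (C * (4 * D * \<delta>))" if \<delta>: "0 < \<delta>" and x: "x \<in> \<Gamma>" for x \<delta>
  proof (rule surface_integral_le_shells[OF assms C(1) C(2), where c = "\<lambda>j. \<delta> * 2 ^ Suc j / D" and R = "\<lambda>j. D / 2 ^ j"])
    have "(\<lambda>j. 2 * D * \<delta> * (1/2::real) ^ j) sums (2 * D * \<delta> * (1 / (1 - 1/2)))"
      by (intro sums_mult geometric_sums) simp
    moreover have "\<delta> * 2 ^ Suc j / D * (D / 2 ^ j)^2 = 2 * D * \<delta> * (1/2::real) ^ j" for j
      using D by (simp add: field_simps power2_eq_square)
    ultimately show "(\<lambda>j. \<delta> * 2 ^ Suc j / D * (D / 2 ^ j)^2) sums (4 * D * \<delta>)"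
      by (simp only:) (simp add: mult.assoc)
  next
    fix y assume y: "y \<in> \<Gamma>"
    have rD: "dist x y \<le> D" using diameter_bounded_bound[OF b x y] by (simp add: D_def)
    show "\<exists>j. dist x y \<le> D / 2 ^ j \<and> inverse (1 + dist x y / \<delta>) \<le> \<delta> * 2 ^ Suc j / D"
    proof (cases "x = y")
      case True
      \<comment> \<open>The weight at the centre is one, and the coefficients of the shells are unbounded.\<close>
      obtain n where n: "D / \<delta> < 2 ^ n" using real_arch_pow[of 2 "D / \<delta>"] by auto
      then have "1 \<le> \<delta> * 2 ^ Suc n / D" using D \<delta> by (simp add: field_simps)
      then show ?thesis using True D by (intro exI[of _ n]) auto
    next
      case False
      then have r: "0 < dist x y" by simp
      obtain n where n: "D / dist x y < 2 ^ n" using real_arch_pow[of 2 "D / dist x y"] by auto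
      have "D < 2 ^ n * dist x y" using n r by (simp add: field_simps)
      moreover have "0 < 2 ^ n * dist x y" using r by simp
      ultimately have "D < 2 ^ Suc n * dist x y" by simp
      then have n': "D / 2 ^ Suc n < dist x y" by (simp add: field_simps)
      define j where "j = (LEAST j. D / 2 ^ Suc j < dist x y)"
      have j: "D / 2 ^ Suc j < dist x y" unfolding j_def by (rule LeastI[of "\<lambda>j. D / 2 ^ Suc j < dist x y", OF n'])
      have "dist x y \<le> D / 2 ^ j"
      proof (cases j)
        case (Suc i)
        then show ?thesis using not_less_Least[of i "\<lambda>j. D / 2 ^ Suc j < dist x y"] by (simp add: j_def)
      qed (use rD in simp)
      moreover have "inverse (1 + dist x y / \<delta>) \<le> inverse (dist x y / \<delta>)"
        using r \<delta> by (intro le_imp_inverse_le) auto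
      moreover have "inverse (dist x y / \<delta>) \<le> inverse (D / 2 ^ Suc j / \<delta>)"
        using j D \<delta> by (intro le_imp_inverse_le divide_right_mono) auto
      moreover have "inverse (D / 2 ^ Suc j / \<delta>) = \<delta> * 2 ^ Suc j / D" by (simp add: field_simps)
      ultimately show ?thesis by (intro exI[of _ j]) linarith
    qed
  qed (use \<delta> D in auto)
  then show ?thesis using C(1) D by (intro exI[of _ "C * (4 * D)"]) (auto simp: mult_ac)
qed

section \<open>The regularizing function as a function of the squared distance\<close>

text \<open>Up to constants this is the \<open>p\<close>-th derivative of \<open>erf(sqrt s)/sqrt s\<close>. The integral form shows at once that it is smooth
across \<open>s = 0\<close>.\<close>

definition gauss_moment :: "nat \<Rightarrow> real \<Rightarrow> real" where
  "gauss_moment p s = integral {0..1} (\<lambda>v. v ^ (2 * p) * exp (- (s * v^2)))"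

lemma gauss_moment_integrable: "(\<lambda>v. v ^ (2 * p) * exp (- (s * v^2))) integrable_on {0..1::real}"
  by (intro integrable_continuous_interval continuous_intros)

lemma gauss_moment_deriv:
  "(gauss_moment p has_field_derivative - gauss_moment (Suc p) s) (at s)"
proof -
  have "((\<lambda>s. integral (cbox 0 1) (\<lambda>v. v ^ (2 * p) * exp (- (s * v^2)))) has_field_derivative
      integral (cbox 0 1) (\<lambda>v. - (v ^ (2 * Suc p) * exp (- (s * v^2))))) (at s within UNIV)"
  proof (rule leibniz_rule_field_derivative)
    show "((\<lambda>s. v ^ (2 * p) * exp (- (s * v^2))) has_field_derivative - (v ^ (2 * Suc p) * exp (- (x * v^2))))
      (at x within UNIV)" for x v :: real
      by (auto intro!: derivative_eq_intros simp: power2_eq_square)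
    show "continuous_on (UNIV \<times> cbox 0 (1::real)) (\<lambda>(x, v). - (v ^ (2 * Suc p) * exp (- (x * v^2))))"
      by (auto simp: case_prod_beta intro!: continuous_intros)
    show "(\<lambda>v. v ^ (2 * p) * exp (- (x * v^2))) integrable_on cbox 0 1" for x :: real
      using gauss_moment_integrable by simp
  qed auto
  then show ?thesis unfolding gauss_moment_def[abs_def] by (simp add: integral_neg)
qed

lemma power_le_fact_exp:
  fixes x :: real
  assumes "0 \<le> x" shows "x ^ n \<le> fact n * exp x"
proof -
  have "(\<Sum>i\<in>{n}. inverse (fact i) *\<^sub>R x ^ i) \<le> (\<Sum>i. inverse (fact i) *\<^sub>R x ^ i)"
    by (rule sum_le_suminf[OF summable_exp_generic]) (use assms in auto)
  then have "inverse (fact n) * x ^ n \<le> exp x" by (simp add: exp_def)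
  then have "fact n * (inverse (fact n) * x ^ n) \<le> fact n * exp x"
    by (intro mult_left_mono) auto
  then show ?thesis by (simp add: mult.assoc[symmetric])
qed

lemma shifted_power_le_exp:
  fixes w :: real
  assumes "0 \<le> w" shows "(1 + w) ^ n * exp (- w) \<le> fact n * exp 1"
proof -
  have "(1 + w) ^ n * exp (- w) \<le> fact n * exp (1 + w) * exp (- w)"
    by (intro mult_right_mono power_le_fact_exp) (use assms in auto)
  also have "\<dots> = fact n * exp 1" by (simp add: exp_add exp_minus)
  finally show ?thesis .
qed

lemma gauss_moment_nonneg: "0 \<le> gauss_moment p s"
  unfolding gauss_moment_def by (rule integral_nonneg[OF gauss_moment_integrable]) auto

text \<open>On the integrand, \<open>(1+s)\<^sup>p v\<^bsup>2p\<^esup> \<le> (1 + s v\<^sup>2)\<^sup>p\<close> because \<open>v \<le> 1\<close>, and \<open>(1+w)\<^sup>p e\<^bsup>-w\<^esup>\<close> is bounded.\<close>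

lemma gauss_moment_le:
  assumes "0 \<le> s" shows "gauss_moment p s \<le> fact p * exp 1 * inverse (1 + s) ^ p"
proof -
  have "gauss_moment p s \<le> integral {0..1::real} (\<lambda>v. fact p * exp 1 * inverse (1 + s) ^ p)"
    unfolding gauss_moment_def
  proof (rule integral_le[OF gauss_moment_integrable])
    fix v :: real assume v: "v \<in> {0..1}"
    have "v^2 \<le> 1" using v by (simp add: power_le_one)
    have "(1 + s) ^ p * (v ^ (2 * p) * exp (- (s * v^2))) = (v^2 + s * v^2) ^ p * exp (- (s * v^2))"
    proof -
      have "v^2 + s * v^2 = (1 + s) * v^2" by (simp add: algebra_simps)
      then show ?thesis by (simp add: power_mult_distrib power_mult)
    qed
    also have "\<dots> \<le> (1 + s * v^2) ^ p * exp (- (s * v^2))"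
      by (intro mult_right_mono power_mono) (use assms \<open>v^2 \<le> 1\<close> in auto)
    also have "\<dots> \<le> fact p * exp 1" by (rule shifted_power_le_exp) (use assms in simp)
    finally have "(1 + s) ^ p * (v ^ (2 * p) * exp (- (s * v^2))) \<le> fact p * exp 1" .
    then show "v ^ (2 * p) * exp (- (s * v^2)) \<le> fact p * exp 1 * inverse (1 + s) ^ p"
      using assms by (simp add: power_inverse field_simps)
  qed auto
  then show ?thesis by simp
qed

text \<open>Integration by parts: both sides are the integral of the derivative of \<open>v\<^bsup>2p+1\<^esup> e\<^bsup>-s v^2\<^esup>\<close>.\<close>

lemma gauss_moment_recursion:
  "exp (- s) = (2 * real p + 1) * gauss_moment p s - 2 * s * gauss_moment (Suc p) s"
proof -
  have ftc: "((\<lambda>v. (2 * real p + 1) * (v ^ (2 * p) * exp (- (s * v^2))) - 2 * s * (v ^ (2 * Suc p) * exp (- (s * v^2))))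
      has_integral (1 ^ (2 * p + 1) * exp (- (s * 1^2)) - 0 ^ (2 * p + 1) * exp (- (s * 0^2)))) {0..1::real}"
  proof (rule fundamental_theorem_of_calculus)
    fix v :: real assume "v \<in> {0..1}"
    have "((\<lambda>v. v ^ (2 * p + 1) * exp (- (s * v^2))) has_real_derivative
       real (2 * p + 1) * v ^ (2 * p) * exp (- (s * v^2)) + exp (- (s * v^2)) * (- (s * (2 * v))) * v ^ (2 * p + 1)) (at v within {0..1})"
      by (rule DERIV_mult, use DERIV_pow[of "2 * p + 1" v "{0..1}"] in simp) (auto intro!: derivative_eq_intros)
    moreover have "real (2 * p + 1) * v ^ (2 * p) * exp (- (s * v^2)) + exp (- (s * v^2)) * (- (s * (2 * v))) * v ^ (2 * p + 1) =
        (2 * real p + 1) * (v ^ (2 * p) * exp (- (s * v^2))) - 2 * s * (v ^ (2 * Suc p) * exp (- (s * v^2)))"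
      by (simp add: algebra_simps power2_eq_square)
    ultimately show "((\<lambda>v. v ^ (2 * p + 1) * exp (- (s * v^2))) has_vector_derivative
      ((2 * real p + 1) * (v ^ (2 * p) * exp (- (s * v^2))) - 2 * s * (v ^ (2 * Suc p) * exp (- (s * v^2))))) (at v within {0..1})"
      by (simp only: has_real_derivative_iff_has_vector_derivative)
  qed simp
  have split: "((\<lambda>v. (2 * real p + 1) * (v ^ (2 * p) * exp (- (s * v^2))) - 2 * s * (v ^ (2 * Suc p) * exp (- (s * v^2))))
      has_integral ((2 * real p + 1) * gauss_moment p s - 2 * s * gauss_moment (Suc p) s)) {0..1::real}"
    unfolding gauss_moment_def
    by (intro has_integral_diff has_integral_mult_right integrable_integral gauss_moment_integrable)
  from has_integral_unique[OF ftc split] show ?thesis by simp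
qed

lemma erf_eq_gauss_moment:
  assumes "0 \<le> t" shows "erf t = 2 / sqrt pi * (t * gauss_moment 0 (t^2))"
proof -
  have "(LBINT u=0..t. exp (- (u^2))) = integral {0..t} (\<lambda>u. exp (- (u^2)))"
  proof -
    have "set_integrable lborel {0..t} (\<lambda>u. exp (- (u^2)))"
      unfolding set_integrable_def by (rule borel_integrable_compact) (auto intro!: continuous_intros)
    from interval_integral_eq_integral[OF assms this] show ?thesis by (simp add: zero_ereal_def)
  qed
  also have "\<dots> = t * gauss_moment 0 (t^2)"
  proof -
    have "((\<lambda>v. t *\<^sub>R exp (- ((t * v)^2))) has_integral (integral {t * 0..t * 1} (\<lambda>u. exp (- (u^2))))) {0..1}"
      by (rule has_integral_substitution[where c = 0 and d = t])
        (use assms in \<open>auto intro!: derivative_eq_intros continuous_intros simp: mult_left_le\<close>)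
    from integral_unique[OF this]
    have "integral {0..t} (\<lambda>u. exp (- (u^2))) = t * integral {0..1} (\<lambda>v. exp (- ((t * v)^2)))"
      by simp
    then show ?thesis by (simp add: gauss_moment_def power_mult_distrib)
  qed
  finally show ?thesis by (simp add: erf_def)
qed

text \<open>The smooth function \<open>\<sigma>\<^sub>p(t)/t\<^bsup>2p+1\<^esup>\<close> of \<open>s = t\<^sup>2\<close>.\<close>

definition reg_kernel :: "nat \<Rightarrow> nat \<Rightarrow> (nat \<Rightarrow> real) \<Rightarrow> real \<Rightarrow> real" where
  "reg_kernel p n c s = 2 / sqrt pi *
     ((if p = 0 then 1 else if p = 1 then 2 else 4/3) * gauss_moment p s +
      (\<Sum>l=1..n. c l * (exp (- s) * s ^ (l - 1))))"

text \<open>The polynomial corrections \<open>-t\<close> and \<open>-t - 2/3 t\<^sup>3\<close> in \<open>\<sigma>\<^sub>1\<close> and \<open>\<sigma>\<^sub>2\<close> are exactly the boundary terms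
in one and two steps of the recursion of the Gaussian moments, starting from \<open>erf t\<close>.\<close>

lemma reg_\<sigma>_eq_reg_kernel:
  assumes "0 \<le> t" "p \<le> 2"
  shows "reg_\<sigma> p n c t = t ^ (2 * p + 1) * reg_kernel p n c (t^2)"
proof -
  have sum: "exp (- (t^2)) * (t ^ (2 * p) * (\<Sum>l=1..n. c l * t ^ (2 * l - 1))) =
      t ^ (2 * p + 1) * (\<Sum>l=1..n. c l * (exp (- (t^2)) * (t^2) ^ (l - 1)))"
  proof -
    have "t ^ (2 * l - 1) = t * (t^2) ^ (l - 1)" if l: "l \<in> {1..n}" for l
    proof -
      obtain m where "l = Suc m" using l by (cases l) auto
      then show ?thesis by (simp add: power_mult)
    qed
    then show ?thesis by (simp add: sum_distrib_left mult_ac)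
  qed
  have r0: "exp (- (t^2)) = gauss_moment 0 (t^2) - 2 * t^2 * gauss_moment 1 (t^2)"
    using gauss_moment_recursion[of "t^2" 0] by simp
  have r1: "exp (- (t^2)) = 3 * gauss_moment 1 (t^2) - 2 * t^2 * gauss_moment 2 (t^2)"
    using gauss_moment_recursion[of "t^2" 1] by (simp add: numeral_2_eq_2)
  have main: "t * gauss_moment 0 (t^2) + exp (- (t^2)) * (if p = 0 then 0 else if p = 1 then - t else - t - 2/3 * t^3) =
      t ^ (2 * p + 1) * ((if p = 0 then 1 else if p = 1 then 2 else 4/3) * gauss_moment p (t^2))"
  proof -
    consider "p = 0" | "p = 1" | "p = 2" using assms(2) by linarith
    then show ?thesis
    proof cases
      case 2
      have "t * gauss_moment 0 (t^2) + exp (- (t^2)) * (- t) = t * (gauss_moment 0 (t^2) - exp (- (t^2)))"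
        by (simp add: algebra_simps)
      also have "\<dots> = t * (2 * t^2 * gauss_moment 1 (t^2))" using r0 by simp
      finally show ?thesis using 2 by (simp add: eval_nat_numeral)
    next
      case 3
      have "t * gauss_moment 0 (t^2) + exp (- (t^2)) * (- t - 2/3 * t^3) =
          t * (gauss_moment 0 (t^2) - exp (- (t^2))) - 2/3 * t^3 * exp (- (t^2))"
        by (simp add: algebra_simps)
      also have "\<dots> = t * (2 * t^2 * gauss_moment 1 (t^2)) - 2/3 * t^3 * exp (- (t^2))" using r0 by simp
      also have "\<dots> = 2/3 * t^3 * (3 * gauss_moment 1 (t^2) - exp (- (t^2)))"
        by (simp add: algebra_simps eval_nat_numeral)
      also have "\<dots> = 2/3 * t^3 * (2 * t^2 * gauss_moment 2 (t^2))" using r1 by simp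
      finally show ?thesis using 3 by (simp add: eval_nat_numeral)
    qed auto
  qed
  have "reg_\<sigma> p n c t = 2 / sqrt pi * ((t * gauss_moment 0 (t^2) +
      exp (- (t^2)) * (if p = 0 then 0 else if p = 1 then - t else - t - 2/3 * t^3)) +
      exp (- (t^2)) * (t ^ (2 * p) * (\<Sum>l=1..n. c l * t ^ (2 * l - 1))))"
    unfolding reg_\<sigma>_def reg_P_def erf_eq_gauss_moment[OF assms(1)] by (simp add: algebra_simps)
  also have "\<dots> = t ^ (2 * p + 1) * reg_kernel p n c (t^2)"
    unfolding main sum reg_kernel_def by (simp add: algebra_simps)
  finally show ?thesis .
qed

lemma jet_bounded_gauss_moment:
  assumes "0 \<le> s"
  shows "jet_bounded r UNIV {s} (gauss_moment p) (fact (p + r) * exp 1 * inverse (1 + s) ^ p) (inverse (1 + s))"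
proof -
  let ?f = "\<lambda>i s. (- 1) ^ i * gauss_moment (p + i) s"
  have "jet_bounded r UNIV {s} (?f 0) (fact (p + r) * exp 1 * inverse (1 + s) ^ p) (inverse (1 + s))"
  proof (rule jet_bounded_real_sequence)
    show "(?f i has_field_derivative ?f (Suc i) s) (at s)" for i s
      by (auto intro!: derivative_eq_intros gauss_moment_deriv)
    fix i s' assume i: "i \<le> r" "s' \<in> {s}"
    have "\<bar>?f i s\<bar> = gauss_moment (p + i) s"
      using gauss_moment_nonneg by (simp add: abs_mult power_abs)
    also have "\<dots> \<le> fact (p + i) * exp 1 * inverse (1 + s) ^ (p + i)" by (rule gauss_moment_le[OF assms])
    also have "\<dots> \<le> fact (p + r) * exp 1 * inverse (1 + s) ^ (p + i)"
      using i assms by (intro mult_right_mono fact_mono) auto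
    finally show "\<bar>?f i s'\<bar> \<le> fact (p + r) * exp 1 * inverse (1 + s) ^ p * inverse (1 + s) ^ i"
      using i by (simp add: power_add mult.assoc)
  qed auto
  then show ?thesis by simp
qed

text \<open>Here \<open>p\<close> is arbitrary: the exponential compensates any power, in particular those in the regularizing
polynomial.\<close>

lemma jet_bounded_exp_minus:
  fixes s :: real
  assumes "0 \<le> s"
  shows "jet_bounded r UNIV {s} (\<lambda>s. exp (- s)) (fact (p + r) * exp 1 * inverse (1 + s) ^ p) (inverse (1 + s))"
proof -
  let ?f = "\<lambda>i s. (- 1) ^ i * exp (- s) :: real"
  have "jet_bounded r UNIV {s} (?f 0) (fact (p + r) * exp 1 * inverse (1 + s) ^ p) (inverse (1 + s))"
  proof (rule jet_bounded_real_sequence)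
    show "(?f i has_field_derivative ?f (Suc i) s) (at s)" for i s
      by (auto intro!: derivative_eq_intros)
    fix i s' assume i: "i \<le> r" "s' \<in> {s}"
    have "inverse (1 + s) ^ (p + i) * (1 + s) ^ (p + i) = 1"
      using assms by (simp add: power_mult_distrib[symmetric])
    then have "exp (- s) = inverse (1 + s) ^ (p + i) * ((1 + s) ^ (p + i) * exp (- s))"
      by (simp add: mult.assoc[symmetric])
    also have "\<dots> \<le> inverse (1 + s) ^ (p + i) * (fact (p + i) * exp 1)"
      using assms by (intro mult_left_mono shifted_power_le_exp) auto
    also have "\<dots> \<le> inverse (1 + s) ^ (p + i) * (fact (p + r) * exp 1)"
      using i assms by (intro mult_left_mono mult_right_mono fact_mono) auto
    finally show "\<bar>?f i s'\<bar> \<le> fact (p + r) * exp 1 * inverse (1 + s) ^ p * inverse (1 + s) ^ i"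
      using i by (simp add: power_add mult_ac abs_mult power_abs)
  qed auto
  then show ?thesis by simp
qed

lemma jet_bounded_mult:
  fixes f g :: "'a::euclidean_space \<Rightarrow> real"
  assumes "open V" "S \<subseteq> V" "jet_bounded r V S f K1 L1" "jet_bounded r V S g K2 L2" "0 \<le> L1" "0 \<le> L2"
  shows "jet_bounded r V S (\<lambda>x. f x * g x) (K1 * K2) (L1 + L2)"
  by (rule jet_bounded_bilinear[OF assms(1,2) bounded_bilinear_mult _ assms(3-6)]) (simp add: abs_mult)

lemma jet_bounded_cmult:
  fixes f :: "'a::euclidean_space \<Rightarrow> real"
  assumes "open V" "S \<subseteq> V" "jet_bounded r V S f K L" "0 \<le> L" "\<bar>c\<bar> \<le> C"
  shows "jet_bounded r V S (\<lambda>x. c * f x) (C * K) L"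
  using jet_bounded_mult[OF assms(1,2) jet_bounded_const[OF assms(1,2), of c C 0] assms(3) _ assms(4)] assms(5)
  by simp

lemma jet_bounded_power:
  fixes s :: real
  assumes "0 \<le> s"
  shows "jet_bounded r UNIV {s} (\<lambda>s. s ^ j) ((1 + s) ^ j) (real j * inverse (1 + s))"
proof (induction j)
  case 0
  then show ?case by (auto intro!: jet_bounded_const)
next
  case (Suc j)
  have "jet_bounded r UNIV {s} (\<lambda>s. 0 + s) (1 + s) (inverse (1 + s))"
    by (rule jet_bounded_affine) (use assms in auto)
  then have "jet_bounded r UNIV {s} (\<lambda>s. s) (1 + s) (inverse (1 + s))" by simp
  from jet_bounded_mult[OF _ _ this Suc.IH] show ?case using assms by (simp add: algebra_simps)
qed

text \<open>The Gaussian moment decays like \<open>(1+s)\<^bsup>-p\<^esup>\<close>, the terms with the coefficients \<open>c\<^sub>l\<close> decay exponentially. The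
constant depends on the coefficients only through their bound \<open>A\<close>.\<close>

lemma jet_bounded_reg_kernel:
  "\<exists>M\<ge>1. \<forall>c s. (\<forall>l\<in>{1..n}. \<bar>c l\<bar> \<le> A) \<and> 0 \<le> s \<longrightarrow>
     jet_bounded r UNIV {s} (reg_kernel p n c) (M * inverse (1 + s) ^ p) (M * inverse (1 + s))"
proof -
  define E where "E = (\<lambda>l. fact ((l + p) + r) * exp 1 :: real)"
  define M where "M = 2 / sqrt pi * (2 * (fact (p + r) * exp 1) + (\<Sum>l=1..n. \<bar>A\<bar> * E (l - 1))) + 1 + real n"
  have E0: "0 \<le> E l" for l by (simp add: E_def)
  have S0: "0 \<le> (\<Sum>l=1..n. \<bar>A\<bar> * E (l - 1))" using E0 by (intro sum_nonneg) auto
  have M1: "1 \<le> M" "1 + real n \<le> M" using S0 by (auto simp: M_def)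
  have "jet_bounded r UNIV {s} (reg_kernel p n c) (M * inverse (1 + s) ^ p) (M * inverse (1 + s))"
    if c: "\<forall>l\<in>{1..n}. \<bar>c l\<bar> \<le> A" and s: "0 \<le> s" for c s
  proof -
    let ?i = "inverse (1 + s)"
    have i: "0 \<le> ?i" using s by simp
    have e: "jet_bounded r UNIV {s} (\<lambda>s. c l * (exp (- s) * s ^ (l - 1))) (\<bar>A\<bar> * (E (l - 1) * ?i ^ p)) ((1 + real n) * ?i)"
      if l: "l \<in> {1..n}" for l
    proof -
      have "jet_bounded r UNIV {s} (\<lambda>s. exp (- s) * s ^ (l - 1))
          (fact ((l - 1 + p) + r) * exp 1 * ?i ^ (l - 1 + p) * (1 + s) ^ (l - 1)) (?i + real (l - 1) * ?i)"
        by (rule jet_bounded_mult[OF _ _ jet_bounded_exp_minus[OF s] jet_bounded_power[OF s]]) (use i in auto)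
      moreover have "?i ^ (l - 1) * (1 + s) ^ (l - 1) = 1" using s by (simp add: power_mult_distrib[symmetric])
      then have "fact ((l - 1 + p) + r) * exp 1 * ?i ^ (l - 1 + p) * (1 + s) ^ (l - 1) = E (l - 1) * ?i ^ p"
        by (simp add: E_def power_add mult_ac) 
      ultimately have "jet_bounded r UNIV {s} (\<lambda>s. exp (- s) * s ^ (l - 1)) (E (l - 1) * ?i ^ p) (?i + real (l - 1) * ?i)"
        by simp
      then have "jet_bounded r UNIV {s} (\<lambda>s. exp (- s) * s ^ (l - 1)) (E (l - 1) * ?i ^ p) ((1 + real n) * ?i)"
      proof (rule jet_bounded_mono)
        have "real (l - 1) * ?i \<le> real n * ?i" using l i by (intro mult_right_mono) auto
        then show "?i + real (l - 1) * ?i \<le> (1 + real n) * ?i" by (simp add: algebra_simps)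
      qed (use i in auto)
      then show ?thesis by (rule jet_bounded_cmult[OF open_UNIV subset_UNIV]) (use i c l in force)+
    qed
    have g: "jet_bounded r UNIV {s} (\<lambda>s. (if p = 0 then 1 else if p = 1 then 2 else 4/3) * gauss_moment p s)
        (2 * (fact (p + r) * exp 1 * ?i ^ p)) ((1 + real n) * ?i)"
    proof (rule jet_bounded_cmult)
      show "jet_bounded r UNIV {s} (gauss_moment p) (fact (p + r) * exp 1 * ?i ^ p) ((1 + real n) * ?i)"
        by (rule jet_bounded_mono[OF jet_bounded_gauss_moment[OF s]]) (use i in \<open>auto simp: algebra_simps\<close>)
    qed (use i in auto)
    have "jet_bounded r UNIV {s} (\<lambda>s. 2 / sqrt pi * ((if p = 0 then 1 else if p = 1 then 2 else 4/3) * gauss_moment p s +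
        (\<Sum>l=1..n. c l * (exp (- s) * s ^ (l - 1)))))
        (2 / sqrt pi * (2 * (fact (p + r) * exp 1 * ?i ^ p) + (\<Sum>l=1..n. \<bar>A\<bar> * (E (l - 1) * ?i ^ p)))) ((1 + real n) * ?i)"
      by (intro jet_bounded_cmult jet_bounded_add g jet_bounded_sum e open_UNIV subset_UNIV) (use i in auto)
    then show ?thesis unfolding reg_kernel_def[abs_def]
    proof (rule jet_bounded_mono)
      have "2 / sqrt pi * (2 * (fact (p + r) * exp 1 * ?i ^ p) + (\<Sum>l=1..n. \<bar>A\<bar> * (E (l - 1) * ?i ^ p)))
          = (2 / sqrt pi * (2 * (fact (p + r) * exp 1) + (\<Sum>l=1..n. \<bar>A\<bar> * E (l - 1)))) * ?i ^ p"
      proof -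
        have "(\<Sum>l=1..n. \<bar>A\<bar> * (E (l - 1) * ?i ^ p)) = (\<Sum>l=1..n. \<bar>A\<bar> * E (l - 1)) * ?i ^ p"
          by (simp only: sum_distrib_right mult.assoc)
        then show ?thesis by (simp only:) (simp add: algebra_simps)
      qed
      also have "\<dots> \<le> M * ?i ^ p" using i by (intro mult_right_mono) (auto simp: M_def)
      finally show "2 / sqrt pi * (2 * (fact (p + r) * exp 1 * ?i ^ p) + (\<Sum>l=1..n. \<bar>A\<bar> * (E (l - 1) * ?i ^ p))) \<le> M * ?i ^ p" .
      show "(1 + real n) * ?i \<le> M * ?i" using M1 i by (intro mult_right_mono) auto
    qed (use i in auto)
  qed
  then show ?thesis using M1(1) by blast
qed

text \<open>For the hypersingular operator the factor \<open>|x-y|\<^sup>2\<close> of \<open>\<Psi>\<close> is moved into the kernel; this is what the exponent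
\<open>s\<close> of the operator stands for.\<close>

definition op_kernel :: "layer_op \<Rightarrow> nat \<Rightarrow> (nat \<Rightarrow> real) \<Rightarrow> real \<Rightarrow> real" where
  "op_kernel B n c s = s ^ op_s B * reg_kernel (op_p B) n c s"

lemma jet_bounded_op_kernel:
  "\<exists>M\<ge>1. \<forall>c s. (\<forall>l\<in>{1..n}. \<bar>c l\<bar> \<le> A) \<and> 0 \<le> s \<longrightarrow>
     jet_bounded r UNIV {s} (op_kernel B n c) (M * inverse (1 + s) ^ (op_p B - op_s B)) (M * inverse (1 + s))"
proof -
  obtain M where M: "M \<ge> 1" "\<And>c s. (\<forall>l\<in>{1..n}. \<bar>c l\<bar> \<le> A) \<Longrightarrow> 0 \<le> s \<Longrightarrow>
     jet_bounded r UNIV {s} (reg_kernel (op_p B) n c) (M * inverse (1 + s) ^ op_p B) (M * inverse (1 + s))"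
    using jet_bounded_reg_kernel[of n A r "op_p B"] by blast
  have sp: "op_s B \<le> op_p B" by (cases B) auto
  have "jet_bounded r UNIV {s} (op_kernel B n c) ((M + 1) * inverse (1 + s) ^ (op_p B - op_s B)) ((M + 1) * inverse (1 + s))"
    if c: "\<forall>l\<in>{1..n}. \<bar>c l\<bar> \<le> A" and s: "0 \<le> s" for c s
  proof -
    let ?i = "inverse (1 + s)"
    have i: "0 \<le> ?i" using s by simp
    have "jet_bounded r UNIV {s} (op_kernel B n c) ((1 + s) ^ op_s B * (M * ?i ^ op_p B)) (real (op_s B) * ?i + M * ?i)"
      unfolding op_kernel_def[abs_def]
      by (rule jet_bounded_mult[OF _ _ jet_bounded_power[OF s] M(2)[OF c s]]) (use i M(1) in auto)
    then show ?thesis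
    proof (rule jet_bounded_mono)
      have "?i ^ op_p B = ?i ^ op_s B * ?i ^ (op_p B - op_s B)" using sp by (simp add: power_add[symmetric])
      moreover have "(1 + s) ^ op_s B * ?i ^ op_s B = 1" using s by (simp add: power_mult_distrib[symmetric])
      ultimately have "(1 + s) ^ op_s B * (M * ?i ^ op_p B) = M * ?i ^ (op_p B - op_s B)"
        by (simp add: mult.left_commute mult.assoc[symmetric])
      also have "\<dots> \<le> (M + 1) * ?i ^ (op_p B - op_s B)" using i by (intro mult_right_mono) auto
      finally show "(1 + s) ^ op_s B * (M * ?i ^ op_p B) \<le> (M + 1) * ?i ^ (op_p B - op_s B)" .
      have "real (op_s B) \<le> 1" by (cases B) auto
      then have "real (op_s B) * ?i \<le> 1 * ?i" using i by (intro mult_right_mono) auto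
      then show "real (op_s B) * ?i + M * ?i \<le> (M + 1) * ?i" by (simp add: algebra_simps)
      show "0 \<le> real (op_s B) * ?i + M * ?i" using i M(1) by auto
    qed (use i in auto)
  qed
  then show ?thesis using M(1) by (intro exI[of _ "M + 1"]) auto
qed

section \<open>The remaining factors of the integrand\<close>

lemma scaled_dist_square_derivative:
  fixes x y :: "'a::euclidean_space"
  assumes "0 < \<delta>"
  shows "((\<lambda>y. (dist x y / \<delta>)^2) has_derivative (\<lambda>v. 2 * ((y - x) \<bullet> v) / \<delta>^2)) (at y)"
proof -
  have "((\<lambda>y. ((y - x) \<bullet> (y - x)) / \<delta>^2) has_derivative (\<lambda>v. ((y - x) \<bullet> v + v \<bullet> (y - x)) / \<delta>^2)) (at y)"
    using assms by (auto intro!: derivative_eq_intros simp: algebra_simps divide_simps)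
  moreover have "((y - x) \<bullet> (y - x)) / \<delta>^2 = (dist x y / \<delta>)^2" for y
    by (metis power_divide dist_commute dist_norm power2_norm_eq_inner)
  moreover have "((y - x) \<bullet> v + v \<bullet> (y - x)) / \<delta>^2 = 2 * ((y - x) \<bullet> v) / \<delta>^2" for v
    by (simp add: inner_commute)
  ultimately show ?thesis by simp
qed

text \<open>The chain rule for \<open>t\<^sup>2\<close>, \<open>t = |x-y|/\<delta>\<close>: its first derivative is at most \<open>2t/\<delta>\<close> and its second derivative \<open>2/\<delta>\<^sup>2\<close>, which is
encoded as size \<open>2(1+t)/\<delta>\<close> and rate \<open>1/(\<delta>(1+t))\<close>. If \<open>g\<close> has rate \<open>1/(1+t\<^sup>2)\<close>, the composition has
rate \<open>O(1/(\<delta>(1+t)))\<close>.\<close>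

lemma jet_bounded_radial:
  fixes x y :: "'a::euclidean_space" and g :: "real \<Rightarrow> real"
  assumes "0 < \<delta>" "jet_bounded r UNIV {(dist x y / \<delta>)^2} g K M" "0 \<le> M" "0 \<le> K"
  defines "t \<equiv> dist x y / \<delta>"
  shows "jet_bounded r UNIV {y} (\<lambda>y. g ((dist x y / \<delta>)^2)) K (2 * M * (1 + t) / \<delta> + r * inverse (\<delta> * (1 + t)))"
proof -
  let ?f = "\<lambda>y. (dist x y / \<delta>)^2"
  have t: "0 \<le> t" using assms(1) by (simp add: t_def)
  have r: "dist x y = \<delta> * t" using assms(1) by (simp add: t_def)
  have fr: "frechet_derivative ?f (at z) = (\<lambda>v. 2 * ((z - x) \<bullet> v) / \<delta>^2)" for z
    using frechet_derivative_at[OF scaled_dist_square_derivative[OF assms(1), of x z]] by simp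
  have "jet_bounded r UNIV {y} (\<lambda>y. g (?f y)) K
     (DIM(real) * M * (2 * (1 + t) / \<delta>) + r * inverse (\<delta> * (1 + t)))"
  proof (rule jet_bounded_compose[where W = UNIV and S' = "{(dist x y / \<delta>)^2}" and f = ?f and g = g])
    show "?f differentiable (at z)" for z
      using scaled_dist_square_derivative[OF assms(1), of x z] by (auto simp: differentiable_def)
    fix b :: 'a assume b: "b \<in> Basis"
    have "jet_bounded r UNIV {y} (\<lambda>z. - (2 * (x \<bullet> b) / \<delta>^2) + 2 * (z \<bullet> b) / \<delta>^2) (2 * (1 + t) / \<delta>) (inverse (\<delta> * (1 + t)))"
    proof (rule jet_bounded_affine)
      show "bounded_linear (\<lambda>z. 2 * (z \<bullet> b) / \<delta>^2)"
        using bounded_linear_inner_left[of "(2 / \<delta>^2) *\<^sub>R b"] by (simp add: mult_ac)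
      have "\<bar>(y - x) \<bullet> b\<bar> \<le> \<delta> * t" using Basis_le_norm[OF b, of "y - x"] r by (simp add: dist_norm norm_minus_commute)
      then have "2 * \<bar>(y - x) \<bullet> b\<bar> / \<delta>^2 \<le> 2 * (\<delta> * t) / \<delta>^2" by (intro divide_right_mono) auto
      also have "\<dots> \<le> 2 * (1 + t) / \<delta>" using assms(1) t by (simp add: power2_eq_square divide_simps)
      finally have "2 * \<bar>(y - x) \<bullet> b\<bar> / \<delta>^2 \<le> 2 * (1 + t) / \<delta>" .
      moreover have "- (2 * (x \<bullet> b) / \<delta>^2) + 2 * (y \<bullet> b) / \<delta>^2 = 2 * ((y - x) \<bullet> b) / \<delta>^2"
        by (simp add: inner_diff_left diff_divide_distrib algebra_simps)
      ultimately show "norm (- (2 * (x \<bullet> b) / \<delta>^2) + 2 * (z \<bullet> b) / \<delta>^2) \<le> 2 * (1 + t) / \<delta>" if "z \<in> {y}" for z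
        using that by (simp add: abs_mult)
      fix b' :: 'a assume b': "b' \<in> Basis"
      have "\<bar>b' \<bullet> b\<bar> \<le> 1" using Basis_le_norm[OF b, of b'] b' by simp
      then have "2 * \<bar>b' \<bullet> b\<bar> / \<delta>^2 \<le> 2 * 1 / \<delta>^2" by (intro divide_right_mono) auto
      also have "2 * 1 / \<delta>^2 = 2 * (1 + t) / \<delta> * inverse (\<delta> * (1 + t))"
        using assms(1) t by (simp add: divide_simps power2_eq_square)
      finally show "norm (2 * (b' \<bullet> b) / \<delta>^2) \<le> 2 * (1 + t) / \<delta> * inverse (\<delta> * (1 + t))"
        by (simp add: abs_mult)
    qed (use assms(1) t in auto)
    moreover have "(\<lambda>z. - (2 * (x \<bullet> b) / \<delta>^2) + 2 * (z \<bullet> b) / \<delta>^2) = (\<lambda>z. frechet_derivative ?f (at z) b)"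
      unfolding fr by (rule ext) (simp add: inner_diff_left diff_divide_distrib algebra_simps)
    ultimately show "jet_bounded r UNIV {y} (\<lambda>z. frechet_derivative ?f (at z) b) (2 * (1 + t) / \<delta>) (inverse (\<delta> * (1 + t)))"
      by simp
  qed (use assms(1-4) t in auto)
  then show ?thesis by (simp add: mult_ac)
qed

text \<open>All derivatives exist and are bounded on bounded intervals of non-negative reals; a qualitative notion for
factors without a small scale.\<close>

definition smooth_jets :: "(real \<Rightarrow> real) \<Rightarrow> bool" where
  "smooth_jets f \<longleftrightarrow> (\<forall>r R. \<exists>M\<ge>1. jet_bounded r UNIV {0..R} f M M)"

lemma smooth_jetsI_sequence:
  assumes "\<And>i s. (f i has_field_derivative f (Suc i) s) (at s)"
  shows "smooth_jets (f 0)"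
  unfolding smooth_jets_def
proof (intro allI)
  fix r :: nat and R :: real
  have "\<exists>B\<ge>0. \<forall>s\<in>{0..R}. \<bar>f i s\<bar> \<le> B" for i
  proof -
    have "continuous_on {0..R} (f i)"
      using assms by (meson DERIV_continuous_on has_field_derivative_at_within)
    then have "bounded (f i ` {0..R})" by (intro compact_imp_bounded compact_continuous_image) auto
    then show ?thesis by (auto simp: bounded_pos intro: less_imp_le)
  qed
  then obtain B where B: "\<And>i. B i \<ge> 0" "\<And>i s. s \<in> {0..R} \<Longrightarrow> \<bar>f i s\<bar> \<le> B i" by metis
  define M where "M = 1 + (\<Sum>i\<le>r. B i)"
  have M: "1 \<le> M" using B(1) by (simp add: M_def sum_nonneg)
  have "jet_bounded r UNIV {0..R} (f 0) M M"
  proof (rule jet_bounded_real_sequence)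
    fix i s assume i: "i \<le> r" "s \<in> {0..R}"
    have "\<bar>f i s\<bar> \<le> B i" by (rule B(2)[OF i(2)])
    also have "\<dots> \<le> (\<Sum>i\<le>r. B i)" by (rule member_le_sum) (use i B(1) in auto)
    also have "\<dots> \<le> M * 1" by (simp add: M_def)
    also have "\<dots> \<le> M * M ^ i" using M by (intro mult_left_mono one_le_power) auto
    finally show "\<bar>f i s\<bar> \<le> M * M ^ i" .
  qed (use assms in auto)
  then show "\<exists>M\<ge>1. jet_bounded r UNIV {0..R} (f 0) M M" using M by blast
qed

lemma smooth_jets_mult:
  assumes "smooth_jets f" "smooth_jets g" shows "smooth_jets (\<lambda>s. f s * g s)"
  unfolding smooth_jets_def
proof (intro allI)
  fix r R
  obtain M N where M: "1 \<le> M" "jet_bounded r UNIV {0..R} f M M" and N: "1 \<le> N" "jet_bounded r UNIV {0..R} g N N"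
    using assms unfolding smooth_jets_def by meson
  have "jet_bounded r UNIV {0..R} (\<lambda>s. f s * g s) (M * N) (M + N)"
    by (rule jet_bounded_mult[OF _ _ M(2) N(2)]) (use M(1) N(1) in auto)
  then have "jet_bounded r UNIV {0..R} (\<lambda>s. f s * g s) (M * N + M + N) (M * N + M + N)"
    by (rule jet_bounded_mono) (use M(1) N(1) in auto)
  moreover have "1 \<le> M * N + M + N" using M(1) N(1) by (simp add: add_increasing)
  ultimately show "\<exists>M\<ge>1. jet_bounded r UNIV {0..R} (\<lambda>s. f s * g s) M M" by blast
qed

lemma smooth_jets_add:
  assumes "smooth_jets f" "smooth_jets g" shows "smooth_jets (\<lambda>s. f s + g s)"
  unfolding smooth_jets_def
proof (intro allI)
  fix r R
  obtain M N where M: "1 \<le> M" "jet_bounded r UNIV {0..R} f M M" and N: "1 \<le> N" "jet_bounded r UNIV {0..R} g N N"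
    using assms unfolding smooth_jets_def by meson
  have "jet_bounded r UNIV {0..R} (\<lambda>s. f s + g s) (M + N) (M + N)"
  proof (rule jet_bounded_add)
    show "jet_bounded r UNIV {0..R} f M (M + N)" by (rule jet_bounded_mono[OF M(2)]) (use M(1) N(1) in auto)
    show "jet_bounded r UNIV {0..R} g N (M + N)" by (rule jet_bounded_mono[OF N(2)]) (use M(1) N(1) in auto)
  qed auto
  then show "\<exists>M\<ge>1. jet_bounded r UNIV {0..R} (\<lambda>s. f s + g s) M M" using M(1) N(1) by (intro exI[of _ "M + N"]) auto
qed

lemma smooth_jets_const: "smooth_jets (\<lambda>s. c)"
  using smooth_jetsI_sequence[of "\<lambda>i s. if i = 0 then c else 0"] by simp

lemma smooth_jets_ident: "smooth_jets (\<lambda>s. s)"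
  using smooth_jetsI_sequence[of "\<lambda>i s. if i = 0 then s else if i = 1 then 1 else 0"] by simp

lemma smooth_jets_power_series:
  fixes c :: "nat \<Rightarrow> real"
  assumes "\<And>s. summable (\<lambda>n. c n * s ^ n)"
  shows "smooth_jets (\<lambda>s. \<Sum>n. c n * s ^ n)"
proof -
  have sm: "summable (\<lambda>n. (diffs ^^ i) c n * s ^ n)" for i s
  proof (induction i arbitrary: s)
    case (Suc i)
    then show ?case using termdiff_converges_all[of "(diffs ^^ i) c" s] by simp
  qed (use assms in simp)
  have "smooth_jets ((\<lambda>i s. \<Sum>n. (diffs ^^ i) c n * s ^ n) 0)"
    by (rule smooth_jetsI_sequence) (use termdiffs_strong_converges_everywhere[OF sm] in simp)
  then show ?thesis by simp
qed

text \<open>The power series of \<open>cos (sqrt s)\<close>, which is smooth at \<open>s = 0\<close>.\<close>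

definition cos_of_square :: "real \<Rightarrow> real" where
  "cos_of_square s = (\<Sum>n. (- 1) ^ n / fact (2 * n) * s ^ n)"

text \<open>The power series of \<open>sin (sqrt s) / sqrt s\<close>.\<close>

definition sinc_of_square :: "real \<Rightarrow> real" where
  "sinc_of_square s = (\<Sum>n. (- 1) ^ n / fact (2 * n + 1) * s ^ n)"

lemma even_odd_exp_series_summable:
  fixes s :: real
  shows "summable (\<lambda>n. (- 1) ^ n / fact (2 * n) * s ^ n)" "summable (\<lambda>n. (- 1) ^ n / fact (2 * n + 1) * s ^ n)"
proof -
  have e: "summable (\<lambda>n. \<bar>s\<bar> ^ n / fact n)"
    using summable_exp[of "\<bar>s\<bar>"] by (simp add: divide_inverse mult.commute)
  have f: "(fact n :: real) \<le> fact (2 * n)" "(fact n :: real) \<le> fact (2 * n + 1)" for n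
    by (intro fact_mono; simp)+
  show "summable (\<lambda>n. (- 1) ^ n / fact (2 * n) * s ^ n)"
    by (rule summable_comparison_test'[OF e])
      (use f(1) in \<open>auto simp: abs_mult power_abs intro!: frac_le\<close>)
  show "summable (\<lambda>n. (- 1) ^ n / fact (2 * n + 1) * s ^ n)"
    by (rule summable_comparison_test'[OF e])
      (use f(2) in \<open>auto simp: abs_mult power_abs simp del: fact_Suc intro!: frac_le\<close>)
qed

lemma cos_eq_cos_of_square: "cos r = cos_of_square (r^2)"
  using sums_unique[OF cos_paired[of r]] by (simp add: cos_of_square_def power_mult)

lemma sin_eq_sinc_of_square: "sin r = r * sinc_of_square (r^2)"
proof -
  have "(\<lambda>n. r * ((- 1) ^ n / fact (2 * n + 1) * (r^2) ^ n)) sums (r * sinc_of_square (r^2))"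
    unfolding sinc_of_square_def
    by (intro sums_mult summable_sums even_odd_exp_series_summable(2))
  moreover have "(\<lambda>n. r * ((- 1) ^ n / fact (2 * n + 1) * (r^2) ^ n)) = (\<lambda>n. (- 1) ^ n / fact (2 * n + 1) * r ^ (2 * n + 1))"
    by (rule ext) (simp add: power_mult[symmetric] mult_ac)
  ultimately show ?thesis using sums_unique2[OF sin_paired[of r]] by simp
qed

primrec op_phase :: "layer_op \<Rightarrow> real \<Rightarrow> real" where
  "op_phase SL = (\<lambda>s. cos_of_square s)"
| "op_phase DL = (\<lambda>s. cos_of_square s + s * sinc_of_square s)"
| "op_phase ADL = (\<lambda>s. cos_of_square s + s * sinc_of_square s)"
| "op_phase HS = (\<lambda>s. cos_of_square s + s * sinc_of_square s)"
| "op_phase WS = (\<lambda>s. (s + (- 3)) * cos_of_square s + (- 3) * s * sinc_of_square s)"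

lemma op_\<Phi>_eq_op_phase: "op_\<Phi> B r = op_phase B (r^2)"
  by (cases B) (simp_all add: cos_eq_cos_of_square[of r] sin_eq_sinc_of_square[of r] power2_eq_square)

lemma smooth_jets_op_phase: "smooth_jets (op_phase B)"
proof -
  have c: "smooth_jets cos_of_square" unfolding cos_of_square_def[abs_def]
    by (rule smooth_jets_power_series[OF even_odd_exp_series_summable(1)])
  have s: "smooth_jets sinc_of_square" unfolding sinc_of_square_def[abs_def]
    by (rule smooth_jets_power_series[OF even_odd_exp_series_summable(2)])
  have a: "smooth_jets (\<lambda>t. cos_of_square t + t * sinc_of_square t)"
    "smooth_jets (\<lambda>t. (t + (- 3)) * cos_of_square t + (- 3) * t * sinc_of_square t)"
    by (intro smooth_jets_add smooth_jets_mult smooth_jets_const smooth_jets_ident c s)+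
  show ?thesis by (cases B) (simp_all only: op_phase.simps c a)
qed

lemma jet_bounded_op_phase:
  fixes D :: real
  assumes "0 < k" "0 \<le> D"
  shows "\<exists>M\<ge>1. \<forall>x y :: real^3. dist x y \<le> D \<longrightarrow>
    jet_bounded r UNIV {y} (\<lambda>y. op_phase B ((k * dist x y)^2)) M M"
proof -
  obtain M where M: "1 \<le> M" "jet_bounded r UNIV {0..(k * D)^2} (op_phase B) M M"
    using smooth_jets_op_phase[of B] unfolding smooth_jets_def by blast
  define M' where "M' = M + 2 * M * (1 + k * D) * k + r * k"
  have M'1: "M \<le> M'" using M assms by (auto simp: M'_def)
  have "jet_bounded r UNIV {y} (\<lambda>y. op_phase B ((k * dist x y)^2)) M' M'" if "dist x y \<le> D" for x y :: "real^3"
  proof -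
    \<comment> \<open>The phase is a radial function on the scale \<open>1/k\<close>.\<close>
    let ?\<delta> = "inverse k" and ?t = "dist x y / inverse k"
    have t: "0 \<le> ?t" "?t \<le> k * D" "?t = k * dist x y"
      using assms that by (auto simp: divide_inverse mult.commute)
    have "jet_bounded r UNIV {?t^2} (op_phase B) M M"
      by (rule jet_bounded_mono[OF M(2)]) (use M(1) t(1,2) in \<open>auto intro: power_mono\<close>)
    then have "jet_bounded r UNIV {y} (\<lambda>y. op_phase B ((dist x y / inverse k)^2)) M
        (2 * M * (1 + ?t) / ?\<delta> + r * inverse (?\<delta> * (1 + ?t)))"
      by (intro jet_bounded_radial) (use M(1) assms in auto)
    then show ?thesis unfolding divide_inverse inverse_inverse_eq mult.commute[of _ k]
    proof (rule jet_bounded_mono)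
      let ?u = "k * dist x y"
      have u: "0 \<le> ?u" "?u \<le> k * D" using t by auto
      have "2 * M * (1 + ?u) * k \<le> 2 * M * (1 + k * D) * k"
        using u M(1) assms by (intro mult_left_mono mult_right_mono) auto
      moreover have "inverse (inverse k * (1 + ?u)) \<le> k"
        using assms u by (simp add: divide_simps mult_left_le)
      then have "r * inverse (inverse k * (1 + ?u)) \<le> r * k" by (intro mult_left_mono) auto
      ultimately show "k * (2 * M * (1 + ?u)) + r * inverse (inverse k * (1 + ?u)) \<le> M'"
        using M(1) unfolding M'_def mult.commute[of k "2 * M * (1 + ?u)"] by linarith
      show "0 \<le> k * (2 * M * (1 + ?u)) + r * inverse (inverse k * (1 + ?u))"
        using u M(1) assms by auto
    qed (use M'1 in auto)
  qed
  then show ?thesis using M(1) M'1 by (intro exI[of _ M']) auto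
qed

text \<open>The function \<open>\<Psi>\<close> without its factor \<open>|x-y|\<^bsup>2s\<^esup>\<close>. The map \<open>N\<close> extends the unit normal to a neighbourhood
of the surface, so that derivatives in \<open>y\<close> make sense.\<close>

primrec op_factor :: "layer_op \<Rightarrow> (real^3 \<Rightarrow> real^3) \<Rightarrow> real^3 \<Rightarrow> real^3 \<Rightarrow> real" where
  "op_factor SL N x = (\<lambda>y. 1)"
| "op_factor DL N x = (\<lambda>y. N y \<bullet> (x - y))"
| "op_factor ADL N x = (\<lambda>y. N x \<bullet> (y - x))"
| "op_factor HS N x = (\<lambda>y. N y \<bullet> N x)"
| "op_factor WS N x = (\<lambda>y. ((x - y) \<bullet> N y) * ((x - y) \<bullet> N x))"

lemma op_\<Psi>_eq_op_factor: "op_\<Psi> B N x y = dist x y ^ (2 * op_s B) * op_factor B N x y"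
  by (cases B) (simp_all add: dist_norm)

lemma jet_bounded_inner:
  fixes f g :: "'a::euclidean_space \<Rightarrow> 'b::real_inner"
  assumes "open V" "S \<subseteq> V" "jet_bounded r V S f K1 L1" "jet_bounded r V S g K2 L2" "0 \<le> L1" "0 \<le> L2"
  shows "jet_bounded r V S (\<lambda>x. f x \<bullet> g x) (K1 * K2) (L1 + L2)"
  by (rule jet_bounded_bilinear[OF assms(1,2) bounded_bilinear_inner _ assms(3-6)])
    (simp add: Cauchy_Schwarz_ineq2)

text \<open>Besides smoothness, the factors that contain a scalar product of a normal with \<open>x-y\<close> vanish at \<open>y = x\<close>, which
follows from the Cauchy-Schwarz inequality. All constants are uniform over the compact surface.\<close>

lemma jet_bounded_op_factor:
  fixes N :: "real^3 \<Rightarrow> real^3"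
  assumes "open V" "\<Gamma> \<subseteq> V" "compact \<Gamma>" "smooth V N"
  shows "\<exists>M\<ge>1. \<forall>x\<in>\<Gamma>. \<forall>y\<in>\<Gamma>. \<forall>B. jet_bounded r V {y} (op_factor B N x) M M \<and>
    (B \<noteq> SL \<and> B \<noteq> HS \<longrightarrow> \<bar>op_factor B N x y\<bar> \<le> M * dist x y)"
proof -
  obtain K0 where K0: "K0 \<ge> 0" "jet_bounded r V \<Gamma> N K0 1"
    using Ck_jet_bounded_compact[OF _ assms(1,3,2)] assms(4) unfolding smooth_def by blast
  define K where "K = K0 + 1"
  define D where "D = diameter \<Gamma> + 1"
  define M where "M = (K * D + 3)^2"
  have bd: "bounded \<Gamma>" by (rule compact_imp_bounded[OF assms(3)])
  have D: "1 \<le> D" using diameter_ge_0[OF bd] by (simp add: D_def)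
  have K: "1 \<le> K" using K0 by (simp add: K_def)
  have KD: "1 \<le> K * D" using mult_mono[of 1 K 1 D] K D by simp
  have M_eq: "M = (K * D)^2 + 6 * (K * D) + 9" by (simp add: M_def power2_eq_square algebra_simps)
  have M: "K * D \<le> M" "3 \<le> M" "(K * D)^2 \<le> M" unfolding M_eq using KD zero_le_power2[of "K * D"] by linarith+
  have KK: "K \<le> K * D" using mult_left_mono[of 1 D K] K D by simp
  have K2: "K * K \<le> M"
  proof -
    have "K * K \<le> (K * D) * (K * D)" by (rule mult_mono[OF KK KK]) (use K KD in auto)
    then show ?thesis using M(3) unfolding power2_eq_square by linarith
  qed
  have DKK: "D * (K * K) \<le> M"
  proof -
    have "D * (K * K) = K * (K * D)" by simp
    also have "\<dots> \<le> (K * D) * (K * D)" using KK KD by (intro mult_right_mono) auto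
    finally show ?thesis using M(3) by (simp add: power2_eq_square)
  qed
  have "jet_bounded r V {y} (op_factor B N x) M M \<and>
    (B \<noteq> SL \<and> B \<noteq> HS \<longrightarrow> \<bar>op_factor B N x y\<bar> \<le> M * dist x y)"
    if x: "x \<in> \<Gamma>" and y: "y \<in> \<Gamma>" for x y B
  proof -
    have yV: "{y} \<subseteq> V" using y assms(2) by blast
    have nK: "norm (N z) \<le> K" if "z \<in> \<Gamma>" for z using jet_boundedD[OF K0(2) that] by (simp add: K_def)
    have d: "norm (x - y) \<le> D" using diameter_bounded_bound[OF bd x y] by (simp add: D_def dist_norm)
    have n: "jet_bounded r V {y} N K 1"
      by (rule jet_bounded_mono[OF K0(2)]) (use assms(1) yV y in \<open>auto simp: K_def\<close>)
    have c: "jet_bounded r V {y} (\<lambda>y. N x) K 0"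
      by (rule jet_bounded_const[OF assms(1) yV nK[OF x]]) simp
    have l1: "jet_bounded r V {y} (\<lambda>y. x + - y) D 1"
      by (rule jet_bounded_affine[OF assms(1) yV]) (use d D in \<open>auto intro: bounded_linear_minus bounded_linear_ident\<close>)
    then have l1: "jet_bounded r V {y} (\<lambda>y. x - y) D 1" by simp
    have l2: "jet_bounded r V {y} (\<lambda>y. - x + y) D 1"
      by (rule jet_bounded_affine[OF assms(1) yV]) (use d D in \<open>auto intro: bounded_linear_ident simp: norm_minus_commute\<close>)
    then have l2: "jet_bounded r V {y} (\<lambda>y. y - x) D 1" by simp
    note inner = jet_bounded_inner[OF assms(1) yV]
    have up: "jet_bounded r V {y} f M M" if "jet_bounded r V {y} f a b" "a \<le> M" "0 \<le> b" "b \<le> M" for f :: "real^3 \<Rightarrow> real" and a b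
      by (rule jet_bounded_mono[OF that(1)]) (use that assms(1) yV in auto)
    have Ny: "\<bar>N y \<bullet> (x - y)\<bar> \<le> K * dist x y" "\<bar>N x \<bullet> (x - y)\<bar> \<le> K * dist x y"
      using Cauchy_Schwarz_ineq2[of "N y" "x - y"] Cauchy_Schwarz_ineq2[of "N x" "x - y"]
        mult_right_mono[OF nK[OF y], of "norm (x - y)"] mult_right_mono[OF nK[OF x], of "norm (x - y)"]
      by (simp_all add: dist_norm)
    have KM: "K * dist x y \<le> M * dist x y" using KK M(1) by (intro mult_right_mono) auto
    show ?thesis
    proof (cases B)
      case SL
      have "jet_bounded r V {y} (\<lambda>y. 1::real) 1 0" by (rule jet_bounded_const[OF assms(1) yV]) auto
      from up[OF this] show ?thesis using SL M by simp
    next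
      case DL
      from up[OF inner[OF n l1]] show ?thesis using DL M Ny(1) KM by simp
    next
      case ADL
      have "\<bar>N x \<bullet> (y - x)\<bar> = \<bar>N x \<bullet> (x - y)\<bar>" by (simp add: inner_diff_right abs_minus_commute)
      with up[OF inner[OF c l2]] show ?thesis using ADL M Ny(2) KM by simp
    next
      case HS
      from up[OF inner[OF n c]] show ?thesis using HS M K2 by simp
    next
      case WS
      have e: "D * K * (D * K) = (K * D)^2" by (simp add: power2_eq_square)
      have "\<bar>(x - y) \<bullet> N y\<bar> * \<bar>(x - y) \<bullet> N x\<bar> \<le> (K * dist x y) * (K * D)"
      proof (rule mult_mono)
        have "K * dist x y \<le> K * D" by (rule mult_left_mono) (use d K in \<open>auto simp: dist_norm\<close>)
        then show "\<bar>(x - y) \<bullet> N x\<bar> \<le> K * D"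
          using Ny(2) unfolding inner_commute[of "x - y" "N x"] by linarith
      qed (use Ny K in \<open>auto simp: inner_commute\<close>)
      also have "\<dots> = D * (K * K) * dist x y" by simp
      also have "\<dots> \<le> M * dist x y" by (rule mult_right_mono[OF DKK]) simp
      finally have "\<bar>op_factor B N x y\<bar> \<le> M * dist x y" using WS by (simp add: abs_mult)
      moreover have "jet_bounded r V {y} (\<lambda>y. ((x - y) \<bullet> N y) * ((x - y) \<bullet> N x)) M M"
        by (rule up[OF jet_bounded_mult[OF assms(1) yV inner[OF l1 n] inner[OF l1 c]]]) (use M e in auto)
      ultimately show ?thesis using WS by simp
    qed
  qed
  then show ?thesis using M by (intro exI[of _ M]) auto
qed

section \<open>Bounds for the regularized density\<close>

text \<open>Order of the singularity of \<open>\<Phi>/|x-y|\<^bsup>2p+1\<^esup>\<close> after the factor \<open>|x-y|\<^bsup>2s\<^esup>\<close> of \<open>\<Psi>\<close> has been cancelled.\<close>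

definition op_order :: "layer_op \<Rightarrow> nat" where
  "op_order B = 2 * (op_p B - op_s B) + 1"

text \<open>The regularized integrand without the density \<open>\<phi>\<close>, extended smoothly to a neighbourhood of the surface and
across \<open>y = x\<close>.\<close>

definition reg_density ::
    "layer_op \<Rightarrow> (real^3 \<Rightarrow> real^3) \<Rightarrow> nat \<Rightarrow> (nat \<Rightarrow> real) \<Rightarrow> real \<Rightarrow> real \<Rightarrow> real^3 \<Rightarrow> real^3 \<Rightarrow> real" where
  "reg_density B N n c k \<delta> x y = inverse (\<delta> ^ op_order B) * (op_kernel B n c ((dist x y / \<delta>)^2) *
     (op_phase B ((k * dist x y)^2) * op_factor B N x y))"

text \<open>With \<open>|x-y| = t \<delta>\<close> the powers of \<open>t\<close> in \<open>\<sigma>\<^sub>p(t)\<close> cancel those in the singular kernel, and a power of \<open>\<delta>\<close> remains.\<close>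

lemma reg_\<sigma>_sing_integrand_eq_reg_density:
  assumes "0 < \<delta>" "y \<noteq> x" "N x = \<nu> x" "N y = \<nu> y"
  shows "reg_\<sigma> (op_p B) n c (norm (x - y) / \<delta>) *\<^sub>R sing_integrand B \<nu> k \<phi> x y = reg_density B N n c k \<delta> x y *\<^sub>R \<phi> y"
proof -
  define r where "r = dist x y"
  have r: "0 < r" "norm (x - y) = r" using assms(2) by (auto simp: r_def dist_norm)
  define t where "t = r / \<delta>"
  have t: "0 \<le> t" "r = t * \<delta>" using r assms(1) by (auto simp: t_def)
  have p2: "op_p B \<le> 2" "op_s B \<le> op_p B" by (cases B; simp)+
  have psi: "op_\<Psi> B \<nu> x y = r ^ (2 * op_s B) * op_factor B N x y"
    using op_\<Psi>_eq_op_factor[of B \<nu> x y] assms(3,4) by (cases B) (auto simp: r_def)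
  have "t \<noteq> 0" "\<delta> \<noteq> 0" using r t assms(1) by auto
  have e: "2 * op_p B + 1 = op_order B + 2 * op_s B" using p2 by (simp add: op_order_def)
  have scale: "t ^ (2 * op_p B + 1) / r ^ (2 * op_p B + 1) * r ^ (2 * op_s B) = inverse (\<delta> ^ op_order B) * (t^2) ^ op_s B"
    unfolding t(2) e using \<open>t \<noteq> 0\<close> \<open>\<delta> \<noteq> 0\<close>
    by (simp add: power_mult_distrib power_add power_mult divide_simps)
  have "reg_\<sigma> (op_p B) n c t * (op_\<Phi> B (k * r) / r ^ (2 * op_p B + 1) * op_\<Psi> B \<nu> x y) =
     t ^ (2 * op_p B + 1) / r ^ (2 * op_p B + 1) * r ^ (2 * op_s B) *
       (reg_kernel (op_p B) n c (t^2) * (op_phase B ((k * r)^2) * op_factor B N x y))"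
    unfolding reg_\<sigma>_eq_reg_kernel[OF t(1) p2(1)] psi op_\<Phi>_eq_op_phase by simp
  also have "\<dots> = inverse (\<delta> ^ op_order B) * ((t^2) ^ op_s B * reg_kernel (op_p B) n c (t^2) *
       (op_phase B ((k * r)^2) * op_factor B N x y))"
    unfolding scale by simp
  finally have "reg_\<sigma> (op_p B) n c t * (op_\<Phi> B (k * r) / r ^ (2 * op_p B + 1) * op_\<Psi> B \<nu> x y) =
     inverse (\<delta> ^ op_order B) * ((t^2) ^ op_s B * reg_kernel (op_p B) n c (t^2) *
       (op_phase B ((k * r)^2) * op_factor B N x y))" .
  then show ?thesis
    by (simp add: sing_integrand_def reg_density_def op_kernel_def r(2) r_def[symmetric] t_def[symmetric])
qed

lemma inverse_one_plus_square_le: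
  fixes t :: real
  assumes "0 \<le> t"
  shows "inverse (1 + t^2) \<le> 2 * inverse (1 + t) ^ 2" "(1 + t) * inverse (1 + t^2) \<le> 2 * inverse (1 + t)"
proof -
  have "(1 + t)^2 \<le> 2 * (1 + t^2)" using zero_le_power2[of "1 - t"] by (simp add: power2_eq_square algebra_simps)
  moreover have "0 < 1 + t^2" using zero_le_power2[of t] by linarith
  moreover have "0 < 1 + t" using assms by simp
  ultimately show "inverse (1 + t^2) \<le> 2 * inverse (1 + t) ^ 2" "(1 + t) * inverse (1 + t^2) \<le> 2 * inverse (1 + t)"
    by (simp_all add: power_inverse divide_simps power2_eq_square)
qed

text \<open>The exponent of \<open>1/\<delta>\<close> in the supremum of the regularized density: the vanishing of \<open>\<Psi>\<close> at \<open>y = x\<close>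
improves the order by one, except for the operators whose remaining factor is bounded away from zero there.\<close>

definition singular_order :: "layer_op \<Rightarrow> nat" where
  "singular_order B = (if B = SL \<or> B = HS then op_order B else op_order B - 1)"

text \<open>A function on the surface that looks like a regularized kernel: it varies on the scale \<open>\<delta> + |x-y|\<close>, decays like
\<open>(1 + |x-y|/\<delta>)\<^bsup>-2d\<^esup>\<close>, and is at most \<open>Z\<close>. The lower bound on the rate lets functions that vary on the scale
\<open>1\<close> be absorbed.\<close>

definition kernel_bound ::
    "nat \<Rightarrow> (real^3) set \<Rightarrow> (real^3) set \<Rightarrow> (real^3 \<Rightarrow> real) \<Rightarrow> real^3 \<Rightarrow> real \<Rightarrow> nat \<Rightarrow> real \<Rightarrow> real \<Rightarrow> real \<Rightarrow> bool" where
  "kernel_bound r V \<Gamma> \<psi> x \<delta> d K L Z \<longleftrightarrow> (\<forall>y\<in>\<Gamma>.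
     jet_bounded r V {y} \<psi> (K * inverse (1 + dist x y / \<delta>) ^ (2 * d)) (L * inverse (\<delta> * (1 + dist x y / \<delta>))) \<and>
     1 \<le> L * inverse (\<delta> * (1 + dist x y / \<delta>)) \<and> \<bar>\<psi> y\<bar> \<le> Z)"

text \<open>The kernel contributes the decay and the rate \<open>1/(\<delta>+|x-y|)\<close>; the other two factors have rate \<open>O(1)\<close>, which is at
most a multiple of \<open>1/(\<delta>+|x-y|)\<close> because the surface is bounded and \<open>\<delta> \<le> 1\<close>. The constant is uniform
in \<open>\<delta>\<close>, in \<open>x\<close> and in the coefficients.\<close>

lemma reg_density_bounds:
  fixes N :: "real^3 \<Rightarrow> real^3"
  assumes "open V" "\<Gamma> \<subseteq> V" "compact \<Gamma>" "smooth V N" "0 < k"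
  shows "\<exists>M\<ge>1. \<forall>\<delta> c x. 0 < \<delta> \<and> \<delta> \<le> 1 \<and> (\<forall>l\<in>{1..n}. \<bar>c l\<bar> \<le> A) \<and> x \<in> \<Gamma> \<longrightarrow>
     kernel_bound r V \<Gamma> (reg_density B N n c k \<delta> x) x \<delta> (op_p B - op_s B)
       (M * inverse (\<delta> ^ op_order B)) M (M * inverse (\<delta> ^ singular_order B))"
proof -
  define D where "D = diameter \<Gamma> + 1"
  have bd: "bounded \<Gamma>" by (rule compact_imp_bounded[OF assms(3)])
  have D: "1 \<le> D" using diameter_ge_0[OF bd] by (simp add: D_def)
  obtain M1 where M1: "M1 \<ge> 1" "\<And>c s. (\<forall>l\<in>{1..n}. \<bar>c l\<bar> \<le> A) \<Longrightarrow> 0 \<le> s \<Longrightarrow>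
     jet_bounded r UNIV {s} (op_kernel B n c) (M1 * inverse (1 + s) ^ (op_p B - op_s B)) (M1 * inverse (1 + s))"
    using jet_bounded_op_kernel[of n A r B] by blast
  obtain M2 where M2: "M2 \<ge> 1" "\<And>x y :: real^3. dist x y \<le> D \<Longrightarrow>
    jet_bounded r UNIV {y} (\<lambda>y. op_phase B ((k * dist x y)^2)) M2 M2"
    using jet_bounded_op_phase[OF assms(5), of D r B] D by auto
  obtain M3 where M3: "M3 \<ge> 1" "\<And>x y. x \<in> \<Gamma> \<Longrightarrow> y \<in> \<Gamma> \<Longrightarrow> jet_bounded r V {y} (op_factor B N x) M3 M3"
    "\<And>x y. x \<in> \<Gamma> \<Longrightarrow> y \<in> \<Gamma> \<Longrightarrow> B \<noteq> SL \<Longrightarrow> B \<noteq> HS \<Longrightarrow> \<bar>op_factor B N x y\<bar> \<le> M3 * dist x y"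
    using jet_bounded_op_factor[OF assms(1-4), of r] by blast
  define d where "d = op_p B - op_s B"
  define P where "P = 4 * M1 * (M2 * M3)"
  define M where "M = P + (4 * M1 + real r + (M2 + M3) * (1 + D))"
  have P1: "1 \<le> P" using M1(1) M2(1) M3(1) mult_mono[of 1 M1 1 "M2 * M3"] mult_mono[of 1 M2 1 M3] by (simp add: P_def)
  have q: "1 + D \<le> (M2 + M3) * (1 + D)" using M2(1) M3(1) D by simp
  have M: "1 \<le> M" "P \<le> M" "4 * M1 + real r + (M2 + M3) * (1 + D) \<le> M" "1 + D \<le> M"
    unfolding M_def using P1 q M1(1) D of_nat_0_le_iff[of r] by linarith+
  have d4: "(2::real) ^ d \<le> 4" by (cases B) (auto simp: d_def)
  have main: "jet_bounded r V {y} (reg_density B N n c k \<delta> x)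
       (M * (inverse (\<delta> ^ op_order B) * inverse (1 + dist x y / \<delta>) ^ (2 * d)))
       (M * inverse (\<delta> * (1 + dist x y / \<delta>))) \<and>
     1 \<le> M * inverse (\<delta> * (1 + dist x y / \<delta>)) \<and>
     \<bar>reg_density B N n c k \<delta> x y\<bar> \<le> M * inverse (\<delta> ^ singular_order B)"
    if \<delta>: "0 < \<delta>" "\<delta> \<le> 1" and c: "\<forall>l\<in>{1..n}. \<bar>c l\<bar> \<le> A" and x: "x \<in> \<Gamma>" and y: "y \<in> \<Gamma>" for \<delta> c x y
  proof -
    have yV: "{y} \<subseteq> V" using y assms(2) by blast
    have dD: "dist x y \<le> D" using diameter_bounded_bound[OF bd x y] by (simp add: D_def)
    define t where "t = dist x y / \<delta>"
    have t: "0 \<le> t" using \<delta> by (simp add: t_def)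
    define \<Lambda> where "\<Lambda> = inverse (\<delta> * (1 + t))"
    have \<Lambda>0: "0 \<le> \<Lambda>" using \<delta> t by (simp add: \<Lambda>_def)
    \<comment> \<open>This lets functions that vary on the scale \<open>1\<close> be estimated with the rate \<open>\<Lambda>\<close>.\<close>
    have "\<delta> * (1 + t) \<le> 1 + D" using \<delta> dD by (simp add: t_def algebra_simps)
    then have \<Lambda>1: "1 \<le> (1 + D) * \<Lambda>" using \<delta> t D by (simp add: \<Lambda>_def divide_simps)
    let ?K = "inverse (1 + t) ^ (2 * d)"
    have K0: "0 \<le> ?K" "?K \<le> 1" using t by (auto intro!: power_le_one simp: inverse_le_1_iff)
    have kern: "jet_bounded r UNIV {y} (\<lambda>y. op_kernel B n c ((dist x y / \<delta>)^2)) (4 * M1 * ?K) ((4 * M1 + real r) * \<Lambda>)"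
    proof -
      have "jet_bounded r UNIV {y} (\<lambda>y. op_kernel B n c ((dist x y / \<delta>)^2)) (M1 * inverse (1 + t^2) ^ d)
          (2 * (M1 * inverse (1 + t^2)) * (1 + t) / \<delta> + r * \<Lambda>)"
        unfolding t_def \<Lambda>_def d_def
        by (rule jet_bounded_radial[OF \<delta>(1) M1(2)[OF c]]) (use M1(1) in auto)
      then show ?thesis
      proof (rule jet_bounded_mono)
        have "inverse (1 + t^2) ^ d \<le> (2 * inverse (1 + t) ^ 2) ^ d"
          by (rule power_mono[OF inverse_one_plus_square_le(1)[OF t]]) simp
        also have "\<dots> = 2 ^ d * ?K" by (simp add: power_mult_distrib power_mult)
        also have "\<dots> \<le> 4 * ?K" by (rule mult_right_mono[OF d4 K0(1)])
        finally show "M1 * inverse (1 + t^2) ^ d \<le> 4 * M1 * ?K" using M1(1) by simp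
        have "2 * (M1 * inverse (1 + t^2)) * (1 + t) / \<delta> = 2 * M1 / \<delta> * ((1 + t) * inverse (1 + t^2))" by simp
        also have "\<dots> \<le> 2 * M1 / \<delta> * (2 * inverse (1 + t))"
          using M1(1) \<delta> by (intro mult_left_mono inverse_one_plus_square_le(2)[OF t]) auto
        also have "\<dots> = 4 * M1 * \<Lambda>" by (simp add: \<Lambda>_def divide_simps)
        finally show "2 * (M1 * inverse (1 + t^2)) * (1 + t) / \<delta> + r * \<Lambda> \<le> (4 * M1 + real r) * \<Lambda>"
          by (simp add: algebra_simps)
        show "0 \<le> 2 * (M1 * inverse (1 + t^2)) * (1 + t) / \<delta> + r * \<Lambda>" using M1(1) \<delta> t \<Lambda>0 by auto
      qed auto
    qed
    have fac: "jet_bounded r V {y} (\<lambda>y. op_phase B ((k * dist x y)^2) * op_factor B N x y) (M2 * M3) (M2 + M3)"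
      by (rule jet_bounded_mult[OF assms(1) yV _ M3(2)[OF x y]])
        (use M2(1) M3(1) yV assms(1) in \<open>auto intro!: jet_bounded_mono[OF M2(2)[OF dD]]\<close>)
    have kernV: "jet_bounded r V {y} (\<lambda>y. op_kernel B n c ((dist x y / \<delta>)^2)) (4 * M1 * ?K) ((4 * M1 + real r) * \<Lambda>)"
      by (rule jet_bounded_mono[OF kern]) (use M1(1) \<Lambda>0 yV assms(1) in auto)
    have prod: "jet_bounded r V {y} (\<lambda>y. op_kernel B n c ((dist x y / \<delta>)^2) *
        (op_phase B ((k * dist x y)^2) * op_factor B N x y)) (4 * M1 * ?K * (M2 * M3)) ((4 * M1 + real r) * \<Lambda> + (M2 + M3))"
      by (rule jet_bounded_mult[OF assms(1) yV kernV fac]) (use M1(1) M2(1) M3(1) \<Lambda>0 in auto)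
    have "jet_bounded r V {y} (reg_density B N n c k \<delta> x) (inverse (\<delta> ^ op_order B) * (4 * M1 * ?K * (M2 * M3)))
        ((4 * M1 + real r) * \<Lambda> + (M2 + M3))"
      unfolding reg_density_def[abs_def]
      by (rule jet_bounded_cmult[OF assms(1) yV prod]) (use M1(1) M2(1) M3(1) \<Lambda>0 \<delta> in auto)
    then have jets: "jet_bounded r V {y} (reg_density B N n c k \<delta> x) (M * (inverse (\<delta> ^ op_order B) * ?K)) (M * \<Lambda>)"
    proof (rule jet_bounded_mono)
      have "inverse (\<delta> ^ op_order B) * (4 * M1 * ?K * (M2 * M3)) = P * (inverse (\<delta> ^ op_order B) * ?K)"
        by (simp add: P_def)
      also have "\<dots> \<le> M * (inverse (\<delta> ^ op_order B) * ?K)"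
        using K0 \<delta> by (intro mult_right_mono M) auto
      finally show "inverse (\<delta> ^ op_order B) * (4 * M1 * ?K * (M2 * M3)) \<le> M * (inverse (\<delta> ^ op_order B) * ?K)" .
      have "M2 + M3 \<le> (M2 + M3) * ((1 + D) * \<Lambda>)" using mult_left_mono[OF \<Lambda>1, of "M2 + M3"] M2(1) M3(1) by simp
      then have "(4 * M1 + real r) * \<Lambda> + (M2 + M3) \<le> (4 * M1 + real r + (M2 + M3) * (1 + D)) * \<Lambda>"
        by (simp add: algebra_simps)
      also have "\<dots> \<le> M * \<Lambda>" by (rule mult_right_mono[OF M(3) \<Lambda>0])
      finally show "(4 * M1 + real r) * \<Lambda> + (M2 + M3) \<le> M * \<Lambda>" .
      show "0 \<le> (4 * M1 + real r) * \<Lambda> + (M2 + M3)" using M1(1) M2(1) M3(1) \<Lambda>0 by auto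
    qed (use yV assms(1) in auto)
    have "1 \<le> M * \<Lambda>" using \<Lambda>1 mult_right_mono[OF M(4) \<Lambda>0] by linarith
    moreover have "\<bar>reg_density B N n c k \<delta> x y\<bar> \<le> M * inverse (\<delta> ^ singular_order B)"
    proof (cases "B = SL \<or> B = HS")
      case True
      have "\<bar>reg_density B N n c k \<delta> x y\<bar> \<le> M * (inverse (\<delta> ^ op_order B) * ?K)"
        using jet_boundedD[OF jets, of y] by simp
      also have "\<dots> \<le> M * (inverse (\<delta> ^ op_order B) * 1)"
        using K0 \<delta> M(1) by (intro mult_left_mono) auto
      finally show ?thesis using True by (simp add: singular_order_def)
    next
      case False
      have d1: "1 \<le> d" "op_order B = Suc (op_order B - 1)" using False by (cases B; simp add: d_def op_order_def)+
      have "\<bar>op_factor B N x y\<bar> \<le> M3 * dist x y" using M3(3)[OF x y] False by blast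
      also have "\<dots> = M3 * \<delta> * t" using \<delta> by (simp add: t_def)
      finally have f: "\<bar>op_factor B N x y\<bar> \<le> M3 * \<delta> * t" .
      have g: "\<bar>op_kernel B n c ((dist x y / \<delta>)^2)\<bar> \<le> 4 * M1 * ?K" using jet_boundedD[OF kernV, of y] by simp
      have h: "\<bar>op_phase B ((k * dist x y)^2)\<bar> \<le> M2" using jet_boundedD[OF M2(2)[OF dD], of y] by simp
      have "t * ?K \<le> 1"
      proof -
        have "?K \<le> inverse (1 + t) ^ 1" using t d1 by (intro power_decreasing) (auto simp: inverse_le_1_iff)
        then have "t * ?K \<le> t * inverse (1 + t)" using t by (intro mult_left_mono) auto
        also have "\<dots> \<le> 1" using t by (simp add: divide_simps)
        finally show ?thesis .
      qed
      then have tK: "P * (\<delta> * (t * ?K)) \<le> P * (\<delta> * 1)" using P1 \<delta> by (intro mult_left_mono) auto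
      have "\<bar>reg_density B N n c k \<delta> x y\<bar> = inverse (\<delta> ^ op_order B) * (\<bar>op_kernel B n c ((dist x y / \<delta>)^2)\<bar> *
          (\<bar>op_phase B ((k * dist x y)^2)\<bar> * \<bar>op_factor B N x y\<bar>))"
        using \<delta> by (simp add: reg_density_def abs_mult)
      also have "\<dots> \<le> inverse (\<delta> ^ op_order B) * (4 * M1 * ?K * (M2 * (M3 * \<delta> * t)))"
        by (intro mult_left_mono mult_mono f g h) (use M1(1) M2(1) M3(1) \<delta> t K0 in auto)
      also have "\<dots> = inverse (\<delta> ^ op_order B) * (P * (\<delta> * (t * ?K)))" by (simp add: P_def mult_ac)
      also have "\<dots> \<le> inverse (\<delta> ^ op_order B) * (P * (\<delta> * 1))"
        by (rule mult_left_mono[OF tK]) (use \<delta> in simp)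
      also have "\<dots> = P * inverse (\<delta> ^ (op_order B - 1))"
        using \<delta> by (subst (1) d1(2)) (simp add: field_simps)
      also have "\<dots> \<le> M * inverse (\<delta> ^ (op_order B - 1))" using \<delta> M(2) by (intro mult_right_mono) auto
      finally show ?thesis using False by (simp add: singular_order_def)
    qed
    ultimately show ?thesis using jets unfolding \<Lambda>_def t_def by blast
  qed
  have "kernel_bound r V \<Gamma> (reg_density B N n c k \<delta> x) x \<delta> d (M * inverse (\<delta> ^ op_order B)) M (M * inverse (\<delta> ^ singular_order B))"
    if "0 < \<delta>" "\<delta> \<le> 1" "\<forall>l\<in>{1..n}. \<bar>c l\<bar> \<le> A" "x \<in> \<Gamma>" for \<delta> c x
    unfolding kernel_bound_def mult.assoc[of M "inverse (\<delta> ^ op_order B)"] using main[OF that] by blast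
  then show ?thesis unfolding d_def using M(1) by blast
qed

section \<open>Quadrature on a curved element\<close>

text \<open>The derivatives are multiples of \<open>s powr (1/2 - i)\<close> with coefficients at most \<open>(r+1)\<^sup>i\<close>.\<close>

lemma jet_bounded_sqrt:
  fixes s :: real
  assumes "0 < s"
  shows "jet_bounded r {0<..} {s} sqrt (sqrt s) ((real r + 1) / s)"
proof -
  define c where "c = (\<lambda>i::nat. \<Prod>j<i. 1/2 - real j)"
  define f where "f = (\<lambda>i s. c i * s powr (1/2 - real i))"
  have cb: "\<bar>c i\<bar> \<le> (real r + 1) ^ i" if "i \<le> r" for i
  proof -
    have "\<bar>c i\<bar> = (\<Prod>j<i. \<bar>1/2 - real j\<bar>)" by (simp add: c_def abs_prod)
    also have "\<dots> \<le> (\<Prod>j<i. real r + 1)" by (rule prod_mono) (use that in auto)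
    finally show ?thesis by simp
  qed
  have "jet_bounded r {0<..} {s} (f 0) (sqrt s) ((real r + 1) / s)"
  proof (rule jet_bounded_real_sequence)
    show "(f i has_field_derivative f (Suc i) t) (at t)" if "t \<in> {0<..}" for i t
    proof -
      have "((\<lambda>t. t powr (1/2 - real i)) has_real_derivative (1/2 - real i) * t powr (1/2 - real i - 1)) (at t)"
        by (rule has_real_derivative_powr) (use that in simp)
      from DERIV_cmult[OF this, of "c i"] show ?thesis
        by (simp add: f_def c_def algebra_simps)
    qed
    fix i t assume i: "i \<le> r" "t \<in> {s}"
    have "\<bar>f i s\<bar> = \<bar>c i\<bar> * (sqrt s / s ^ i)"
      using assms by (simp add: f_def abs_mult powr_diff powr_half_sqrt powr_realpow)
    also have "\<dots> \<le> (real r + 1) ^ i * (sqrt s / s ^ i)"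
      using assms by (intro mult_right_mono cb[OF i(1)]) auto
    also have "\<dots> = sqrt s * ((real r + 1) / s) ^ i" by (simp add: power_divide)
    finally show "\<bar>f i t\<bar> \<le> sqrt s * ((real r + 1) / s) ^ i" using i(2) by simp
  qed (use assms in auto)
  moreover have "f 0 t = sqrt t" if "t \<in> {0<..}" for t using that by (simp add: f_def c_def powr_half_sqrt)
  ultimately show ?thesis using jet_bounded_cong[of "{0<..}" "{s}" "f 0" sqrt r "sqrt s" "(real r + 1) / s"] assms by auto
qed

lemma norm_cross3_le: "norm (cross3 x y) \<le> norm x * norm y"
proof -
  have "(norm (cross3 x y))^2 \<le> (norm x * norm y)^2"
    using norm_cross_dot[of x y] zero_le_power2[of "x \<bullet> y"] by linarith
  then show ?thesis by (rule power2_le_imp_le) simp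
qed

lemma jet_bounded_derivative:
  fixes F :: "real^'n \<Rightarrow> 'b::real_normed_vector"
  assumes "smooth V F" "S \<subseteq> V" "0 \<le> h"
    "\<And>\<alpha> u. \<alpha> \<noteq> [] \<Longrightarrow> length \<alpha> \<le> Suc r \<Longrightarrow> u \<in> S \<Longrightarrow> norm (partials \<alpha> F u) \<le> A * h ^ length \<alpha>"
    "b \<in> Basis"
  shows "jet_bounded r V S (\<lambda>u. frechet_derivative F (at u) b) (A * h) h"
proof -
  obtain i where i: "b = axis i 1" using assms(5) by (auto simp: Basis_vec_axis)
  have "Ck r V (\<lambda>u. frechet_derivative F (at u) b)"
    using smooth_frechet_derivative[OF assms(1)] by (simp add: smooth_def)
  then show ?thesis
  proof (rule Ck_partials_imp_jet_bounded[OF _ assms(2)])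
    fix \<alpha> :: "'n list" and u assume *: "length \<alpha> \<le> r" "u \<in> S"
    show "norm (partials \<alpha> (\<lambda>u. frechet_derivative F (at u) b) u) \<le> A * h * h ^ length \<alpha>"
      using assms(4)[of "\<alpha> @ [i]" u] * by (simp add: partials_append i mult.assoc)
  qed
qed

text \<open>The squared Jacobian is a polynomial in first derivatives of \<open>F\<close> and of size \<open>h\<^sup>4\<close> with rate \<open>O(h)\<close>. Regularity of
the mesh bounds it from below by a multiple of \<open>h\<^sup>4\<close>, so the square root keeps the rate.\<close>

lemma jet_bounded_surf_jac:
  assumes "open U" "smooth U F" "u \<in> U" "\<And>v. v \<in> U \<Longrightarrow> surf_jac F v \<noteq> 0"
    "0 < h" "0 < lo" "lo * h^2 \<le> surf_jac F u" "surf_jac F u \<le> hi * h^2" "0 \<le> A"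
    "\<And>\<alpha>. \<alpha> \<noteq> [] \<Longrightarrow> length \<alpha> \<le> Suc (Suc r) \<Longrightarrow> norm (partials \<alpha> F u) \<le> A * h ^ length \<alpha>"
  shows "jet_bounded r U {u} (surf_jac F) (hi * h^2) (((real r + 1) / lo^2 * (4 * A^4) + 4 * real r) * h)"
proof -
  let ?D = "\<lambda>i u. frechet_derivative F (at u) (axis i 1)"
  let ?w = "\<lambda>u. cross3 (?D 1 u) (?D 2 u) \<bullet> cross3 (?D 1 u) (?D 2 u)"
  have uU: "{u} \<subseteq> U" using assms(3) by simp
  have D: "jet_bounded (Suc r) U {u} (?D i) (A * h) h" for i
    by (rule jet_bounded_derivative[OF assms(2) uU]) (use assms(5,10) in \<open>auto simp: Basis_vec_axis\<close>)
  have bl: "bounded_bilinear cross3" using bilinear_cross by (simp add: bilinear_conv_bounded_bilinear)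
  have cr: "jet_bounded (Suc r) U {u} (\<lambda>u. cross3 (?D 1 u) (?D 2 u)) (A * h * (A * h)) (h + h)"
    by (rule jet_bounded_bilinear[OF assms(1) uU bl norm_cross3_le D D]) (use assms(5) in auto)
  have w: "jet_bounded (Suc r) U {u} ?w (A * h * (A * h) * (A * h * (A * h))) (h + h + (h + h))"
    by (rule jet_bounded_inner[OF assms(1) uU cr cr]) (use assms(5) in auto)
  have wJ: "?w v = (surf_jac F v)^2" for v by (simp add: surf_jac_eq power2_norm_eq_inner)
  have Jw: "surf_jac F = (\<lambda>v. sqrt (?w v))" unfolding wJ by (rule ext) (simp add: surf_jac_eq)
  have J0: "0 < surf_jac F v" if "v \<in> U" for v using assms(4)[OF that] by (simp add: surf_jac_eq)
  have w0: "0 < ?w v" if "v \<in> U" for v unfolding wJ using J0[OF that] by simp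
  have "jet_bounded r U {u} (\<lambda>v. sqrt (?w v)) (sqrt (?w u))
      (DIM(real) * ((real r + 1) / ?w u) * (A * h * (A * h) * (A * h * (A * h)) * (h + h + (h + h))) + r * (h + h + (h + h)))"
  proof (rule jet_bounded_compose[where W = "{0<..}" and S' = "{?w u}" and f = ?w and g = sqrt])
    show "?w differentiable (at v)" if "v \<in> U" for v
      by (rule jet_bounded_differentiable[OF w]) (use that in auto)
    show "jet_bounded r U {u} (\<lambda>v. frechet_derivative ?w (at v) b) (A * h * (A * h) * (A * h * (A * h)) * (h + h + (h + h))) (h + h + (h + h))"
      if "b \<in> Basis" for b by (rule jet_bounded_SucE[OF w that])
    show "jet_bounded r {0<..} {?w u} sqrt (sqrt (?w u)) ((real r + 1) / ?w u)"
      by (rule jet_bounded_sqrt[OF w0[OF assms(3)]])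
    show "?w ` U \<subseteq> {0<..}" using w0 by auto
    show "0 \<le> (real r + 1) / ?w u" using w0[OF assms(3)] by simp
  qed (use assms w0 in auto)
  moreover have "sqrt (?w u) = surf_jac F u" unfolding wJ using J0[OF assms(3)] by simp
  moreover have "DIM(real) * ((real r + 1) / ?w u) * (A * h * (A * h) * (A * h * (A * h)) * (h + h + (h + h))) + r * (h + h + (h + h))
      = (real r + 1) / (surf_jac F u)^2 * (4 * A^4 * h^5) + r * (4 * h)"
    unfolding wJ by (simp add: eval_nat_numeral)
  ultimately have "jet_bounded r U {u} (surf_jac F) (surf_jac F u)
      ((real r + 1) / (surf_jac F u)^2 * (4 * A^4 * h^5) + r * (4 * h))"
    by (subst (1) Jw) (simp only:)
  then show ?thesis
  proof (rule jet_bounded_mono)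
    have "lo^2 * h^4 \<le> (surf_jac F u)^2"
      using power_mono[OF assms(7), of 2] assms(5,6) by (simp add: power_mult_distrib power_mult[symmetric])
    then have "(real r + 1) / (surf_jac F u)^2 \<le> (real r + 1) / (lo^2 * h^4)"
      using assms(5,6) J0[OF assms(3)] by (intro divide_left_mono mult_pos_pos zero_less_power) auto
    then have "(real r + 1) / (surf_jac F u)^2 * (4 * A^4 * h^5) \<le> (real r + 1) / (lo^2 * h^4) * (4 * A^4 * h^5)"
      using assms(5,9) by (intro mult_right_mono) auto
    also have "\<dots> = (real r + 1) / lo^2 * (4 * A^4) * h"
      using assms(5) by (simp add: eval_nat_numeral divide_simps)
    finally show "(real r + 1) / (surf_jac F u)^2 * (4 * A^4 * h^5) + r * (4 * h) \<le> ((real r + 1) / lo^2 * (4 * A^4) + 4 * real r) * h"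
      by (simp add: algebra_simps)
    show "0 \<le> (real r + 1) / (surf_jac F u)^2 * (4 * A^4 * h^5) + r * (4 * h)" using assms(5,9) by simp
  qed (use assms uU in auto)
qed

lemma regular_mesh_partials_bound:
  fixes reg_D :: "2 list \<Rightarrow> real"
  shows "\<exists>A\<ge>0. \<forall>\<alpha>. length \<alpha> \<le> r \<longrightarrow> reg_D \<alpha> \<le> A"
proof -
  have fin: "finite {\<alpha>::2 list. length \<alpha> \<le> r}" using finite_lists_length_le[of "UNIV::2 set"] by simp
  show ?thesis
  proof (intro exI[of _ "\<Sum>\<alpha>\<in>{\<alpha>. length \<alpha> \<le> r}. \<bar>reg_D \<alpha>\<bar>"] conjI allI impI)
    fix \<alpha> :: "2 list" assume "length \<alpha> \<le> r"
    then have "\<bar>reg_D \<alpha>\<bar> \<le> (\<Sum>\<alpha>\<in>{\<alpha>. length \<alpha> \<le> r}. \<bar>reg_D \<alpha>\<bar>)"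
      using fin by (intro member_le_sum) auto
    then show "reg_D \<alpha> \<le> (\<Sum>\<alpha>\<in>{\<alpha>. length \<alpha> \<le> r}. \<bar>reg_D \<alpha>\<bar>)" by linarith
  qed (simp add: sum_nonneg)
qed

definition element_error ::
    "(real^2) set \<Rightarrow> nat \<Rightarrow> (nat \<Rightarrow> real^2) \<Rightarrow> (nat \<Rightarrow> real) \<Rightarrow> (real^2 \<Rightarrow> real^3) \<Rightarrow> (real^3 \<Rightarrow> real) \<Rightarrow> real" where
  "element_error Th NQ xq w F \<psi> =
     (LINT u:Th|lborel. surf_jac F u * \<psi> (F u)) - (\<Sum>j=1..NQ. w j * (surf_jac F (xq j) * \<psi> (F (xq j))))"

text \<open>A rate \<open>\<Lambda>\<close> on the surface becomes the rate \<open>O(h \<Lambda>)\<close> in the reference coordinates, since every derivative of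
the parametrization carries a factor \<open>h\<close>. The Jacobian contributes the area \<open>h\<^sup>2\<close> and the rate \<open>O(h)\<close>.\<close>

lemma element_quadrature_error:
  assumes "quadrature_rule Th q NQ xq w" "0 < reg_lo"
  shows "\<exists>C\<ge>0. \<forall>\<Gamma> ds h M F V \<psi> K \<Lambda>.
    smooth_closed_surface \<Gamma> \<and> surface_measure \<Gamma> ds \<and> reference_element Th \<and>
    regular_mesh \<Gamma> Th reg_s reg_u reg_lo reg_hi reg_D h M \<and> 0 < h \<and> F \<in> M \<and> open V \<and> F ` Th \<subseteq> V \<and>
    0 \<le> K \<and> 1 \<le> \<Lambda> \<and> jet_bounded (Suc q) V (F ` Th) \<psi> K \<Lambda> \<longrightarrow>
    \<bar>element_error Th NQ xq w F \<psi>\<bar> \<le> C * (h^2 * K * (h * \<Lambda>) ^ Suc q)"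
proof -
  obtain A where A: "0 \<le> A" "\<And>\<alpha>. length \<alpha> \<le> Suc (Suc (Suc q)) \<Longrightarrow> reg_D \<alpha> \<le> A"
    using regular_mesh_partials_bound[of "Suc (Suc (Suc q))" reg_D] by blast
  define r where "r = Suc q"
  define CJ where "CJ = (real r + 1) / reg_lo^2 * (4 * A^4) + 4 * real r"
  define CL where "CL = CJ + 3 * A + real r"
  define C0 where "C0 = 2 * measure lborel Th * (2 * diameter Th) ^ Suc q * (\<bar>reg_hi\<bar> * CL ^ Suc q)"
  have CJ0: "0 \<le> CJ" using A(1) by (simp add: CJ_def)
  have CL0: "0 \<le> CL" using A(1) CJ0 by (simp add: CL_def)
  show ?thesis
  proof (intro exI[of _ "\<bar>C0\<bar>"] conjI allI impI; (elim conjE)?)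
    fix \<Gamma> ds h M F V K \<Lambda> and \<psi> :: "real^3 \<Rightarrow> real"
    assume asm: "smooth_closed_surface \<Gamma>" "surface_measure \<Gamma> ds" and ref: "reference_element Th"
      and mesh: "regular_mesh \<Gamma> Th reg_s reg_u reg_lo reg_hi reg_D h M" and h: "0 < h" and F: "F \<in> M"
      and W: "open V" "F ` Th \<subseteq> V" and K: "0 \<le> K" and \<Lambda>: "1 \<le> \<Lambda>"
      and jets: "jet_bounded (Suc q) V (F ` Th) \<psi> K \<Lambda>"
    obtain V0 where V0: "surface_element \<Gamma> ds Th F V0"
      using regular_mesh_element[OF asm ref mesh assms(2) h F] .
    interpret surface_element \<Gamma> ds Th F V0 by (rule V0)
    have Jb: "reg_lo * h^2 \<le> surf_jac F u" "surf_jac F u \<le> reg_hi * h^2" if "u \<in> Th" for u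
      using mesh F that unfolding regular_mesh_def by blast+
    have Pb: "norm (partials \<alpha> F u) \<le> A * h ^ length \<alpha>"
      if "u \<in> Th" "\<alpha> \<noteq> []" "length \<alpha> \<le> Suc (Suc (Suc q))" for \<alpha> u
    proof -
      have "norm (partials \<alpha> F u) \<le> reg_D \<alpha> * h ^ length \<alpha>" using mesh F that unfolding regular_mesh_def by blast
      also have "\<dots> \<le> A * h ^ length \<alpha>" using A(2)[OF that(3)] h by (intro mult_right_mono) auto
      finally show ?thesis .
    qed
    \<comment> \<open>An open neighbourhood of the reference element on which the Jacobian stays positive and \<open>F\<close> stays in \<open>V\<close>.\<close>
    define U where "U = (V0 \<inter> surf_jac F -` (- {0})) \<inter> (V0 \<inter> F -` V)"
    have Uo: "open U" unfolding U_def
      by (rule open_Int[OF continuous_open_preimage[OF continuous_J V(1)]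
            continuous_open_preimage[OF continuous_F V(1) W(1)]]) (simp add: open_Compl)
    have ThU: "Th \<subseteq> U" unfolding U_def using V(2) regular W(2) by auto
    have UV0: "U \<subseteq> V0" by (auto simp: U_def)
    have smU: "smooth U F" by (rule smooth_subset[OF V(3) UV0])
    have hi0: "0 \<le> reg_hi * h^2"
    proof -
      obtain u where u: "u \<in> Th" using Th(3) interior_subset by blast
      have "0 \<le> surf_jac F u" by (simp add: surf_jac_eq)
      then show ?thesis using Jb(2)[OF u] by linarith
    qed
    then have hi: "reg_hi * h^2 = \<bar>reg_hi\<bar> * h^2" using h by (simp add: zero_le_mult_iff)
    have "jet_bounded (Suc q) U {u} (\<lambda>u. surf_jac F u * \<psi> (F u)) (\<bar>reg_hi\<bar> * h^2 * K) (CL * (h * \<Lambda>))"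
      if u: "u \<in> Th" for u
    proof -
      have uU: "{u} \<subseteq> U" using ThU u by blast
      have J: "jet_bounded (Suc q) U {u} (surf_jac F) (reg_hi * h^2) (CJ * h)"
        unfolding CJ_def r_def
        by (rule jet_bounded_surf_jac[OF Uo smU _ _ h assms(2) Jb[OF u] A(1) Pb[OF u]])
          (use uU in \<open>auto simp: U_def\<close>)
      have P: "jet_bounded (Suc q) U {u} (\<lambda>u. \<psi> (F u)) K (DIM(real^3) * \<Lambda> * (A * h) + Suc q * h)"
      proof (rule jet_bounded_compose[where W = V and S' = "F ` Th" and f = F and g = \<psi>])
        show "F differentiable (at v)" if "v \<in> U" for v by (rule smooth_differentiable[OF smU that])
        show "jet_bounded (Suc q) U {u} (\<lambda>v. frechet_derivative F (at v) b) (A * h) h" if "b \<in> Basis" for b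
          by (rule jet_bounded_derivative[OF smU uU _ _ that]) (use h Pb[OF u] in auto)
        show "F ` U \<subseteq> V" by (auto simp: U_def)
      qed (use Uo uU W u jets K \<Lambda> h A(1) in auto)
      have "jet_bounded (Suc q) U {u} (\<lambda>u. surf_jac F u * \<psi> (F u)) (reg_hi * h^2 * K) (CJ * h + (DIM(real^3) * \<Lambda> * (A * h) + Suc q * h))"
        by (rule jet_bounded_mult[OF Uo uU J P]) (use CJ0 h \<Lambda> A(1) in auto)
      then show ?thesis
      proof (rule jet_bounded_mono)
        have "CJ * h + (DIM(real^3) * \<Lambda> * (A * h) + Suc q * h) = (CJ + real r) * (h * 1) + 3 * A * (h * \<Lambda>)"
          by (simp add: r_def algebra_simps)
        also have "\<dots> \<le> (CJ + real r) * (h * \<Lambda>) + 3 * A * (h * \<Lambda>)"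
          using CJ0 h \<Lambda> by (intro add_right_mono mult_left_mono) auto
        finally show "CJ * h + (DIM(real^3) * \<Lambda> * (A * h) + Suc q * h) \<le> CL * (h * \<Lambda>)"
          by (simp add: CL_def algebra_simps)
        show "0 \<le> CJ * h + (DIM(real^3) * \<Lambda> * (A * h) + Suc q * h)" using CJ0 h \<Lambda> A(1) by simp
      qed (use hi Uo uU in auto)
    qed
    then have g: "jet_bounded (Suc q) U Th (\<lambda>u. surf_jac F u * \<psi> (F u)) (\<bar>reg_hi\<bar> * h^2 * K) (CL * (h * \<Lambda>))"
      by (rule jet_bounded_pointwise) (use Th(3) interior_subset[of Th] in auto)
    have "\<bar>element_error Th NQ xq w F \<psi>\<bar>
      \<le> 2 * measure lborel Th * (2 * diameter Th) ^ Suc q * (\<bar>reg_hi\<bar> * h^2 * K * (CL * (h * \<Lambda>)) ^ Suc q)"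
      unfolding element_error_def
      by (rule quadrature_error_reference_element[OF assms(1) ref Uo ThU g]) (use K CL0 h \<Lambda> in auto)
    also have "\<dots> = C0 * (h^2 * K * (h * \<Lambda>) ^ Suc q)"
      by (simp only: C0_def power_mult_distrib mult_ac)
    also have "\<dots> \<le> \<bar>C0\<bar> * (h^2 * K * (h * \<Lambda>) ^ Suc q)"
      using K h \<Lambda> by (intro mult_right_mono) auto
    finally show "\<bar>element_error Th NQ xq w F \<psi>\<bar> \<le> \<bar>C0\<bar> * (h^2 * K * (h * \<Lambda>) ^ Suc q)" .
  qed simp
qed

text \<open>An element has area \<open>O(h\<^sup>2)\<close>, and so has the sum of its quadrature weights, which are positive.\<close>

lemma element_quadrature_trivial_bound:
  assumes "quadrature_rule Th q NQ xq w"
    "smooth_closed_surface \<Gamma>" "surface_measure \<Gamma> ds" "reference_element Th"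
    "regular_mesh \<Gamma> Th reg_s reg_u reg_lo reg_hi reg_D h M" "0 < reg_lo" "0 < h" "F \<in> M"
    "continuous_on (F ` Th) \<psi>" "\<And>y. y \<in> F ` Th \<Longrightarrow> \<bar>\<psi> y\<bar> \<le> b"
  shows "\<bar>element_error Th NQ xq w F \<psi>\<bar> \<le> 2 * measure lborel Th * (reg_hi * h^2 * b)"
proof -
  obtain V0 where V0: "surface_element \<Gamma> ds Th F V0"
    using regular_mesh_element[OF assms(2-8)] .
  interpret surface_element \<Gamma> ds Th F V0 by (rule V0)
  let ?g = "\<lambda>u. surf_jac F u * \<psi> (F u)" and ?B = "reg_hi * h^2 * b"
  have J: "surf_jac F u \<le> reg_hi * h^2" if "u \<in> Th" for u
    using assms(5,8) that unfolding regular_mesh_def by blast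
  have J0: "0 \<le> surf_jac F u" for u by (simp add: surf_jac_eq)
  have g: "\<bar>?g u\<bar> \<le> ?B" if "u \<in> Th" for u
    unfolding abs_mult
    by (rule mult_mono) (use that J J0 assms(10) order_trans[OF J0 J[OF that]] in auto)
  have c: "continuous_on Th ?g"
    by (intro continuous_on_mult continuous_on_subset[OF continuous_J V(2)]
        continuous_on_compose2[OF assms(9)] continuous_on_subset[OF continuous_F V(2)] order_refl)
  have int: "set_integrable lborel Th f" if "continuous_on Th f" for f :: "real^2 \<Rightarrow> real"
    using borel_integrable_compact[OF Th(1) that] by (simp add: set_integrable_def)
  have "norm (LINT u:Th|lborel. ?g u) \<le> (LINT u:Th|lborel. norm (?g u))"
    by (rule set_integral_norm_bound) (rule int[OF c])
  also have "\<dots> \<le> (LINT u:Th|lborel. ?B)"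
    by (rule set_integral_mono) (use g c in \<open>auto intro!: int continuous_intros\<close>)
  also have "\<dots> = ?B * measure lborel Th" by (simp add: set_lebesgue_integral_def)
  finally have 1: "\<bar>LINT u:Th|lborel. ?g u\<bar> \<le> ?B * measure lborel Th" by simp
  have q: "0 < w l" "xq l \<in> Th" if "l \<in> {1..NQ}" for l
    using assms(1) that by (auto simp: quadrature_rule_def)
  have "\<bar>\<Sum>j=1..NQ. w j * ?g (xq j)\<bar> \<le> (\<Sum>j=1..NQ. w j * ?B)"
  proof (rule sum_abs[THEN order_trans], rule sum_mono)
    fix l assume l: "l \<in> {1..NQ}"
    show "\<bar>w l * ?g (xq l)\<bar> \<le> w l * ?B"
      unfolding abs_mult[of "w l"] using q[OF l] g[OF q(2)[OF l]] by (auto intro!: mult_mono)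
  qed
  also have "\<dots> = (\<Sum>l=1..NQ. w l) * ?B" by (rule sum_distrib_right[symmetric])
  also have "\<dots> = ?B * measure lborel Th"
    unfolding quadrature_weights_sum[OF assms(1) Th(1)] by (rule mult.commute)
  finally have 2: "\<bar>\<Sum>j=1..NQ. w j * ?g (xq j)\<bar> \<le> ?B * measure lborel Th" .
  have "\<bar>(LINT u:Th|lborel. ?g u) - (\<Sum>j=1..NQ. w j * ?g (xq j))\<bar> \<le> 2 * (?B * measure lborel Th)"
    using 1 2 by linarith
  then show ?thesis unfolding element_error_def by (simp only: mult_ac)
qed

section \<open>Quadrature over a mesh\<close>

lemma regular_mesh_dist_le:
  assumes "regular_mesh \<Gamma> Th reg_s reg_u reg_lo reg_hi reg_D h M" "compact \<Gamma>" "F \<in> M" "u \<in> Th" "v \<in> Th"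
  shows "dist (F u) (F v) \<le> h"
proof -
  have t: "tessellation \<Gamma> Th M" and h: "h = mesh_size Th M" using assms(1) by (auto simp: regular_mesh_def)
  have fin: "finite M" and sub: "F ` Th \<subseteq> \<Gamma>" using t assms(3) by (auto simp: tessellation_def)
  have "bounded (F ` Th)" using bounded_subset[OF compact_imp_bounded[OF assms(2)] sub] .
  then have "dist (F u) (F v) \<le> diameter (F ` Th)" by (rule diameter_bounded_bound) (use assms in auto)
  also have "\<dots> \<le> h" unfolding h mesh_size_def using fin assms(3) by (intro Max_ge) auto
  finally show ?thesis .
qed

lemma regular_mesh_size_le:
  assumes "regular_mesh \<Gamma> Th reg_s reg_u reg_lo reg_hi reg_D h M" "compact \<Gamma>" "\<Gamma> \<noteq> {}"
  shows "h \<le> diameter \<Gamma>"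
proof -
  have t: "tessellation \<Gamma> Th M" and h: "h = mesh_size Th M" using assms(1) by (auto simp: regular_mesh_def)
  have "finite M" "M \<noteq> {}" using t assms(3) by (auto simp: tessellation_def)
  moreover have "diameter (F ` Th) \<le> diameter \<Gamma>" if "F \<in> M" for F
  proof (rule diameter_subset[OF _ compact_imp_bounded[OF assms(2)]])
    show "F ` Th \<subseteq> \<Gamma>" using t that by (auto simp: tessellation_def)
  qed
  ultimately show ?thesis unfolding h mesh_size_def by (subst Max_le_iff) auto
qed

text \<open>These elements lie in a ball of radius \<open>2h\<close>, of area \<open>O(h\<^sup>2)\<close>, are disjoint, and each has area at least a
multiple of \<open>h\<^sup>2\<close>.\<close>

lemma near_elements_card:
  assumes "smooth_closed_surface \<Gamma>" "surface_measure \<Gamma> ds" "reference_element Th"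
    "regular_mesh \<Gamma> Th reg_s reg_u reg_lo reg_hi reg_D h M" "0 < reg_lo" "0 < h" "M' \<subseteq> M"
    "\<And>R. 0 \<le> R \<Longrightarrow> emeasure ds (\<Gamma> \<inter> cball x R) \<le> ennreal (C * R^2)" "0 \<le> C"
    "\<And>F. F \<in> M' \<Longrightarrow> \<exists>u\<in>Th. dist x (F u) \<le> h"
  shows "reg_lo * measure lborel Th * real (card M') \<le> 4 * C"
proof -
  have cp: "compact \<Gamma>" using assms(1) by (simp add: smooth_closed_surface_def)
  let ?B = "\<Gamma> \<inter> cball x (2 * h)"
  have B: "?B \<in> sets ds" by (rule surface_measure_cball_sets[OF assms(2,1)])
  have "ennreal (reg_lo * measure lborel Th * h^2 * (\<Sum>F\<in>M'. 1)) \<le> (\<integral>\<^sup>+y. ennreal (indicator ?B y) \<partial>ds)"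
  proof (rule regular_mesh_sum_le_integral[OF assms(1-7)])
    show "(indicator ?B :: _ \<Rightarrow> real) \<in> borel_measurable ds" using B by measurable
    fix F u assume F: "F \<in> M'" and u: "u \<in> Th"
    obtain v where v: "v \<in> Th" "dist x (F v) \<le> h" using assms(10)[OF F] by blast
    have "dist (F v) (F u) \<le> h" using regular_mesh_dist_le[OF assms(4) cp _ v(1) u] F assms(7) by blast
    then have "dist x (F u) \<le> 2 * h" using v(2) dist_triangle[of x "F u" "F v"] by linarith
    moreover have "F u \<in> \<Gamma>" using assms(4,7) F u unfolding regular_mesh_def tessellation_def by blast
    ultimately show "1 \<le> (indicator ?B (F u) :: real)" by simp
  qed auto
  also have "\<dots> = emeasure ds ?B" using B by (simp add: ennreal_indicator)
  also have "\<dots> \<le> ennreal (C * (2 * h)^2)" by (rule assms(8)) (use assms(6) in simp)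
  finally have "reg_lo * measure lborel Th * h^2 * (\<Sum>F\<in>M'. 1) \<le> C * (2 * h)^2"
    using assms(9) by (subst (asm) ennreal_le_iff) auto
  then have "h^2 * (reg_lo * measure lborel Th * real (card M')) \<le> h^2 * (4 * C)"
    by (simp add: power_mult_distrib mult_ac)
  then show ?thesis using assms(6) by (subst (asm) mult_le_cancel_left_pos) auto
qed

definition mesh_error ::
    "(real^3) measure \<Rightarrow> nat \<Rightarrow> (nat \<Rightarrow> real^2) \<Rightarrow> (nat \<Rightarrow> real) \<Rightarrow> (real^2 \<Rightarrow> real^3) set \<Rightarrow> (real^3 \<Rightarrow> real) \<Rightarrow> real" where
  "mesh_error ds NQ xq w M \<psi> =
     (LINT y|ds. \<psi> y) - (\<Sum>F\<in>M. \<Sum>j=1..NQ. w j * (surf_jac F (xq j) * \<psi> (F (xq j))))"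

text \<open>Elements are called near if \<open>h > \<delta>\<close> and they meet the ball of radius \<open>h\<close> around \<open>x\<close>. On all others the weight
\<open>1 + |x-y|/\<delta>\<close> varies by a factor of at most two, and the sum of the element errors is dominated by the
integral of the weight to the power \<open>-1\<close> or \<open>-3\<close>. The near elements are boundedly many and are estimated by
the supremum \<open>Z\<close>.\<close>

lemma mesh_quadrature_error:
  assumes "smooth_closed_surface \<Gamma>" "surface_measure \<Gamma> ds"
    "reference_element Th" "quadrature_rule Th q NQ xq w" "0 < reg_lo"
  shows "\<exists>C\<ge>0. \<forall>h M \<delta> x V \<psi> K L d Z.
    regular_mesh \<Gamma> Th reg_s reg_u reg_lo reg_hi reg_D h M \<and> 0 < h \<and> 0 < \<delta> \<and> x \<in> \<Gamma> \<and>
    open V \<and> \<Gamma> \<subseteq> V \<and> d \<le> 2 \<and> 0 \<le> K \<and> 0 \<le> L \<and> kernel_bound (Suc q) V \<Gamma> \<psi> x \<delta> d K L Z \<longrightarrow>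
    \<bar>mesh_error ds NQ xq w M \<psi>\<bar>
      \<le> C * (K * (L * h / \<delta>) ^ Suc q * (if d = 0 then \<delta> else \<delta>^2) + (if h \<le> \<delta> then 0 else h^2 * Z))"
proof -
  have cp: "compact \<Gamma>" using assms(1) by (simp add: smooth_closed_surface_def)
  obtain C1 where C1: "0 \<le> C1" "\<forall>\<Gamma> ds h M F V \<psi> K \<Lambda>.
    smooth_closed_surface \<Gamma> \<and> surface_measure \<Gamma> ds \<and> reference_element Th \<and>
    regular_mesh \<Gamma> Th reg_s reg_u reg_lo reg_hi reg_D h M \<and> 0 < h \<and> F \<in> M \<and> open V \<and> F ` Th \<subseteq> V \<and>
    0 \<le> K \<and> 1 \<le> \<Lambda> \<and> jet_bounded (Suc q) V (F ` Th) \<psi> K \<Lambda> \<longrightarrow>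
    \<bar>element_error Th NQ xq w F \<psi>\<bar> \<le> C1 * (h^2 * K * (h * \<Lambda>) ^ Suc q)"
    using element_quadrature_error[OF assms(4,5), of reg_s reg_u reg_hi reg_D] by blast
  obtain C2 where C2: "0 \<le> C2" "\<And>x R. 0 \<le> R \<Longrightarrow> emeasure ds (\<Gamma> \<inter> cball x R) \<le> ennreal (C2 * R^2)"
    using surface_measure_ball[OF assms(2,1)] by blast
  obtain C3 where C3: "0 \<le> C3" "\<And>x \<delta>. 0 < \<delta> \<Longrightarrow> (\<integral>\<^sup>+y. ennreal (inverse ((1 + dist x y / \<delta>) ^ 3)) \<partial>ds) \<le> ennreal (C3 * \<delta>^2)"
    using surface_integral_decay_cubic[OF assms(1,2)] by blast
  obtain C4 where C4: "0 \<le> C4" "\<And>x \<delta>. x \<in> \<Gamma> \<Longrightarrow> 0 < \<delta> \<Longrightarrow> (\<integral>\<^sup>+y. ennreal (inverse (1 + dist x y / \<delta>)) \<partial>ds) \<le> ennreal (C4 * \<delta>)"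
    using surface_integral_decay_linear[OF assms(1,2)] by blast
  define C5 where "C5 = C3 + C4"
  define m where "m = reg_lo * measure lborel Th"
  define G where "G = C1 * 2 ^ (q + 5) * (8 * C5 / m)"
  define N where "N = 4 * C2 / m * (2 * measure lborel Th * \<bar>reg_hi\<bar>)"
  show ?thesis
  proof (intro exI[of _ "\<bar>G\<bar> + \<bar>N\<bar>"] conjI allI impI; (elim conjE)?)
    fix h M \<delta> x V K L d Z and \<psi> :: "real^3 \<Rightarrow> real"
    assume mesh: "regular_mesh \<Gamma> Th reg_s reg_u reg_lo reg_hi reg_D h M" and h: "0 < h" and \<delta>: "0 < \<delta>" and x: "x \<in> \<Gamma>"
      and V: "open V" "\<Gamma> \<subseteq> V" and d: "d \<le> 2" and K: "0 \<le> K" and L: "0 \<le> L"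
      and kb: "kernel_bound (Suc q) V \<Gamma> \<psi> x \<delta> d K L Z"
    from kb have jets: "jet_bounded (Suc q) V {y} \<psi> (K * inverse (1 + dist x y / \<delta>) ^ (2 * d)) (L * inverse (\<delta> * (1 + dist x y / \<delta>)))"
      and ge: "1 \<le> L * inverse (\<delta> * (1 + dist x y / \<delta>))" and Z: "\<bar>\<psi> y\<bar> \<le> Z" if "y \<in> \<Gamma>" for y
      using that by (auto simp: kernel_bound_def simp del: jet_bounded.simps)
    have Mel: "\<exists>V. surface_element \<Gamma> ds Th F V" if "F \<in> M" for F
      using regular_mesh_element[OF assms(1-3) mesh assms(5) h that] by blast
    have fin: "finite M" using mesh by (simp add: regular_mesh_def tessellation_def)
    have sub: "F ` Th \<subseteq> \<Gamma>" if "F \<in> M" for F using mesh that by (auto simp: regular_mesh_def tessellation_def)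
    have "M \<noteq> {}" using mesh x by (auto simp: regular_mesh_def tessellation_def)
    then obtain F0 V0 where "surface_element \<Gamma> ds Th F0 V0" using Mel by blast
    then have Tp: "0 < measure lborel Th" by (rule surface_element.measure_reference_pos)
    then have m: "0 < m" using assms(5) by (simp add: m_def)
    obtain u0 where u0: "u0 \<in> Th" using assms(3) interior_subset[of Th] by (auto simp: reference_element_def)
    have cont: "continuous_on \<Gamma> \<psi>"
    proof (rule continuous_at_imp_continuous_on, rule ballI)
      fix y assume y: "y \<in> \<Gamma>"
      have "\<psi> differentiable (at y)" by (rule jet_bounded_differentiable[OF jets[OF y]]) (use V y in auto)
      then show "isCont \<psi> y" by (rule differentiable_imp_continuous_within)
    qed
    define e where "e = (\<lambda>F. element_error Th NQ xq w F \<psi>)"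
    define \<tau> where "\<tau> = (\<lambda>y. dist x y / \<delta>)"
    have \<tau>0: "0 \<le> \<tau> y" for y using \<delta> by (simp add: \<tau>_def)
    define near where "near = {F \<in> M. \<delta> < h \<and> (\<exists>u\<in>Th. dist x (F u) \<le> h)}"
    \<comment> \<open>The decay available for every \<open>q\<close>: the element errors decay with the exponent \<open>2d + q + 1\<close>.\<close>
    define \<beta> :: nat where "\<beta> = (if d = 0 then 1 else 3)"
    define fac where "fac = (if d = 0 then \<delta> else \<delta>^2)"
    define a where "a = (\<lambda>F. inverse (1 + \<tau> (F u0)))"
    have a: "0 < a F" "a F \<le> 1" for F using \<tau>0[of "F u0"] by (auto simp: a_def inverse_le_1_iff)
    have good: "\<bar>e F\<bar> \<le> C1 * 2 ^ (q + 5) * (h^2 * K * (L * h / \<delta>) ^ Suc q * a F ^ \<beta>)"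
      and cmp: "\<And>u. u \<in> Th \<Longrightarrow> (a F / 2) ^ \<beta> \<le> inverse ((1 + \<tau> (F u)) ^ \<beta>)" if F: "F \<in> M - near" for F
    proof -
      have FM: "F \<in> M" using F by simp
      have two: "1 + \<tau> (F v) \<le> 2 * (1 + \<tau> (F u))" if u: "u \<in> Th" and v: "v \<in> Th" for u v
      proof -
        have "dist x (F v) \<le> dist x (F u) + h"
          using dist_triangle[of x "F v" "F u"] regular_mesh_dist_le[OF mesh cp FM u v] by linarith
        moreover have "h \<le> \<delta> \<or> h \<le> dist x (F u)" using F u by (auto simp: near_def)
        ultimately have "dist x (F v) \<le> \<delta> + 2 * dist x (F u)" using \<delta> zero_le_dist[of x "F u"] by linarith
        then have "\<tau> (F v) \<le> 1 + 2 * \<tau> (F u)" using \<delta> by (simp add: \<tau>_def divide_simps)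
        then show ?thesis by simp
      qed
      have i1: "inverse (1 + \<tau> (F u)) \<le> 2 * a F" if "u \<in> Th" for u
        using two[OF that u0] \<tau>0[of "F u"] \<tau>0[of "F u0"] by (simp add: a_def divide_simps)
      have i2: "a F / 2 \<le> inverse (1 + \<tau> (F u))" if "u \<in> Th" for u
        using two[OF u0 that] \<tau>0[of "F u"] \<tau>0[of "F u0"] by (simp add: a_def divide_simps)
      show "(a F / 2) ^ \<beta> \<le> inverse ((1 + \<tau> (F u)) ^ \<beta>)" if "u \<in> Th" for u
        using power_mono[OF i2[OF that], of \<beta>] a(1)[of F] by (simp add: power_inverse)
      let ?K = "K * (2 * a F) ^ (2 * d)" and ?L = "L * (2 * a F) / \<delta>"
      have jT: "jet_bounded (Suc q) V (F ` Th) \<psi> ?K ?L"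
      proof (rule jet_bounded_pointwise)
        fix y assume "y \<in> F ` Th"
        then obtain u where u: "u \<in> Th" "y = F u" by blast
        have y: "y \<in> \<Gamma>" using sub[OF FM] u by blast
        show "jet_bounded (Suc q) V {y} \<psi> ?K ?L"
        proof (rule jet_bounded_mono[OF jets[OF y]])
          show "K * inverse (1 + dist x y / \<delta>) ^ (2 * d) \<le> ?K"
            using i1[OF u(1)] \<tau>0[of "F u"] K unfolding u(2) \<tau>_def[symmetric, of]
            by (intro mult_left_mono power_mono) (auto simp: \<tau>_def)
          have "L * inverse (\<delta> * (1 + dist x y / \<delta>)) = L / \<delta> * inverse (1 + \<tau> (F u))"
            by (simp add: u(2) \<tau>_def divide_inverse mult_ac)
          also have "\<dots> \<le> L / \<delta> * (2 * a F)" using i1[OF u(1)] L \<delta> by (intro mult_left_mono) auto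
          finally show "L * inverse (\<delta> * (1 + dist x y / \<delta>)) \<le> ?L" by simp
          show "0 \<le> L * inverse (\<delta> * (1 + dist x y / \<delta>))" using ge[OF y] by linarith
        qed (use V y in auto)
      qed (use u0 in auto)
      have L1: "1 \<le> ?L"
      proof -
        have y: "F u0 \<in> \<Gamma>" using sub[OF FM] u0 by blast
        have "L * inverse (\<delta> * (1 + dist x (F u0) / \<delta>)) = L * a F / \<delta>"
          by (simp add: a_def \<tau>_def divide_inverse mult_ac)
        then have "1 \<le> L * a F / \<delta>" using ge[OF y] by simp
        moreover have "L * a F / \<delta> \<le> ?L" using L a(1)[of F] \<delta> by (intro divide_right_mono mult_left_mono) auto
        ultimately show ?thesis by (rule order_trans)
      qed
      have K0: "0 \<le> ?K" using K a(1)[of F] by simp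
      have FV: "F ` Th \<subseteq> V" using sub[OF FM] V(2) by blast
      have "\<bar>e F\<bar> \<le> C1 * (h^2 * ?K * (h * ?L) ^ Suc q)"
        unfolding e_def
        by (rule C1(2)[rule_format, where \<psi> = \<psi> and F = F and \<Gamma> = \<Gamma> and ds = ds and V = V and M = M])
          (intro conjI assms(1-3) mesh h FM V(1) FV K0 L1 jT)
      also have "h^2 * ?K * (h * ?L) ^ Suc q = h^2 * K * (L * h / \<delta>) ^ Suc q * (2 * a F) ^ (2 * d + Suc q)"
      proof -
        have "h * ?L = (L * h / \<delta>) * (2 * a F)" by simp
        then have "(h * ?L) ^ Suc q = (L * h / \<delta>) ^ Suc q * (2 * a F) ^ Suc q" by (simp only: power_mult_distrib)
        then show ?thesis by (simp only: power_add mult_ac)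
      qed
      also have "C1 * (h^2 * K * (L * h / \<delta>) ^ Suc q * (2 * a F) ^ (2 * d + Suc q))
          \<le> C1 * (h^2 * K * (L * h / \<delta>) ^ Suc q * (2 ^ (q + 5) * a F ^ \<beta>))"
      proof (intro mult_left_mono)
        have "(2 * a F) ^ (2 * d + Suc q) = 2 ^ (2 * d + Suc q) * a F ^ (2 * d + Suc q)" by (rule power_mult_distrib)
        also have "\<dots> \<le> 2 ^ (q + 5) * a F ^ \<beta>"
          using d a[of F] by (intro mult_mono power_increasing power_decreasing) (auto simp: \<beta>_def)
        finally show "(2 * a F) ^ (2 * d + Suc q) \<le> 2 ^ (q + 5) * a F ^ \<beta>" .
      qed (use C1(1) K L h \<delta> in auto)
      finally show "\<bar>e F\<bar> \<le> C1 * 2 ^ (q + 5) * (h^2 * K * (L * h / \<delta>) ^ Suc q * a F ^ \<beta>)"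
        by (simp only: mult_ac)
    qed
    have sum_good: "m * h^2 * (\<Sum>F\<in>M - near. (a F / 2) ^ \<beta>) \<le> C5 * fac"
    proof -
      have "ennreal (reg_lo * measure lborel Th * h^2 * (\<Sum>F\<in>M - near. (a F / 2) ^ \<beta>)) \<le>
          (\<integral>\<^sup>+y. ennreal (inverse ((1 + \<tau> y) ^ \<beta>)) \<partial>ds)"
      proof (rule regular_mesh_sum_le_integral[OF assms(1-3) mesh assms(5) h])
        have nz: "1 + \<tau> y \<noteq> 0" for y using \<tau>0[of y] by linarith
        have "continuous_on \<Gamma> (\<lambda>y. inverse ((1 + \<tau> y) ^ \<beta>))"
          unfolding \<tau>_def by (intro continuous_intros) (use \<delta> nz[unfolded \<tau>_def] in auto)
        then show "(\<lambda>y. inverse ((1 + \<tau> y) ^ \<beta>)) \<in> borel_measurable ds"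
          by (rule continuous_on_surface_measurable[OF assms(1,2)])
      qed (use a cmp in \<open>auto simp: less_imp_le\<close>)
      also have "\<dots> \<le> ennreal (C5 * fac)"
      proof (cases "d = 0")
        case True
        have "(\<integral>\<^sup>+y. ennreal (inverse ((1 + \<tau> y) ^ \<beta>)) \<partial>ds) \<le> ennreal (C4 * \<delta>)"
          using C4(2)[OF x \<delta>] True by (simp add: \<beta>_def \<tau>_def)
        also have "\<dots> \<le> ennreal (C5 * fac)"
          using True C3(1) \<delta> by (intro ennreal_leI) (simp add: C5_def fac_def)
        finally show ?thesis .
      next
        case False
        have "(\<integral>\<^sup>+y. ennreal (inverse ((1 + \<tau> y) ^ \<beta>)) \<partial>ds) \<le> ennreal (C3 * \<delta>^2)"
          using C3(2)[OF \<delta>] False by (simp add: \<beta>_def \<tau>_def)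
        also have "\<dots> \<le> ennreal (C5 * fac)"
          using False C4(1) \<delta> by (intro ennreal_leI) (simp add: C5_def fac_def)
        finally show ?thesis .
      qed
      finally show ?thesis unfolding m_def using C3(1) C4(1) \<delta>
        by (subst (asm) ennreal_le_iff) (auto simp: C5_def fac_def)
    qed
    have good_sum: "(\<Sum>F\<in>M - near. \<bar>e F\<bar>) \<le> G * (K * (L * h / \<delta>) ^ Suc q * fac)"
    proof -
      have "2 ^ \<beta> \<le> (8::real)" by (simp add: \<beta>_def)
      then have ab: "a F ^ \<beta> \<le> 8 * (a F / 2) ^ \<beta>" for F
        using mult_right_mono[of "2 ^ \<beta>" "8::real" "(a F / 2) ^ \<beta>"] a(1)[of F] by (simp add: power_divide)
      have "m * (h^2 * (\<Sum>F\<in>M - near. a F ^ \<beta>)) \<le> m * (h^2 * (\<Sum>F\<in>M - near. 8 * (a F / 2) ^ \<beta>))"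
        using m by (intro mult_left_mono sum_mono ab) auto
      also have "\<dots> = 8 * (m * h^2 * (\<Sum>F\<in>M - near. (a F / 2) ^ \<beta>))"
        by (simp only: sum_distrib_left[symmetric] mult_ac)
      also have "\<dots> \<le> 8 * (C5 * fac)" using sum_good by simp
      finally have hs: "h^2 * (\<Sum>F\<in>M - near. a F ^ \<beta>) \<le> 8 * C5 / m * fac" using m by (simp add: field_simps)
      have "(\<Sum>F\<in>M - near. \<bar>e F\<bar>) \<le> (\<Sum>F\<in>M - near. C1 * 2 ^ (q + 5) * (h^2 * K * (L * h / \<delta>) ^ Suc q * a F ^ \<beta>))"
        by (rule sum_mono[OF good])
      also have "\<dots> = C1 * 2 ^ (q + 5) * (K * (L * h / \<delta>) ^ Suc q) * (h^2 * (\<Sum>F\<in>M - near. a F ^ \<beta>))"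
        by (simp only: sum_distrib_left mult_ac)
      also have "\<dots> \<le> C1 * 2 ^ (q + 5) * (K * (L * h / \<delta>) ^ Suc q) * (8 * C5 / m * fac)"
        by (rule mult_left_mono[OF hs]) (use C1(1) K L h \<delta> in auto)
      also have "\<dots> = G * (K * (L * h / \<delta>) ^ Suc q * fac)" by (simp only: G_def mult_ac)
      finally show ?thesis .
    qed
    have near_sum: "(\<Sum>F\<in>near. \<bar>e F\<bar>) \<le> N * (if h \<le> \<delta> then 0 else h^2 * Z)"
    proof (cases "h \<le> \<delta>")
      case True
      then have "near = {}" by (auto simp: near_def)
      then show ?thesis using True by simp
    next
      case False
      have Z0: "0 \<le> Z" using Z[OF x] by linarith
      have nM: "near \<subseteq> M" by (auto simp: near_def)
      have "m * real (card near) \<le> 4 * C2"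
        unfolding m_def by (rule near_elements_card[OF assms(1-3) mesh assms(5) h nM C2(2) C2(1)]) (auto simp: near_def)
      then have card: "real (card near) \<le> 4 * C2 / m" using m by (simp add: field_simps)
      have "\<bar>e F\<bar> \<le> 2 * measure lborel Th * \<bar>reg_hi\<bar> * (h^2 * Z)" if "F \<in> near" for F
      proof -
        have FM: "F \<in> M" using that nM by blast
        have "\<bar>e F\<bar> \<le> 2 * measure lborel Th * (reg_hi * h^2 * Z)"
          unfolding e_def
          by (rule element_quadrature_trivial_bound[OF assms(4,1,2,3) mesh assms(5) h FM continuous_on_subset[OF cont sub[OF FM]]])
            (use Z sub[OF FM] in blast)
        also have "\<dots> \<le> 2 * measure lborel Th * (\<bar>reg_hi\<bar> * h^2 * Z)"
          using Z0 Tp by (intro mult_left_mono mult_right_mono) auto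
        finally show ?thesis by (simp only: mult_ac)
      qed
      then have "(\<Sum>F\<in>near. \<bar>e F\<bar>) \<le> (\<Sum>F\<in>near. 2 * measure lborel Th * \<bar>reg_hi\<bar> * (h^2 * Z))" by (rule sum_mono)
      also have "\<dots> = real (card near) * (2 * measure lborel Th * \<bar>reg_hi\<bar> * (h^2 * Z))" by simp
      also have "\<dots> \<le> 4 * C2 / m * (2 * measure lborel Th * \<bar>reg_hi\<bar> * (h^2 * Z))"
        by (rule mult_right_mono[OF card]) (use Z0 Tp in auto)
      also have "\<dots> = N * (h^2 * Z)" by (simp only: N_def mult_ac)
      finally show ?thesis using False by simp
    qed
    have "mesh_error ds NQ xq w M \<psi> = (\<Sum>F\<in>M. e F)"
      unfolding mesh_error_def integral_regular_mesh[OF assms(1-3) mesh assms(5) h cont] e_def element_error_def by (rule sum_subtractf[symmetric])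
    also have "\<bar>\<dots>\<bar> \<le> (\<Sum>F\<in>M. \<bar>e F\<bar>)" by (rule sum_abs)
    also have "\<dots> = (\<Sum>F\<in>M - near. \<bar>e F\<bar>) + (\<Sum>F\<in>near. \<bar>e F\<bar>)"
      by (rule sum.subset_diff[OF _ fin]) (auto simp: near_def)
    also have "\<dots> \<le> G * (K * (L * h / \<delta>) ^ Suc q * fac) + N * (if h \<le> \<delta> then 0 else h^2 * Z)"
      by (rule add_mono[OF good_sum near_sum])
    also have "\<dots> \<le> (\<bar>G\<bar> + \<bar>N\<bar>) * (K * (L * h / \<delta>) ^ Suc q * fac) + (\<bar>G\<bar> + \<bar>N\<bar>) * (if h \<le> \<delta> then 0 else h^2 * Z)"
    proof -
      have "0 \<le> Z" using Z[OF x] by linarith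
      then show ?thesis using K L h \<delta> by (intro add_mono mult_right_mono) (auto simp: fac_def)
    qed
    finally show "\<bar>mesh_error ds NQ xq w M \<psi>\<bar> \<le> (\<bar>G\<bar> + \<bar>N\<bar>) *
        (K * (L * h / \<delta>) ^ Suc q * (if d = 0 then \<delta> else \<delta>^2) + (if h \<le> \<delta> then 0 else h^2 * Z))"
      unfolding fac_def by (simp only: distrib_left)
  qed simp
qed

section \<open>The discretization error\<close>

lemma disc_rate_eq:
  assumes "0 < \<delta>"
  shows "disc_rate q (op_p B) (op_s B) h \<delta> = inverse (\<delta> ^ op_order B) * (h / \<delta>) ^ Suc q *
    (if op_p B - op_s B = 0 then \<delta> else \<delta>^2)"
proof -
  have p: "\<delta> powr - real n = inverse (\<delta> ^ n)" for n using assms by (simp add: powr_minus powr_realpow)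
  have ps: "op_p B - op_s B = 0 \<longleftrightarrow> op_p B = op_s B" by (cases B) auto
  show ?thesis
  proof (cases "op_p B = op_s B")
    case True
    have "op_order B = 1" using True by (simp add: op_order_def)
    moreover have "disc_rate q (op_p B) (op_s B) h \<delta> = h ^ (q + 1) * inverse (\<delta> ^ (q + 1))"
      using True p[of "q + 1"] unfolding disc_rate_def by (simp only: of_nat_add of_nat_1 if_True simp_thms)
    ultimately show ?thesis using True ps assms by (simp add: field_simps)
  next
    case False
    define d where "d = op_p B - op_s B"
    have d: "real (op_p B) - real (op_s B) = real d" by (cases B) (auto simp: d_def)
    have "disc_rate q (op_p B) (op_s B) h \<delta> = h ^ (q + 1) * inverse (\<delta> ^ (q + 2 * d))"
      using False p[of "q + 2 * d"] unfolding disc_rate_def d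
      by (simp only: of_nat_add of_nat_mult of_nat_numeral if_False)
    moreover have "op_order B = 2 * d + 1" by (simp add: op_order_def d_def)
    moreover have "d \<noteq> 0" using False ps by (simp add: d_def)
    ultimately show ?thesis unfolding d_def[symmetric] using assms
      by (simp add: power_add power_divide power2_eq_square divide_simps mult_ac)
  qed
qed

text \<open>For \<open>h > \<delta>\<close> the rate contains a power of \<open>h/\<delta> \<ge> 1\<close>. For the hypersingular operator this power is
\<open>q - 1\<close>, which is why \<open>q = 0\<close> has to be excluded.\<close>

lemma singular_order_rate_le:
  assumes "0 < \<delta>" "\<delta> < h" "h \<le> D" "1 \<le> D" "B = HS \<Longrightarrow> q \<noteq> 0"
  shows "h^2 * inverse (\<delta> ^ singular_order B) \<le> D * disc_rate q (op_p B) (op_s B) h \<delta>"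
proof -
  have h: "0 < h" using assms by simp
  have r: "1 \<le> h / \<delta>" using assms by simp
  define d where "d = op_p B - op_s B"
  have D: "disc_rate q (op_p B) (op_s B) h \<delta> = inverse (\<delta> ^ (2 * d + 1)) * (h / \<delta>) ^ Suc q * (if d = 0 then \<delta> else \<delta>^2)"
    using disc_rate_eq[OF assms(1), of q B h] by (simp add: op_order_def d_def)
  consider "B = SL" | "B = HS" | "B \<noteq> SL" "B \<noteq> HS" by blast
  then show ?thesis
  proof cases
    case 1
    have "d = 0" "singular_order B = 1" using 1 by (auto simp: d_def singular_order_def op_order_def)
    then have "D * disc_rate q (op_p B) (op_s B) h \<delta> = D * (h / \<delta>) * (h / \<delta>) ^ q"
      using D assms(1) by (simp add: divide_inverse mult_ac)
    moreover have "h^2 * inverse (\<delta> ^ singular_order B) = h * (h / \<delta>) * 1"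
      using \<open>singular_order B = 1\<close> by (simp add: power2_eq_square divide_inverse)
    moreover have "h * (h / \<delta>) * 1 \<le> D * (h / \<delta>) * (h / \<delta>) ^ q"
      using assms h r by (intro mult_mono one_le_power) auto
    ultimately show ?thesis by simp
  next
    case 2
    obtain q' where q': "q = Suc q'" using assms(5)[OF 2] by (cases q) auto
    have "d = 1" "singular_order B = 3" using 2 by (auto simp: d_def singular_order_def op_order_def)
    then have "D * disc_rate q (op_p B) (op_s B) h \<delta> = D * (h^2 * inverse (\<delta> ^ 3)) * (h / \<delta>) ^ q'"
      using D assms(1) q' by (simp add: eval_nat_numeral field_simps)
    moreover have "1 * (h^2 * inverse (\<delta> ^ 3)) * 1 \<le> D * (h^2 * inverse (\<delta> ^ 3)) * (h / \<delta>) ^ q'"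
      using assms h r by (intro mult_mono one_le_power) auto
    ultimately show ?thesis unfolding \<open>singular_order B = 3\<close> by linarith
  next
    case 3
    have d: "d \<noteq> 0" "singular_order B = 2 * d" using 3 by (cases B; simp add: d_def singular_order_def op_order_def)+
    then have "D * disc_rate q (op_p B) (op_s B) h \<delta> = D * (h * inverse (\<delta> ^ (2 * d))) * (h / \<delta>) ^ q"
      using D assms(1) by (simp add: power2_eq_square field_simps)
    moreover have "h^2 * inverse (\<delta> ^ singular_order B) = h * (h * inverse (\<delta> ^ (2 * d))) * 1"
      using d by (simp add: power2_eq_square)
    moreover have "h * (h * inverse (\<delta> ^ (2 * d))) * 1 \<le> D * (h * inverse (\<delta> ^ (2 * d))) * (h / \<delta>) ^ q"
      using assms h r by (intro mult_mono one_le_power) auto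
    ultimately show ?thesis by linarith
  qed
qed

lemma surface_not_isolated:
  assumes "smooth_closed_surface \<Gamma>" "x \<in> \<Gamma>"
  shows "at x within \<Gamma> \<noteq> bot"
proof -
  obtain U F G where UF: "surface_param \<Gamma> U F" "x \<in> F ` U"
    using assms unfolding smooth_closed_surface_def by meson
  obtain u0 where u0: "u0 \<in> U" "x = F u0" using UF by blast
  have U: "open U" "smooth U F" "inj_on F U" "F ` U \<subseteq> \<Gamma>" using UF(1) by (auto simp: surface_param_def)
  have "isCont F u0" using smooth_continuous_on[OF U(2)] U(1) u0(1) continuous_on_eq_continuous_at by blast
  have "x islimpt \<Gamma>" unfolding islimpt_approachable
  proof (intro allI impI)
    fix e :: real assume "0 < e"
    then obtain r where r: "0 < r" "\<And>u. dist u u0 < r \<Longrightarrow> dist (F u) (F u0) < e"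
      using \<open>isCont F u0\<close> unfolding continuous_at_eps_delta by blast
    obtain s where s: "0 < s" "ball u0 s \<subseteq> U" using U(1) u0(1) open_contains_ball by blast
    define u where "u = u0 + (min r s / 2) *\<^sub>R axis 1 1"
    have d: "dist u u0 = min r s / 2" using r(1) s(1) by (simp add: u_def dist_norm)
    have "u \<in> U" using d r(1) s by (intro subsetD[OF s(2)]) (simp add: dist_commute)
    moreover have "u \<noteq> u0" using d r(1) s(1) by auto
    ultimately have "F u \<noteq> x" "F u \<in> \<Gamma>" using U(3,4) u0 by (auto dest: inj_onD)
    moreover have "dist (F u) x < e" unfolding u0(2) by (rule r(2)) (use d r(1) s(1) in auto)
    ultimately show "\<exists>y\<in>\<Gamma>. y \<noteq> x \<and> dist y x < e" by blast
  qed
  then show ?thesis by (simp add: trivial_limit_within)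
qed

text \<open>At \<open>y = x\<close> the integrand is defined as a limit along the surface, and the smooth extension is continuous there.\<close>

lemma reg_integrand_eq:
  assumes "smooth_closed_surface \<Gamma>" "x \<in> \<Gamma>" "0 < \<delta>" "\<And>y. y \<in> \<Gamma> \<Longrightarrow> N y = \<nu> y" "\<And>y. y \<in> \<Gamma> \<Longrightarrow> g y = \<phi> y"
    "isCont (\<lambda>y. reg_density B N n (a (\<delta> * k)) k \<delta> x y *\<^sub>R g y) x" "y \<in> \<Gamma>"
  shows "reg_integrand \<Gamma> B \<nu> n a k \<phi> x \<delta> y = reg_density B N n (a (\<delta> * k)) k \<delta> x y *\<^sub>R g y"
proof -
  let ?h = "\<lambda>y. reg_density B N n (a (\<delta> * k)) k \<delta> x y *\<^sub>R g y"
  let ?g = "\<lambda>y. reg_\<sigma> (op_p B) n (a (\<delta> * k)) (norm (x - y) / \<delta>) *\<^sub>R sing_integrand B \<nu> k \<phi> x y"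
  have e: "?g z = ?h z" if "z \<in> \<Gamma>" "z \<noteq> x" for z
    using reg_\<sigma>_sing_integrand_eq_reg_density[OF assms(3) that(2) assms(4)[OF assms(2)] assms(4)[OF that(1)]] assms(5)[OF that(1)] by simp
  have "(?h \<longlongrightarrow> ?h x) (at x within \<Gamma>)"
    using assms(6) continuous_at_imp_continuous_at_within continuous_within by blast
  then have "(?g \<longlongrightarrow> ?h x) (at x within \<Gamma>)"
    by (rule Lim_transform_eventually) (use e in \<open>auto simp: eventually_at_filter\<close>)
  then have "Lim (at x within \<Gamma>) ?g = ?h x" by (rule tendsto_Lim[OF surface_not_isolated[OF assms(1,2)]])
  then show ?thesis using e[OF assms(7)] unfolding reg_integrand_def Let_def by auto
qed

text \<open>The estimate for one extension \<open>g\<close> of the density. Multiplication by \<open>g\<close> at most doubles the rate of the kernel. Real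
and imaginary parts are treated separately, as scalar products of \<open>g\<close> with \<open>1\<close> and \<open>\<i>\<close>.\<close>

lemma disc_error_extension_bound:
  assumes "smooth_closed_surface \<Gamma>" "surface_measure \<Gamma> ds"
    "reference_element Th" "quadrature_rule Th q NQ xq w" "0 < reg_lo"
    "open V0" "\<Gamma> \<subseteq> V0" "\<forall>y\<in>\<Gamma>. N y = \<nu> y"
  shows "\<exists>C\<ge>0. \<forall>B k n a \<delta> h M \<phi> x m g b.
    0 < \<delta> \<and> 0 < h \<and> regular_mesh \<Gamma> Th reg_s reg_u reg_lo reg_hi reg_D h M \<and> x \<in> \<Gamma> \<and> 1 \<le> m \<and>
    kernel_bound (Suc q) V0 \<Gamma> (reg_density B N n (a (\<delta> * k)) k \<delta> x) x \<delta> (op_p B - op_s B)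
      (m * inverse (\<delta> ^ op_order B)) m (m * inverse (\<delta> ^ singular_order B)) \<and>
    (B = HS \<and> q = 0 \<longrightarrow> h \<le> \<delta>) \<and>
    Ck_extension (Suc q) \<Gamma> \<phi> g \<and> (\<forall>\<alpha>. length \<alpha> \<le> Suc q \<longrightarrow> (\<forall>y\<in>\<Gamma>. norm (partials \<alpha> g y) \<le> b)) \<longrightarrow>
    norm (disc_error \<Gamma> ds B \<nu> n a k \<phi> x NQ xq w M \<delta>)
      \<le> C * (m * (2 * m) ^ Suc q) * b * disc_rate q (op_p B) (op_s B) h \<delta>"
proof -
  have cp: "compact \<Gamma>" using assms(1) by (simp add: smooth_closed_surface_def)
  obtain C1 where C1: "0 \<le> C1" "\<forall>h M \<delta> x V \<psi> K L d Z.
    regular_mesh \<Gamma> Th reg_s reg_u reg_lo reg_hi reg_D h M \<and> 0 < h \<and> 0 < \<delta> \<and> x \<in> \<Gamma> \<and>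
    open V \<and> \<Gamma> \<subseteq> V \<and> d \<le> 2 \<and> 0 \<le> K \<and> 0 \<le> L \<and>
    kernel_bound (Suc q) V \<Gamma> \<psi> x \<delta> d K L Z \<longrightarrow>
    \<bar>mesh_error ds NQ xq w M \<psi>\<bar>
      \<le> C1 * (K * (L * h / \<delta>) ^ Suc q * (if d = 0 then \<delta> else \<delta>^2) + (if h \<le> \<delta> then 0 else h^2 * Z))"
    using mesh_quadrature_error[OF assms(1-5), of reg_s reg_u reg_hi reg_D] by blast
  define D where "D = diameter \<Gamma> + 1"
  have D1: "1 \<le> D" using diameter_ge_0[OF compact_imp_bounded[OF cp]] by (simp add: D_def)
  define C where "C = C1 * (1 + D)"
  have C0: "0 \<le> C" using C1(1) D1 by (simp add: C_def)
  show ?thesis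
  proof (intro exI[of _ "2 * C"] conjI allI impI; (elim conjE)?)
    fix B k n a \<delta> h M x m b and \<phi> g :: "real^3 \<Rightarrow> complex"
    assume \<delta>: "0 < \<delta>" and h: "0 < h" and mesh: "regular_mesh \<Gamma> Th reg_s reg_u reg_lo reg_hi reg_D h M"
      and x: "x \<in> \<Gamma>" and m: "1 \<le> m" and kb: "kernel_bound (Suc q) V0 \<Gamma> (reg_density B N n (a (\<delta> * k)) k \<delta> x) x \<delta>
        (op_p B - op_s B) (m * inverse (\<delta> ^ op_order B)) m (m * inverse (\<delta> ^ singular_order B))"
      and HS: "B = HS \<and> q = 0 \<longrightarrow> h \<le> \<delta>" and extn: "Ck_extension (Suc q) \<Gamma> \<phi> g"
      and bnd: "\<forall>\<alpha>. length \<alpha> \<le> Suc q \<longrightarrow> (\<forall>y\<in>\<Gamma>. norm (partials \<alpha> g y) \<le> b)"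
    have gb: "norm (partials \<alpha> g y) \<le> b" if "length \<alpha> \<le> Suc q" "y \<in> \<Gamma>" for \<alpha> y
      using bnd that by blast
    from kb have jets: "jet_bounded (Suc q) V0 {y} (reg_density B N n (a (\<delta> * k)) k \<delta> x)
        (m * inverse (\<delta> ^ op_order B) * inverse (1 + dist x y / \<delta>) ^ (2 * (op_p B - op_s B))) (m * inverse (\<delta> * (1 + dist x y / \<delta>)))"
      and ge: "1 \<le> m * inverse (\<delta> * (1 + dist x y / \<delta>))"
      and Z: "\<bar>reg_density B N n (a (\<delta> * k)) k \<delta> x y\<bar> \<le> m * inverse (\<delta> ^ singular_order B)" if "y \<in> \<Gamma>" for y
      using that by (auto simp: kernel_bound_def simp del: jet_bounded.simps)
    obtain V1 where V1: "open V1" "\<Gamma> \<subseteq> V1" "Ck (Suc q) V1 g" and g\<phi>: "\<And>y. y \<in> \<Gamma> \<Longrightarrow> g y = \<phi> y"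
      using extn unfolding Ck_extension_def by blast
    have b0: "0 \<le> b" using gb[of "[]" x] x by (simp add: order_trans[OF norm_ge_zero])
    define V where "V = V0 \<inter> V1"
    have V: "open V" "\<Gamma> \<subseteq> V" using assms(6,7) V1 by (auto simp: V_def)
    define d where "d = op_p B - op_s B"
    have d2: "d \<le> 2" by (cases B) (auto simp: d_def)
    let ?\<rho> = "reg_density B N n (a (\<delta> * k)) k \<delta> x"
    let ?R = "m * (2 * m) ^ Suc q"
    have R0: "1 \<le> (2 * m) ^ Suc q" using m by (intro one_le_power) simp
    have rate0: "0 \<le> disc_rate q (op_p B) (op_s B) h \<delta>" unfolding disc_rate_eq[OF \<delta>] using h \<delta> by auto
    have part: "\<bar>mesh_error ds NQ xq w M (\<lambda>y. ?\<rho> y * (g y \<bullet> e))\<bar> \<le> C * ?R * b * disc_rate q (op_p B) (op_s B) h \<delta>"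
      and diff: "\<And>y. y \<in> \<Gamma> \<Longrightarrow> (\<lambda>y. ?\<rho> y * (g y \<bullet> e)) differentiable (at y)" if e: "norm e = 1" for e :: complex
    proof -
      let ?\<psi> = "\<lambda>y. ?\<rho> y * (g y \<bullet> e)"
      let ?K = "m * inverse (\<delta> ^ op_order B) * b" and ?Z = "m * inverse (\<delta> ^ singular_order B) * b"
      have jp: "jet_bounded (Suc q) V {y} ?\<psi> (?K * inverse (1 + dist x y / \<delta>) ^ (2 * d)) (2 * m * inverse (\<delta> * (1 + dist x y / \<delta>)))"
        and zp: "\<bar>?\<psi> y\<bar> \<le> ?Z" if y: "y \<in> \<Gamma>" for y
      proof -
        have yV: "{y} \<subseteq> V" using V(2) y by blast
        have "jet_bounded (Suc q) V1 {y} g b 1"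
          by (rule Ck_partials_imp_jet_bounded[OF V1(3)]) (use y V1(2) gb in auto)
        then have gj: "jet_bounded (Suc q) V {y} g b 1"
          by (rule jet_bounded_mono) (use V(1) yV in \<open>auto simp: V_def\<close>)
        have ge': "jet_bounded (Suc q) V {y} (\<lambda>y. g y \<bullet> e) (b * 1) (1 + 0)"
          by (rule jet_bounded_inner[OF V(1) yV gj jet_bounded_const[OF V(1) yV]]) (use e in auto)
        have \<rho>j: "jet_bounded (Suc q) V {y} ?\<rho> (m * inverse (\<delta> ^ op_order B) * inverse (1 + dist x y / \<delta>) ^ (2 * d)) (m * inverse (\<delta> * (1 + dist x y / \<delta>)))"
          by (rule jet_bounded_mono[OF jets[OF y]]) (use V(1) yV ge[OF y] in \<open>auto simp: V_def d_def\<close>)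
        have "jet_bounded (Suc q) V {y} ?\<psi> (m * inverse (\<delta> ^ op_order B) * inverse (1 + dist x y / \<delta>) ^ (2 * d) * (b * 1))
            (m * inverse (\<delta> * (1 + dist x y / \<delta>)) + (1 + 0))"
          by (rule jet_bounded_mult[OF V(1) yV \<rho>j ge']) (use ge[OF y] in auto)
        then show "jet_bounded (Suc q) V {y} ?\<psi> (?K * inverse (1 + dist x y / \<delta>) ^ (2 * d)) (2 * m * inverse (\<delta> * (1 + dist x y / \<delta>)))"
        proof (rule jet_bounded_mono)
          show "m * inverse (\<delta> * (1 + dist x y / \<delta>)) + (1 + 0) \<le> 2 * m * inverse (\<delta> * (1 + dist x y / \<delta>))"
            using ge[OF y] by (simp only: mult.assoc)
          show "0 \<le> m * inverse (\<delta> * (1 + dist x y / \<delta>)) + (1 + 0)" using ge[OF y] by linarith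
        qed (use V(1) yV in auto)
        have "\<bar>g y \<bullet> e\<bar> \<le> b" using jet_boundedD[OF ge', of y] by simp
        then show "\<bar>?\<psi> y\<bar> \<le> ?Z" unfolding abs_mult using Z[OF y] m \<delta> by (intro mult_mono) auto
      qed
      show "?\<psi> differentiable (at y)" if "y \<in> \<Gamma>" for y
        by (rule jet_bounded_differentiable[OF jp[OF that]]) (use V(2) that in auto)
      have ge2: "1 \<le> 2 * m * inverse (\<delta> * (1 + dist x y / \<delta>))" if "y \<in> \<Gamma>" for y
        using ge[OF that] unfolding mult.assoc by linarith
      let ?fac = "if d = 0 then \<delta> else \<delta>^2"
      have "\<bar>mesh_error ds NQ xq w M ?\<psi>\<bar>
          \<le> C1 * (?K * (2 * m * h / \<delta>) ^ Suc q * ?fac + (if h \<le> \<delta> then 0 else h^2 * ?Z))"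
      proof (rule C1(2)[rule_format, where \<psi> = ?\<psi> and x = x and V = V and d = d], intro conjI)
        show "0 \<le> ?K" using m b0 \<delta> by simp
        show "0 \<le> 2 * m" using m by simp
        show "kernel_bound (Suc q) V \<Gamma> ?\<psi> x \<delta> d ?K (2 * m) ?Z"
          unfolding kernel_bound_def by (intro ballI conjI jp zp ge2)
      qed (fact mesh h \<delta> x V d2)+
      also have "\<dots> \<le> C1 * (?R * b * disc_rate q (op_p B) (op_s B) h \<delta> + ?R * b * (D * disc_rate q (op_p B) (op_s B) h \<delta>))"
      proof (intro mult_left_mono add_mono C1(1))
        have "?K * (2 * m * h / \<delta>) ^ Suc q * ?fac = ?R * b * (inverse (\<delta> ^ op_order B) * (h / \<delta>) ^ Suc q * ?fac)"
        proof -
          have "2 * m * h / \<delta> = (2 * m) * (h / \<delta>)" by simp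
          then have "(2 * m * h / \<delta>) ^ Suc q = (2 * m) ^ Suc q * (h / \<delta>) ^ Suc q" by (simp only: power_mult_distrib)
          then show ?thesis by (simp only: mult_ac)
        qed
        also have "\<dots> = ?R * b * disc_rate q (op_p B) (op_s B) h \<delta>" unfolding disc_rate_eq[OF \<delta>] d_def by (rule refl)
        finally show "?K * (2 * m * h / \<delta>) ^ Suc q * ?fac \<le> ?R * b * disc_rate q (op_p B) (op_s B) h \<delta>" by simp
        show "(if h \<le> \<delta> then 0 else h^2 * ?Z) \<le> ?R * b * (D * disc_rate q (op_p B) (op_s B) h \<delta>)"
        proof (cases "h \<le> \<delta>")
          case True
          then show ?thesis using m b0 D1 rate0 by simp
        next
          case False
          have "h \<le> diameter \<Gamma>" by (rule regular_mesh_size_le[OF mesh cp]) (use x in auto)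
          then have "h \<le> D" by (simp add: D_def)
          then have le: "h^2 * inverse (\<delta> ^ singular_order B) \<le> D * disc_rate q (op_p B) (op_s B) h \<delta>"
            by (intro singular_order_rate_le) (use \<delta> False D1 HS in auto)
          have "h^2 * ?Z = m * b * (h^2 * inverse (\<delta> ^ singular_order B))" by simp
          also have "\<dots> \<le> m * b * (D * disc_rate q (op_p B) (op_s B) h \<delta>)"
            by (rule mult_left_mono[OF le]) (use m b0 in simp)
          also have "\<dots> \<le> ?R * b * (D * disc_rate q (op_p B) (op_s B) h \<delta>)"
          proof (rule mult_right_mono[OF mult_right_mono])
            show "m \<le> ?R" using mult_left_mono[OF R0, of m] m by simp
          qed (use b0 D1 rate0 in auto)
          finally show ?thesis using False by simp
        qed
      qed
      also have "\<dots> = C * ?R * b * disc_rate q (op_p B) (op_s B) h \<delta>" unfolding C_def by (simp only: algebra_simps)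
      finally show "\<bar>mesh_error ds NQ xq w M ?\<psi>\<bar>
        \<le> C * ?R * b * disc_rate q (op_p B) (op_s B) h \<delta>" .
    qed
    let ?f = "\<lambda>y. ?\<rho> y *\<^sub>R g y"
    have f_eq: "?f = (\<lambda>y. of_real (?\<rho> y * (g y \<bullet> 1)) + \<i> * of_real (?\<rho> y * (g y \<bullet> \<i>)))"
      by (rule ext) (simp add: complex_eq_iff inner_complex_def)
    have cont: "isCont ?f y" if "y \<in> \<Gamma>" for y
    proof -
      have "isCont (\<lambda>y. ?\<rho> y * (g y \<bullet> e)) y" if "norm e = 1" for e :: complex
        by (rule differentiable_imp_continuous_within[OF diff[OF that \<open>y \<in> \<Gamma>\<close>]])
      note c = this
      have "isCont (\<lambda>y. ?\<rho> y * (g y \<bullet> 1)) y" "isCont (\<lambda>y. ?\<rho> y * (g y \<bullet> \<i>)) y" by (rule c; simp)+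
      then show ?thesis unfolding f_eq
        by (rule continuous_add[OF continuous_of_real continuous_mult[OF continuous_const continuous_of_real]])
    qed
    have req: "reg_integrand \<Gamma> B \<nu> n a k \<phi> x \<delta> y = ?f y" if "y \<in> \<Gamma>" for y
      by (rule reg_integrand_eq[where a = a and g = g and k = k and N = N, OF assms(1) x \<delta> bspec[OF assms(8)] g\<phi> cont[OF x] that])
    have cont\<Gamma>: "continuous_on \<Gamma> ?f" using cont by (auto intro: continuous_at_imp_continuous_on)
    have int: "integrable ds ?f" by (rule continuous_on_surface_integrable[OF assms(1,2) cont\<Gamma>])
    have lint: "(LINT y|ds. reg_integrand \<Gamma> B \<nu> n a k \<phi> x \<delta> y) = (LINT y|ds. ?f y)"
      by (rule Bochner_Integration.integral_cong) (use req surface_measure_space[OF assms(2)] in auto)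
    have quad: "surface_quadrature NQ xq w M (reg_integrand \<Gamma> B \<nu> n a k \<phi> x \<delta>) =
        (\<Sum>F\<in>M. \<Sum>j=1..NQ. (w j * surf_jac F (xq j)) *\<^sub>R ?f (F (xq j)))"
      unfolding surface_quadrature_def
    proof (intro sum.cong refl)
      fix F j assume F: "F \<in> M" and j: "j \<in> {1..NQ}"
      have "xq j \<in> Th" using assms(4) j by (auto simp: quadrature_rule_def)
      then have "F (xq j) \<in> \<Gamma>" using mesh F unfolding regular_mesh_def tessellation_def by blast
      then show "(w j * surf_jac F (xq j)) *\<^sub>R reg_integrand \<Gamma> B \<nu> n a k \<phi> x \<delta> (F (xq j)) = (w j * surf_jac F (xq j)) *\<^sub>R ?f (F (xq j))"
        by (simp only: req)
    qed
    have proj: "disc_error \<Gamma> ds B \<nu> n a k \<phi> x NQ xq w M \<delta> \<bullet> e =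
        mesh_error ds NQ xq w M (\<lambda>y. ?\<rho> y * (g y \<bullet> e))" for e
      unfolding mesh_error_def disc_error_def lint quad inner_diff_left inner_sum_left
      by (simp add: integral_inner_left[OF int, symmetric] mult.assoc)
    let ?X = "C * ?R * b * disc_rate q (op_p B) (op_s B) h \<delta>"
    have "\<bar>Re (disc_error \<Gamma> ds B \<nu> n a k \<phi> x NQ xq w M \<delta>)\<bar> \<le> ?X"
      using part[of 1] proj[of 1] by (simp add: inner_complex_def)
    moreover have "\<bar>Im (disc_error \<Gamma> ds B \<nu> n a k \<phi> x NQ xq w M \<delta>)\<bar> \<le> ?X"
      using part[of \<i>] proj[of \<i>] by (simp add: inner_complex_def)
    ultimately have "norm (disc_error \<Gamma> ds B \<nu> n a k \<phi> x NQ xq w M \<delta>) \<le> 2 * ?X"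
      using cmod_le[of "disc_error \<Gamma> ds B \<nu> n a k \<phi> x NQ xq w M \<delta>"] by linarith
    then show "norm (disc_error \<Gamma> ds B \<nu> n a k \<phi> x NQ xq w M \<delta>)
      \<le> 2 * C * (m * (2 * m) ^ Suc q) * b * disc_rate q (op_p B) (op_s B) h \<delta>" by (simp only: mult.assoc)
  qed (use C0 in simp)
qed

section \<open>Balancing the two errors\<close>

text \<open>With \<open>\<tau>\<close> the power of \<open>1/\<delta>\<close> in the rate, \<open>\<mu>\<close> is the solution of \<open>q + 1 - \<mu> \<tau> = \<mu> \<mm>\<close>. It is below one for the
hypersingular operator and \<open>q = 0\<close>, so there \<open>h \<le> c h\<^bsup>\<mu>\<^esup>\<close> for small \<open>h\<close>, as the discretization bound
requires.\<close>

lemma mu_star_rates: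
  fixes q :: nat
  assumes "op_p B \<le> m" "0 < c"
  defines "\<mu> \<equiv> mu_star q m (op_p B) (op_s B)"
  defines "\<oo> \<equiv> \<mu> * reg_order m (op_p B)"
  shows "0 < \<mu>" "B = HS \<Longrightarrow> q = 0 \<Longrightarrow> \<mu> < 1"
    "(\<lambda>h. disc_rate q (op_p B) (op_s B) h (c * h powr \<mu>)) \<in> \<Theta>[at_right 0](\<lambda>h. h powr \<oo>)"
    "(\<lambda>h. (c * h powr \<mu>) powr reg_order m (op_p B)) \<in> \<Theta>[at_right 0](\<lambda>h. h powr \<oo>)"
proof -
  define \<tau> where "\<tau> = (if op_p B = op_s B then real q + 1 else real q + 2 * (real (op_p B) - real (op_s B)))"
  have r1: "1 \<le> reg_order m (op_p B)" using assms(1) by (simp add: reg_order_def)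
  have ps: "real (op_s B) \<le> real (op_p B)" by (cases B) auto
  have \<tau>0: "0 \<le> \<tau>" using ps by (auto simp: \<tau>_def)
  have \<mu>: "\<mu> = (real q + 1) / (\<tau> + reg_order m (op_p B))" by (simp add: \<mu>_def mu_star_def \<tau>_def)
  have den: "0 < \<tau> + reg_order m (op_p B)" using \<tau>0 r1 by linarith
  show \<mu>0: "0 < \<mu>" unfolding \<mu> using den by simp
  show "\<mu> < 1" if "B = HS" "q = 0"
    using that r1 by (simp add: \<mu> \<tau>_def)
  have bal: "real q + 1 - \<mu> * \<tau> = \<oo>" unfolding \<oo>_def \<mu> using den by (simp add: field_simps)
  have rate: "disc_rate q (op_p B) (op_s B) h \<delta> = h ^ (q + 1) * \<delta> powr (- \<tau>)" for h \<delta>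
    by (simp add: disc_rate_def \<tau>_def)
  have pos: "\<forall>\<^sub>F h in at_right (0::real). 0 < h" by (rule eventually_at_right_less)
  have e1: "\<forall>\<^sub>F h in at_right 0. c powr (- \<tau>) * h powr \<oo> = disc_rate q (op_p B) (op_s B) h (c * h powr \<mu>)"
    using pos
  proof eventually_elim
    case (elim h)
    have "h ^ (q + 1) = h powr (real q + 1)" using powr_realpow[OF elim, of "q + 1"] by (simp add: add.commute)
    moreover have "(c * h powr \<mu>) powr (- \<tau>) = c powr (- \<tau>) * h powr (- (\<mu> * \<tau>))"
      using assms(2) elim by (simp add: powr_mult powr_powr)
    ultimately have "disc_rate q (op_p B) (op_s B) h (c * h powr \<mu>) = c powr (- \<tau>) * (h powr (real q + 1) * h powr (- (\<mu> * \<tau>)))"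
      unfolding rate by simp
    also have "h powr (real q + 1) * h powr (- (\<mu> * \<tau>)) = h powr \<oo>"
      unfolding powr_add[symmetric] bal[symmetric] by simp
    finally show ?case by simp
  qed
  have "(\<lambda>h. c powr (- \<tau>) * h powr \<oo>) \<in> \<Theta>[at_right 0](\<lambda>h. h powr \<oo>)" using assms(2) by simp
  then show "(\<lambda>h. disc_rate q (op_p B) (op_s B) h (c * h powr \<mu>)) \<in> \<Theta>[at_right 0](\<lambda>h. h powr \<oo>)"
    using landau_theta.in_cong[OF e1] by simp
  have e2: "\<forall>\<^sub>F h in at_right 0. c powr reg_order m (op_p B) * h powr \<oo> = (c * h powr \<mu>) powr reg_order m (op_p B)"
    using pos by eventually_elim (use assms(2) in \<open>simp add: powr_mult powr_powr \<oo>_def\<close>)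
  have "(\<lambda>h. c powr reg_order m (op_p B) * h powr \<oo>) \<in> \<Theta>[at_right 0](\<lambda>h. h powr \<oo>)" using assms(2) by simp
  then show "(\<lambda>h. (c * h powr \<mu>) powr reg_order m (op_p B)) \<in> \<Theta>[at_right 0](\<lambda>h. h powr \<oo>)"
    using landau_theta.in_cong[OF e2] by simp
qed

lemma powr_scaling_at_right:
  fixes c \<mu> :: real
  assumes "0 < c" "0 < \<mu>"
  shows "filterlim (\<lambda>h. c * h powr \<mu>) (at_right 0) (at_right 0)"
proof -
  have "((\<lambda>h::real. h powr \<mu>) \<longlongrightarrow> 0) (at_right 0)"
  proof -
    have "((\<lambda>h::real. h powr \<mu>) \<longlongrightarrow> 0 powr \<mu>) (at_right 0)"
      by (rule tendsto_powr2) (use assms(2) in \<open>auto intro!: tendsto_intros eventually_at_right_less[THEN eventually_mono]\<close>)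
    then show ?thesis by simp
  qed
  then have "((\<lambda>h::real. c * h powr \<mu>) \<longlongrightarrow> 0) (at_right 0)" using tendsto_mult_right_zero by blast
  moreover have "\<forall>\<^sub>F h in at_right (0::real). c * h powr \<mu> > 0"
    using eventually_at_right_less[of "0::real"] by eventually_elim (use assms in simp)
  ultimately show ?thesis unfolding filterlim_at by (auto elim: eventually_mono)
qed

text \<open>The discretization bound is available only for mesh sizes in \<open>H\<close> with \<open>P h\<close>, and for \<open>\<delta> < \<delta>\<^sub>0\<close>; all of this holds
eventually as \<open>h \<rightarrow> 0\<close> in \<open>H\<close>, since \<open>c h\<^bsup>\<mu>\<^esup> \<rightarrow> 0\<close>.\<close>

lemma total_error_rate:
  fixes Er Ed :: "real \<Rightarrow> complex" and H :: "real set"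
  assumes "H \<subseteq> {0<..}" "0 < c" "0 < \<mu>" "0 < \<delta>\<^sub>0"
    "(\<lambda>\<delta>. norm (Er \<delta>)) \<in> O[at_right 0](\<lambda>\<delta>. \<delta> powr r)"
    "(\<lambda>h. (c * h powr \<mu>) powr r) \<in> \<Theta>[at_right 0](\<lambda>h. h powr \<oo>)"
    "R \<in> \<Theta>[at_right 0](\<lambda>h. h powr \<oo>)"
    "\<And>h. h \<in> H \<Longrightarrow> c * h powr \<mu> < \<delta>\<^sub>0 \<Longrightarrow> P h \<Longrightarrow> norm (Ed h) \<le> K * R h"
    "\<forall>\<^sub>F h in at_right 0. P h"
  shows "(\<lambda>h. norm (Er (c * h powr \<mu>) + Ed h)) \<in> O[at 0 within H](\<lambda>h. h powr \<oo>)"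
proof -
  note lim = powr_scaling_at_right[OF assms(2,3)]
  have le: "at 0 within H \<le> at_right (0::real)" using assms(1) by (rule at_le)
  have "(\<lambda>h. norm (Er (c * h powr \<mu>))) \<in> O[at_right 0](\<lambda>h. (c * h powr \<mu>) powr r)"
    by (rule landau_o.big.compose[OF assms(5) lim])
  also have "(\<lambda>h. (c * h powr \<mu>) powr r) \<in> O[at_right 0](\<lambda>h. h powr \<oo>)"
    using assms(6) by (rule bigthetaD1)
  finally have er: "(\<lambda>h. norm (Er (c * h powr \<mu>))) \<in> O[at 0 within H](\<lambda>h. h powr \<oo>)"
    using landau_o.big.filter_mono[OF le] by blast
  have "\<forall>\<^sub>F h in at_right 0. c * h powr \<mu> < \<delta>\<^sub>0"
    using lim assms(4) unfolding filterlim_at by (auto dest: order_tendstoD(2))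
  then have "\<forall>\<^sub>F h in at_right 0. c * h powr \<mu> < \<delta>\<^sub>0 \<and> P h" using assms(9) by (rule eventually_conj)
  then have "\<forall>\<^sub>F h in at 0 within H. c * h powr \<mu> < \<delta>\<^sub>0 \<and> P h" using le filter_leD by blast
  moreover have "\<forall>\<^sub>F h in at 0 within H. h \<in> H" by (simp add: eventually_at_filter)
  ultimately have "\<forall>\<^sub>F h in at 0 within H. norm (norm (Ed h)) \<le> \<bar>K\<bar> * norm (R h)"
  proof eventually_elim
    case (elim h)
    then have "norm (Ed h) \<le> K * R h" using assms(8) by blast
    also have "\<dots> \<le> \<bar>K\<bar> * \<bar>R h\<bar>" by (simp add: abs_mult[symmetric])
    finally show ?case by simp
  qed
  then have "(\<lambda>h. norm (Ed h)) \<in> O[at 0 within H](R)" by (rule bigoI)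
  also have "R \<in> O[at 0 within H](\<lambda>h. h powr \<oo>)"
    using landau_o.big.filter_mono[OF le bigthetaD1[OF assms(7)]] .
  finally have ed: "(\<lambda>h. norm (Ed h)) \<in> O[at 0 within H](\<lambda>h. h powr \<oo>)" .
  have "(\<lambda>h. norm (Er (c * h powr \<mu>) + Ed h)) \<in> O[at 0 within H](\<lambda>h. norm (Er (c * h powr \<mu>)) + norm (Ed h))"
    by (rule bigoI[of _ 1]) (auto intro: always_eventually norm_triangle_ineq)
  also have "(\<lambda>h. norm (Er (c * h powr \<mu>)) + norm (Ed h)) \<in> O[at 0 within H](\<lambda>h. h powr \<oo>)"
    by (rule sum_in_bigo(1)[OF er ed])
  finally show ?thesis .
qed

text \<open>The norm is an infimum over extensions, so it suffices to prove a bound for each extension. Compactness of the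
surface guarantees that the infimum is not over the empty set.\<close>

lemma Ck_norm_ge:
  fixes \<phi> :: "real^'n \<Rightarrow> 'b::real_normed_vector"
  assumes "Ck_surface r \<Gamma> \<phi>" "compact \<Gamma>" "0 \<le> X"
    "\<And>g b. Ck_extension r \<Gamma> \<phi> g \<Longrightarrow> (\<And>\<alpha> y. length \<alpha> \<le> r \<Longrightarrow> y \<in> \<Gamma> \<Longrightarrow> norm (partials \<alpha> g y) \<le> b) \<Longrightarrow> E \<le> X * b"
  shows "E \<le> X * Ck_norm r \<Gamma> \<phi>"
proof -
  let ?S = "{b. \<exists>g. Ck_extension r \<Gamma> \<phi> g \<and> (\<forall>\<alpha>. length \<alpha> \<le> r \<longrightarrow> (\<forall>y\<in>\<Gamma>. norm (partials \<alpha> g y) \<le> b))}"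
  have S: "E \<le> X * b" if "b \<in> ?S" for b using that assms(4) by blast
  obtain g where g: "Ck_extension r \<Gamma> \<phi> g" using assms(1) by (auto simp: Ck_surface_def)
  then obtain V where "Ck r V g" "\<Gamma> \<subseteq> V" by (auto simp: Ck_extension_def)
  then obtain b where "\<forall>\<alpha>. length \<alpha> \<le> r \<longrightarrow> (\<forall>x\<in>\<Gamma>. norm (partials \<alpha> g x) \<le> b)"
    using Ck_partials_bounded_compact[OF _ assms(2)] by blast
  then have b: "b \<in> ?S" using g by blast
  show ?thesis
  proof (cases "X = 0")
    case True
    then show ?thesis using S[OF b] by simp
  next
    case False
    then have "E / X \<le> Inf ?S"
      by (intro cInf_greatest) (use b S assms(3) in \<open>auto simp: divide_le_eq mult.commute\<close>)
    then show ?thesis using False assms(3) by (simp add: Ck_norm_def divide_le_eq mult.commute)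
  qed
qed

section \<open>The theorem\<close>

theorem theorem3p1:
  fixes \<Gamma> :: "(real^3) set" and \<nu> :: "real^3 \<Rightarrow> real^3" and ds :: "(real^3) measure" and q :: nat
  assumes "smooth_closed_surface \<Gamma>"
    and "outward_unit_normal \<Gamma> \<nu>"
    and "surface_measure \<Gamma> ds"
  shows "\<exists>C\<^sub>\<sigma> C\<^sub>\<Phi> C\<^sub>\<Psi> :: layer_op \<Rightarrow> real \<Rightarrow> nat \<Rightarrow> (real \<Rightarrow> nat \<Rightarrow> real) \<Rightarrow> real \<Rightarrow> real.
    \<forall>Th NQ xq w reg_s reg_u reg_lo reg_hi reg_D.
      reference_element Th \<and> quadrature_rule Th q NQ xq w \<and> 0 < reg_lo \<longrightarrow>
      (\<exists>C::real. \<forall>B k n m a \<delta>\<^sub>0 H \<T> \<phi> x.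
        0 < k \<and> op_p B \<le> m \<and> 0 < \<delta>\<^sub>0 \<and> \<delta>\<^sub>0 \<le> 1 \<and>
        (\<forall>\<delta>\<in>{0<..<\<delta>\<^sub>0}. reg_coeffs B n m (\<delta> * k) (a (\<delta> * k))) \<and>
        (\<exists>A. \<forall>\<delta>\<in>{0<..<\<delta>\<^sub>0}. \<forall>l\<in>{1..n}. \<bar>a (\<delta> * k) l\<bar> \<le> A) \<and>
        H \<subseteq> {0<..} \<and> (\<forall>h\<in>H. regular_mesh \<Gamma> Th reg_s reg_u reg_lo reg_hi reg_D h (\<T> h)) \<and>
        Ck_surface (q + 1) \<Gamma> \<phi> \<and> x \<in> \<Gamma> \<and>
        (\<lambda>\<delta>. norm (reg_error \<Gamma> ds B \<nu> n a k \<phi> x \<delta>))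
          \<in> O[at_right 0](\<lambda>\<delta>. \<delta> powr reg_order m (op_p B)) \<longrightarrow>
        (\<forall>h\<in>H. \<forall>\<delta>\<in>{0<..<\<delta>\<^sub>0}. (B = HS \<and> q = 0 \<longrightarrow> h \<le> \<delta>) \<longrightarrow>
           norm (disc_error \<Gamma> ds B \<nu> n a k \<phi> x NQ xq w (\<T> h) \<delta>)
             \<le> C * (C\<^sub>\<sigma> B k n a \<delta>\<^sub>0 * C\<^sub>\<Phi> B k n a \<delta>\<^sub>0 * C\<^sub>\<Psi> B k n a \<delta>\<^sub>0 *
                 Ck_norm (q + 1) \<Gamma> \<phi> * disc_rate q (op_p B) (op_s B) h \<delta>)) \<and>
        (\<forall>c>0. let \<mu> = mu_star q m (op_p B) (op_s B);
                   \<oo> = \<mu> * reg_order m (op_p B);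
                   \<delta> = (\<lambda>h. c * h powr \<mu>)
           in (\<lambda>h. disc_rate q (op_p B) (op_s B) h (\<delta> h)) \<in> \<Theta>[at_right 0](\<lambda>h. h powr \<oo>) \<and>
              (\<lambda>h. \<delta> h powr reg_order m (op_p B)) \<in> \<Theta>[at_right 0](\<lambda>h. h powr \<oo>) \<and>
              (\<lambda>h. norm (reg_error \<Gamma> ds B \<nu> n a k \<phi> x (\<delta> h) +
                         disc_error \<Gamma> ds B \<nu> n a k \<phi> x NQ xq w (\<T> h) (\<delta> h)))
                \<in> O[at 0 within H](\<lambda>h. h powr \<oo>)))"
proof -
  have cp: "compact \<Gamma>" using assms(1) by (simp add: smooth_closed_surface_def)
  have "\<exists>V N. open V \<and> \<Gamma> \<subseteq> V \<and> smooth V N \<and> (\<forall>y\<in>\<Gamma>. N y = \<nu> y)"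
    using assms(2) unfolding outward_unit_normal_def by (rule conjunct1)
  then obtain V N where V: "open V" "\<Gamma> \<subseteq> V" "smooth V N" and N': "\<forall>y\<in>\<Gamma>. N y = \<nu> y"
    by (elim exE conjE)
  define bounded_coeffs where "bounded_coeffs = (\<lambda>k n (a :: real \<Rightarrow> nat \<Rightarrow> real) \<delta>\<^sub>0.
    \<exists>A. \<forall>\<delta>\<in>{0<..<\<delta>\<^sub>0}. \<forall>l\<in>{1..n::nat}. \<bar>a (\<delta> * k) l\<bar> \<le> A)"
  define kb where "kb = (\<lambda>B k n (a :: real \<Rightarrow> nat \<Rightarrow> real) \<delta> m. \<forall>x\<in>\<Gamma>.
    kernel_bound (Suc q) V \<Gamma> (reg_density B N n (a (\<delta> * k)) k \<delta> x) x \<delta> (op_p B - op_s B)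
      (m * inverse (\<delta> ^ op_order B)) m (m * inverse (\<delta> ^ singular_order B)))"
  have ex: "\<exists>M\<ge>1. \<forall>\<delta>\<in>{0<..<\<delta>\<^sub>0}. kb B k n a \<delta> M"
    if k: "0 < k" and le: "\<delta>\<^sub>0 \<le> 1" and bd: "bounded_coeffs k n a \<delta>\<^sub>0" for B k n a \<delta>\<^sub>0
  proof -
    obtain A where A: "\<forall>\<delta>\<in>{0<..<\<delta>\<^sub>0}. \<forall>l\<in>{1..n}. \<bar>a (\<delta> * k) l\<bar> \<le> A"
      using bd unfolding bounded_coeffs_def by (rule exE)
    from reg_density_bounds[OF V(1,2) cp V(3) k, of n A "Suc q" B]
    obtain M where M: "1 \<le> M" "\<forall>\<delta> c x. 0 < \<delta> \<and> \<delta> \<le> 1 \<and> (\<forall>l\<in>{1..n}. \<bar>c l\<bar> \<le> A) \<and> x \<in> \<Gamma> \<longrightarrow>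
      kernel_bound (Suc q) V \<Gamma> (reg_density B N n c k \<delta> x) x \<delta> (op_p B - op_s B)
        (M * inverse (\<delta> ^ op_order B)) M (M * inverse (\<delta> ^ singular_order B))" by (elim exE conjE)
    have "kb B k n a \<delta> M" if "\<delta> \<in> {0<..<\<delta>\<^sub>0}" for \<delta>
      unfolding kb_def
      by (intro ballI M(2)[rule_format] conjI) (use that A le in auto)
    then show ?thesis using M(1) by blast
  qed
  \<comment> \<open>The bound depends on the coefficient function \<open>a\<close>, so it is selected for each choice of the arguments.\<close>
  define Mk where "Mk = (\<lambda>B k n a \<delta>\<^sub>0. SOME M. 1 \<le> M \<and> (\<forall>\<delta>\<in>{0<..<\<delta>\<^sub>0}. kb B k n a \<delta> M))"
  have Mk: "1 \<le> Mk B k n a \<delta>\<^sub>0" "\<And>\<delta>. \<delta> \<in> {0<..<\<delta>\<^sub>0} \<Longrightarrow> kb B k n a \<delta> (Mk B k n a \<delta>\<^sub>0)"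
    if "0 < k" "\<delta>\<^sub>0 \<le> 1" "bounded_coeffs k n a \<delta>\<^sub>0" for B k n a \<delta>\<^sub>0
    using someI_ex[OF ex[OF that, of B, unfolded Bex_def]] unfolding Mk_def by blast+
  \<comment> \<open>Only the product of the three constants enters the estimate; it is collected in the first one.\<close>
  define C\<sigma> where "C\<sigma> = (\<lambda>B k n a \<delta>\<^sub>0. Mk B k n a \<delta>\<^sub>0 * (2 * Mk B k n a \<delta>\<^sub>0) ^ Suc q)"
  define one where "one = (\<lambda>(B::layer_op) (k::real) (n::nat) (a :: real \<Rightarrow> nat \<Rightarrow> real) (\<delta>\<^sub>0::real). 1::real)"
  show ?thesis
  proof (rule exI[of _ C\<sigma>], rule exI[of _ one], rule exI[of _ one], intro allI impI, elim conjE, goal_cases)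
    case (1 Th NQ xq w reg_s reg_u reg_lo reg_hi reg_D)
    note Th = 1(1) and quad = 1(2) and lo = 1(3)
    from disc_error_extension_bound[where \<nu> = \<nu> and N = N and reg_s = reg_s and reg_u = reg_u
        and reg_hi = reg_hi and reg_D = reg_D, OF assms(1,3) Th quad lo V(1,2) N']
    obtain C where C: "0 \<le> C" "\<forall>B k n a \<delta> h M \<phi> x m g b.
      0 < \<delta> \<and> 0 < h \<and> regular_mesh \<Gamma> Th reg_s reg_u reg_lo reg_hi reg_D h M \<and> x \<in> \<Gamma> \<and> 1 \<le> m \<and>
      kernel_bound (Suc q) V \<Gamma> (reg_density B N n (a (\<delta> * k)) k \<delta> x) x \<delta> (op_p B - op_s B)
        (m * inverse (\<delta> ^ op_order B)) m (m * inverse (\<delta> ^ singular_order B)) \<and>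
      (B = HS \<and> q = 0 \<longrightarrow> h \<le> \<delta>) \<and>
      Ck_extension (Suc q) \<Gamma> \<phi> g \<and> (\<forall>\<alpha>. length \<alpha> \<le> Suc q \<longrightarrow> (\<forall>y\<in>\<Gamma>. norm (partials \<alpha> g y) \<le> b)) \<longrightarrow>
      norm (disc_error \<Gamma> ds B \<nu> n a k \<phi> x NQ xq w M \<delta>)
        \<le> C * (m * (2 * m) ^ Suc q) * b * disc_rate q (op_p B) (op_s B) h \<delta>"
      by (elim exE conjE)
    show ?case
    proof (intro exI[of _ C] allI impI, elim conjE, goal_cases)
      case (1 B k n m a \<delta>\<^sub>0 H \<T> \<phi> x)
      note k = 1(1) and m = 1(2) and \<delta>\<^sub>0 = 1(3,4) and A = 1(6) and H = 1(7) and mesh = 1(8) and \<phi> = 1(9)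
        and x = 1(10) and Er = 1(11)
      have A': "bounded_coeffs k n a \<delta>\<^sub>0" using A by (simp add: bounded_coeffs_def)
      note M1 = Mk(1)[OF k \<delta>\<^sub>0(2) A', of B] and Mb = Mk(2)[OF k \<delta>\<^sub>0(2) A', of _ B]
      have bound: "norm (disc_error \<Gamma> ds B \<nu> n a k \<phi> x NQ xq w (\<T> h) \<delta>)
             \<le> C * (C\<sigma> B k n a \<delta>\<^sub>0 * one B k n a \<delta>\<^sub>0 * one B k n a \<delta>\<^sub>0 *
                 Ck_norm (q + 1) \<Gamma> \<phi> * disc_rate q (op_p B) (op_s B) h \<delta>)"
        if h: "h \<in> H" and \<delta>: "\<delta> \<in> {0<..<\<delta>\<^sub>0}" and HS: "B = HS \<and> q = 0 \<longrightarrow> h \<le> \<delta>" for h \<delta>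
      proof -
        let ?X = "C * C\<sigma> B k n a \<delta>\<^sub>0 * disc_rate q (op_p B) (op_s B) h \<delta>"
        have h0: "0 < h" using h H by auto
        have d0: "0 < \<delta>" using \<delta> by simp
        have "norm (disc_error \<Gamma> ds B \<nu> n a k \<phi> x NQ xq w (\<T> h) \<delta>) \<le> ?X * Ck_norm (q + 1) \<Gamma> \<phi>"
        proof (rule Ck_norm_ge[OF \<phi> cp])
          show "0 \<le> ?X" unfolding disc_rate_eq[OF d0] C\<sigma>_def using C(1) M1 h0 d0 by auto
          fix g b assume g: "Ck_extension (q + 1) \<Gamma> \<phi> g"
            "\<And>\<alpha> y. length \<alpha> \<le> q + 1 \<Longrightarrow> y \<in> \<Gamma> \<Longrightarrow> norm (partials \<alpha> g y) \<le> b"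
          have "norm (disc_error \<Gamma> ds B \<nu> n a k \<phi> x NQ xq w (\<T> h) \<delta>)
            \<le> C * (Mk B k n a \<delta>\<^sub>0 * (2 * Mk B k n a \<delta>\<^sub>0) ^ Suc q) * b * disc_rate q (op_p B) (op_s B) h \<delta>"
          proof (rule C(2)[rule_format, where g = g and x = x], intro conjI)
            show "kernel_bound (Suc q) V \<Gamma> (reg_density B N n (a (\<delta> * k)) k \<delta> x) x \<delta> (op_p B - op_s B)
                (Mk B k n a \<delta>\<^sub>0 * inverse (\<delta> ^ op_order B)) (Mk B k n a \<delta>\<^sub>0) (Mk B k n a \<delta>\<^sub>0 * inverse (\<delta> ^ singular_order B))"
              using Mb[OF \<delta>] x unfolding kb_def by blast
            show "Ck_extension (Suc q) \<Gamma> \<phi> g" using g(1) by simp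
            show "\<forall>\<alpha>. length \<alpha> \<le> Suc q \<longrightarrow> (\<forall>y\<in>\<Gamma>. norm (partials \<alpha> g y) \<le> b)" using g(2) by simp
          qed (use d0 h0 mesh h x M1 HS in blast)+
          then show "norm (disc_error \<Gamma> ds B \<nu> n a k \<phi> x NQ xq w (\<T> h) \<delta>) \<le> ?X * b"
            unfolding C\<sigma>_def by (simp only: mult_ac)
        qed
        then show ?thesis by (simp add: one_def mult_ac)
      qed
      define \<mu> where "\<mu> = mu_star q m (op_p B) (op_s B)"
      define \<oo> where "\<oo> = \<mu> * reg_order m (op_p B)"
      have rates: "(\<lambda>h. disc_rate q (op_p B) (op_s B) h (c * h powr \<mu>)) \<in> \<Theta>[at_right 0](\<lambda>h. h powr \<oo>)"
        "(\<lambda>h. (c * h powr \<mu>) powr reg_order m (op_p B)) \<in> \<Theta>[at_right 0](\<lambda>h. h powr \<oo>)"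
        "(\<lambda>h. norm (reg_error \<Gamma> ds B \<nu> n a k \<phi> x (c * h powr \<mu>) +
           disc_error \<Gamma> ds B \<nu> n a k \<phi> x NQ xq w (\<T> h) (c * h powr \<mu>))) \<in> O[at 0 within H](\<lambda>h. h powr \<oo>)"
        if c: "0 < c" for c
      proof -
        note r = mu_star_rates[OF m c, of q, folded \<mu>_def, folded \<oo>_def]
        show R: "(\<lambda>h. disc_rate q (op_p B) (op_s B) h (c * h powr \<mu>)) \<in> \<Theta>[at_right 0](\<lambda>h. h powr \<oo>)" by (rule r(3))
        show D: "(\<lambda>h. (c * h powr \<mu>) powr reg_order m (op_p B)) \<in> \<Theta>[at_right 0](\<lambda>h. h powr \<oo>)" by (rule r(4))
        \<comment> \<open>For the hypersingular operator and \<open>q = 0\<close>, \<open>\<mu> < 1\<close> makes \<open>\<delta>\<close> eventually larger than \<open>h\<close>.\<close>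
        let ?P = "\<lambda>h. B = HS \<and> q = 0 \<longrightarrow> h \<le> c * h powr \<mu>"
        have P: "\<forall>\<^sub>F h in at_right 0. ?P h"
        proof (cases "B = HS \<and> q = 0")
          case True
          then have \<mu>: "0 < 1 - \<mu>" using r(2) by simp
          have "\<forall>\<^sub>F h in at_right (0::real). h powr (1 - \<mu>) < c"
            using powr_scaling_at_right[OF zero_less_one \<mu>] c unfolding filterlim_at by (auto dest: order_tendstoD(2))
          then have "\<forall>\<^sub>F h in at_right (0::real). h \<le> c * h powr \<mu>"
            using eventually_at_right_less[of "0::real"]
          proof eventually_elim
            case (elim h)
            have "h = h powr (1 - \<mu>) * h powr \<mu>" using elim by (simp add: powr_add[symmetric])
            also have "\<dots> \<le> c * h powr \<mu>" using elim by (intro mult_right_mono) auto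
            finally show ?case .
          qed
          then show ?thesis by (auto elim: eventually_mono)
        qed auto
        show "(\<lambda>h. norm (reg_error \<Gamma> ds B \<nu> n a k \<phi> x (c * h powr \<mu>) +
           disc_error \<Gamma> ds B \<nu> n a k \<phi> x NQ xq w (\<T> h) (c * h powr \<mu>))) \<in> O[at 0 within H](\<lambda>h. h powr \<oo>)"
        proof (rule total_error_rate[OF H c r(1) \<delta>\<^sub>0(1) Er D R _ P])
          fix h assume h: "h \<in> H" and s: "c * h powr \<mu> < \<delta>\<^sub>0" and p: "?P h"
          have "0 < c * h powr \<mu>" using c h H by auto
          then have "c * h powr \<mu> \<in> {0<..<\<delta>\<^sub>0}" using s by simp
          from bound[OF h this p]
          show "norm (disc_error \<Gamma> ds B \<nu> n a k \<phi> x NQ xq w (\<T> h) (c * h powr \<mu>))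
             \<le> (C * (C\<sigma> B k n a \<delta>\<^sub>0 * one B k n a \<delta>\<^sub>0 * one B k n a \<delta>\<^sub>0 * Ck_norm (q + 1) \<Gamma> \<phi>)) *
               disc_rate q (op_p B) (op_s B) h (c * h powr \<mu>)" by (simp only: mult.assoc)
        qed
      qed
      show ?case
        unfolding Let_def \<mu>_def[symmetric] \<oo>_def[symmetric]
        by (intro conjI ballI allI impI rates bound) simp_all
    qed
  qed
qed

end
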